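(* Let $d\ge1$ and $d<q<p\le+\infty$. Then there exist open subsets $\Omega^m_{p,q}$ and $\Omega^M_{p,q}$ of $\mathbb{R}^d$ such that $$\mathcal{F}_{p,q}(\Omega^m_{p,q})=m(p,q)\qquad\text{and}\qquad \mathcal{F}_{p,q}(\Omega^M_{p,q})=M(p,q),$$ and moreover the complements $\mathbb{R}^d\setminus\Omega^m_{p,q}$ and $\mathbb{R}^d\setminus\Omega^M_{p,q}$ are discrete sets with no accumulation points.
   Context: For $1\le p<\infty$ and a nonempty bounded open set $\Omega\subset\mathbb{R}^d$, $$\lambda_p(\Omega)=\inf\Big\{\frac{\int|\nabla u|^p\,dx}{\int|u|^p\,dx}\ :\ u\in W^{1,p}_0(\Omega)\setminus\{0\}\Big\},$$ where $W_0^{1,p}(\Omega)$ is the closure of $C^1_c(\Omega)$ in $W^{1,p}$ (equivalently the infimum may be taken over $u\in C^1_c(\Omega)\setminus\{0\}$). For a nonempty, possibly unbounded open set, $\lambda_p(\Omega)=\inf\{\lambda_p(A): A\subset\Omega,\ A \text{ bounded, open, nonempty}\}$. For $p=\infty$, the symbol $\lambda_\infty^{1/\infty}(\Omega)$ means $1/\rho(\Omega)$, where $\rho(\Omega)\in(0,+\infty]$ is the inradius of $\Omega$ (the supremum of the radii of balls contained in $\Omega$), with $1/\infty=0$. For $1\le q<p\le\infty$ and $\Omega$ open with $\lambda_q(\Omega)>0$ set $$\mathcal{F}_{p,q}(\Omega)=\frac{\lambda_p^{1/p}(\Omega)}{\lambda_q^{1/q}(\Omega)},$$ and define $$m(p,q)=\inf\{\mathcal{F}_{p,q}(\Omega):\Omega\subset\mathbb{R}^d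 \text{ open},\ \lambda_q(\Omega)>0\},\qquad M(p,q)=\sup\{\mathcal{F}_{p,q}(\Omega):\Omega\subset\mathbb{R}^d \text{ open},\ \lambda_q(\Omega)>0\}.$$ *)

theory Defs
  imports "HOL-Analysis.Analysis"
begin

definition grad :: "(real^'n \<Rightarrow> real) \<Rightarrow> real^'n \<Rightarrow> real^'n" where
  "grad f x = (\<chi> i. frechet_derivative f (at x) (axis i 1))"

text \<open>Elements of \<open>C\<^sup>1\<^sub>c(\<Omega>)\<close>, extended by zero to the whole space.\<close>

definition C1c :: "(real^'n) set \<Rightarrow> (real^'n \<Rightarrow> real) set" where
  "C1c \<Omega> = {f. (\<forall>x. f differentiable (at x)) \<and> continuous_on UNIV (grad f) \<and>
     compact (closure {x. f x \<noteq> 0}) \<and> closure {x. f x \<noteq> 0} \<subseteq> \<Omega>}"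

text \<open>Functions on \<open>\<Omega>\<close> are represented by total functions whose values outside \<open>\<Omega>\<close> are
  irrelevant. They are not quotiented by almost everywhere equality.\<close>

definition Lp :: "real \<Rightarrow> (real^'n) set \<Rightarrow> (real^'n \<Rightarrow> 'b::euclidean_space) set" where
  "Lp p \<Omega> = {f. set_borel_measurable lebesgue \<Omega> f \<and>
     set_integrable lebesgue \<Omega> (\<lambda>x. norm (f x) powr p)}"

definition weak_gradient :: "(real^'n) set \<Rightarrow> (real^'n \<Rightarrow> real) \<Rightarrow> (real^'n \<Rightarrow> real^'n) \<Rightarrow> bool" where
  "weak_gradient \<Omega> u g \<longleftrightarrow> (\<forall>\<phi>\<in>C1c \<Omega>.
     (LINT x:\<Omega>|lebesgue. u x *\<^sub>R grad \<phi> x) = - (LINT x:\<Omega>|lebesgue. \<phi> x *\<^sub>R g x))"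

text \<open>\<open>W\<^sup>1\<^sup>,\<^sup>p(\<Omega>)\<close>, each function being paired with a representative of its weak gradient
  (which is unique up to null sets).\<close>

definition W1p :: "real \<Rightarrow> (real^'n) set \<Rightarrow> ((real^'n \<Rightarrow> real) \<times> (real^'n \<Rightarrow> real^'n)) set" where
  "W1p p \<Omega> = {(u, g). u \<in> Lp p \<Omega> \<and> g \<in> Lp p \<Omega> \<and> weak_gradient \<Omega> u g}"

definition W1p_norm :: "real \<Rightarrow> (real^'n) set \<Rightarrow> (real^'n \<Rightarrow> real) \<Rightarrow> (real^'n \<Rightarrow> real^'n) \<Rightarrow> real" where
  "W1p_norm p \<Omega> u g =
     ((LINT x:\<Omega>|lebesgue. \<bar>u x\<bar> powr p) + (LINT x:\<Omega>|lebesgue. norm (g x) powr p)) powr (1 / p)"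

definition W1p0 :: "real \<Rightarrow> (real^'n) set \<Rightarrow> ((real^'n \<Rightarrow> real) \<times> (real^'n \<Rightarrow> real^'n)) set" where
  "W1p0 p \<Omega> = {(u, g) \<in> W1p p \<Omega>.
     \<forall>\<epsilon>>0. \<exists>\<phi>\<in>C1c \<Omega>. W1p_norm p \<Omega> (\<lambda>x. u x - \<phi> x) (\<lambda>x. g x - grad \<phi> x) < \<epsilon>}"

definition lambda_bounded :: "real \<Rightarrow> (real^'n) set \<Rightarrow> real" where
  "lambda_bounded p \<Omega> =
     Inf {(LINT x:\<Omega>|lebesgue. norm (g x) powr p) / (LINT x:\<Omega>|lebesgue. \<bar>u x\<bar> powr p) | u g.
       (u, g) \<in> W1p0 p \<Omega> \<and> \<not> (AE x in lebesgue. x \<in> \<Omega> \<longrightarrow> u x = 0)}"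

text \<open>For bounded \<open>\<Omega>\<close> this agrees with \<^const>\<open>lambda_bounded\<close>, by monotonicity under
  inclusion. Meaningful for nonempty \<open>\<Omega>\<close> only.\<close>

definition lambda :: "real \<Rightarrow> (real^'n) set \<Rightarrow> real" where
  "lambda p \<Omega> = (INF A\<in>{A. A \<subseteq> \<Omega> \<and> open A \<and> bounded A \<and> A \<noteq> {}}. lambda_bounded p A)"

definition inradius :: "(real^'n) set \<Rightarrow> ereal" where
  "inradius \<Omega> = Sup {ereal r | r. 0 < r \<and> (\<exists>x. ball x r \<subseteq> \<Omega>)}"

text \<open>\<open>\<lambda>\<^sub>p(\<Omega>)\<^sup>1\<^sup>/\<^sup>p\<close>; in \<^typ>\<open>ereal\<close>, \<open>1 / \<infinity> = 0\<close>.\<close>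

definition lambda_root :: "ereal \<Rightarrow> (real^'n) set \<Rightarrow> real" where
  "lambda_root p \<Omega> =
     (if p = \<infinity> then real_of_ereal (1 / inradius \<Omega>)
      else lambda (real_of_ereal p) \<Omega> powr (1 / real_of_ereal p))"

definition admissible :: "real \<Rightarrow> (real^'n) set set" where
  "admissible q = {\<Omega>. open \<Omega> \<and> \<Omega> \<noteq> {} \<and> lambda q \<Omega> > 0}"

definition F_ratio :: "ereal \<Rightarrow> real \<Rightarrow> (real^'n) set \<Rightarrow> real" where
  "F_ratio p q \<Omega> = lambda_root p \<Omega> / lambda_root (ereal q) \<Omega>"

text \<open>The supremum may a priori be infinite, hence extended real values. The first argument
  fixes the ambient space.\<close>

definition m_inf :: "'n::finite itself \<Rightarrow> ereal \<Rightarrow> real \<Rightarrow> ereal" where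
  "m_inf _ p q = (INF \<Omega>\<in>(admissible q :: (real^'n) set set). ereal (F_ratio p q \<Omega>))"

definition M_sup :: "'n::finite itself \<Rightarrow> ereal \<Rightarrow> real \<Rightarrow> ereal" where
  "M_sup _ p q = (SUP \<Omega>\<in>(admissible q :: (real^'n) set set). ereal (F_ratio p q \<Omega>))"

end

theory Submission
  imports Defs
begin

text \<open>The function \<open>lambda_root s\<close> scales like an inverse length and decreases when the set grows, and
  on a disjoint union of open sets it is the infimum over the pieces. This makes extremal sets easy
  to build out of extremizing sequences, with no compactness argument: let the ratios of the bounded
  open sets \<open>U n\<close> converge to the infimum, and rescale so that \<open>lambda_root q (U n) = 1\<close> for all \<open>n\<close>.
  A union of far apart copies then has \<open>lambda_root q = 1\<close>, and its \<open>lambda_root p\<close> is the infimum of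
  the ratios. For the supremum rescale to \<open>lambda_root p (U n) = 1\<close> instead; then \<open>lambda_root q (U n)\<close>
  is the inverse of the ratio, whose infimum is attained by the union in the same way.

  The complement of such a union is not discrete, and here \<open>p, q > d\<close> enters. By Morrey's inequality
  (\<open>morrey_cube\<close>) the oscillation of a function on a small cube is controlled by the \<open>s\<close>-th power
  integral of its gradient. If a function vanishes at one point of every small cube that meets the
  complement of \<open>U\<close>, it is therefore uniformly small off \<open>U\<close>, and a truncation at that small level is
  a test function for \<open>U\<close> (\<open>truncation\<close>). So a fine enough finite set of points does almost the work of
  the boundary of \<open>U\<close> (\<open>cell_bound_eventually\<close>). The loss is compensated beforehand by shrinking
  \<open>U n\<close> with a factor \<open>t n < 1\<close>, \<open>t n \<longlonglongrightarrow> 1\<close>, which raises its frequencies strictly above the limits. The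
  estimate needs no boundary condition on the faces of a surrounding cell, so that it can be summed
  over a partition of the space into bounded cells, one for each \<open>U n\<close> (\<open>discrete_gluing\<close>). Only
  finitely many points lie in each cell, whence the complement is discrete and closed.

  Two further points are needed. First, the supremum is finite: if \<open>\<Omega>\<close> contains no cube of a grid with
  side \<open>h\<close>, then Morrey's inequality on each cube yields \<open>lambda_root q \<Omega> \<ge> c / h\<close>; otherwise \<open>\<Omega>\<close>
  contains a ball of radius \<open>h / 2\<close>, which bounds \<open>lambda_root p \<Omega>\<close> from above
  (\<open>lambda_root_le_comparable\<close>). Secondly, the definition by Sobolev functions on bounded subsets is
  traded once and for all for an inequality between continuously differentiable functions of compact
  support, or between radii of balls if the exponent is infinite (\<open>le_lambda_root_iff\<close>). Everything else
  uses only these inequalities.\<close>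

section \<open>Gradients of compactly supported functions\<close>

lemma has_derivative_grad:
  fixes f :: "real^'n \<Rightarrow> real"
  assumes "f differentiable (at x)"
  shows "(f has_derivative (\<lambda>h. grad f x \<bullet> h)) (at x)"
proof -
  let ?D = "frechet_derivative f (at x)"
  have d: "(f has_derivative ?D) (at x)" using assms frechet_derivative_works by blast
  then have lin: "linear ?D" by (rule has_derivative_linear)
  have "?D h = grad f x \<bullet> h" for h
  proof -
    have "?D h = ?D (\<Sum>i\<in>UNIV. h$i *\<^sub>R axis i 1)"
      by (metis basis_expansion scalar_mult_eq_scaleR)
    also have "\<dots> = (\<Sum>i\<in>UNIV. h$i * ?D (axis i 1))"
      using lin by (simp add: linear_sum linear_cmul)
    finally show ?thesis by (simp add: grad_def inner_vec_def mult.commute)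
  qed
  then have "?D = (\<lambda>h. grad f x \<bullet> h)" by auto
  then show ?thesis using d by simp
qed

lemma grad_unique:
  fixes f :: "real^'n \<Rightarrow> real"
  assumes "(f has_derivative (\<lambda>h. v \<bullet> h)) (at x)"
  shows "grad f x = v"
proof -
  have "frechet_derivative f (at x) = (\<lambda>h. v \<bullet> h)"
    using frechet_derivative_at[OF assms] by simp
  then show ?thesis by (simp add: grad_def vec_eq_iff inner_axis)
qed

lemma C1cI:
  fixes f :: "real^'n \<Rightarrow> real"
  assumes d: "\<And>x. (f has_derivative (\<lambda>h. g x \<bullet> h)) (at x)" and g: "continuous_on UNIV g"
    and S: "compact S" "S \<subseteq> \<Omega>" "\<And>x. x \<notin> S \<Longrightarrow> f x = 0"
  shows "f \<in> C1c \<Omega>" "grad f = g"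
proof -
  show *: "grad f = g" using grad_unique[OF d] by auto
  have "closure {x. f x \<noteq> 0} \<subseteq> S"
    using S by (intro closure_minimal compact_imp_closed) auto
  moreover from this have "compact (closure {x. f x \<noteq> 0})"
    using S(1) bounded_subset by (auto simp: compact_eq_bounded_closed)
  ultimately show "f \<in> C1c \<Omega>" unfolding C1c_def
    using S * g d differentiableI[OF d] by auto
qed

lemma C1cE:
  fixes f :: "real^'n \<Rightarrow> real"
  assumes "f \<in> C1c \<Omega>"
  obtains S where "compact S" "S \<subseteq> \<Omega>" "\<And>x. x \<notin> S \<Longrightarrow> f x = 0" "\<And>x. x \<notin> S \<Longrightarrow> grad f x = 0"
proof
  let ?S = "closure {x. f x \<noteq> 0}"
  show "compact ?S" "?S \<subseteq> \<Omega>" using assms by (simp_all only: C1c_def mem_Collect_eq)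
  show z: "f x = 0" if "x \<notin> ?S" for x
    using that subsetD[OF closure_subset, of x "{x. f x \<noteq> 0}"] by (metis mem_Collect_eq)
  show "grad f x = 0" if "x \<notin> ?S" for x
  proof (rule grad_unique)
    have "((\<lambda>_. 0) has_derivative (\<lambda>h. 0 \<bullet> h)) (at x)" by simp
    then show "(f has_derivative (\<lambda>h. 0 \<bullet> h)) (at x)"
    proof (rule has_derivative_transform_within_open)
      show "open (- ?S)" "x \<in> - ?S" using that by auto
      show "0 = f y" if "y \<in> - ?S" for y
        using z[of y] that by (metis ComplD)
    qed
  qed
qed

lemma C1c_D:
  assumes "f \<in> C1c \<Omega>"
  shows "(f has_derivative (\<lambda>h. grad f x \<bullet> h)) (at x)" "continuous_on UNIV (grad f)"
    "continuous_on UNIV f"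
proof -
  show d: "(f has_derivative (\<lambda>h. grad f x \<bullet> h)) (at x)" for x
    by (rule has_derivative_grad) (use assms in \<open>simp add: C1c_def\<close>)
  show "continuous_on UNIV (grad f)" using assms by (simp only: C1c_def mem_Collect_eq)
  show "continuous_on UNIV f"
    unfolding continuous_on_eq_continuous_within using has_derivative_continuous[OF d] by blast
qed

lemma C1c_mono: "\<Omega> \<subseteq> \<Omega>' \<Longrightarrow> C1c \<Omega> \<subseteq> C1c \<Omega>'"
  unfolding C1c_def by blast

lemma continuous_absolutely_integrable:
  fixes f :: "real^'n \<Rightarrow> 'b::euclidean_space"
  assumes "continuous_on UNIV f" "bounded S" "S \<in> sets lebesgue"
  shows "f absolutely_integrable_on S"
proof -
  obtain a where a: "S \<subseteq> cbox (-a) a" using bounded_subset_cbox_symmetric assms(2) by blast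
  have "f absolutely_integrable_on cbox (-a) a"
    using assms(1) by (intro absolutely_integrable_continuous) (auto intro: continuous_on_subset)
  then show ?thesis using assms(3) a by (rule set_integrable_subset)
qed

lemma continuous_norm_powr:
  fixes f :: "'a::topological_space \<Rightarrow> 'b::real_normed_vector"
  assumes "continuous_on S f" "s > 0"
  shows "continuous_on S (\<lambda>x. norm (f x) powr s)"
  using assms by (intro continuous_on_powr' continuous_intros) auto

lemma norm_powr_integrable:
  fixes f :: "real^'n \<Rightarrow> 'b::euclidean_space"
  assumes "continuous_on UNIV f" "s > 0" "bounded S" "S \<in> sets lebesgue"
  shows "(\<lambda>x. norm (f x) powr s) absolutely_integrable_on S" "(\<lambda>x. norm (f x) powr s) integrable_on S"
proof -
  show 1: "(\<lambda>x. norm (f x) powr s) absolutely_integrable_on S"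
    by (rule continuous_absolutely_integrable[OF continuous_norm_powr[OF assms(1,2)] assms(3,4)])
  show "(\<lambda>x. norm (f x) powr s) integrable_on S" by (rule set_lebesgue_integral_eq_integral[OF 1])
qed

lemma compact_support_integrable:
  fixes f :: "real^'n \<Rightarrow> 'b::euclidean_space"
  assumes "continuous_on UNIV f" "compact S" "S \<subseteq> T" "\<And>x. x \<notin> S \<Longrightarrow> f x = 0"
  shows "f absolutely_integrable_on T" "integral T f = integral S f" "f integrable_on T"
proof -
  have 1: "f absolutely_integrable_on S"
    using assms by (intro continuous_absolutely_integrable compact_imp_bounded lmeasurable_compact fmeasurableD)
  have e: "(\<lambda>x. if x \<in> S then f x else 0) = f" "(\<lambda>x. if x \<in> T then f x else 0) = f"
    using assms(3,4) by fastforce+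
  have "f absolutely_integrable_on UNIV" using 1 absolutely_integrable_restrict_UNIV[of S f] e by simp
  then show "f absolutely_integrable_on T" using absolutely_integrable_restrict_UNIV[of T f] e by simp
  then show "f integrable_on T" by (rule set_lebesgue_integral_eq_integral)
  show "integral T f = integral S f"
    using integral_restrict_UNIV[of S f] integral_restrict_UNIV[of T f] e by simp
qed

text \<open>Translation invariance makes \<open>t \<mapsto> \<integral> f (x + t v) dx\<close> constant; differentiating under the integral
  sign at \<open>t = 0\<close> gives the claim.\<close>

lemma integral_grad_eq_0:
  fixes f :: "real^'n \<Rightarrow> real"
  assumes f: "f \<in> C1c UNIV"
  shows "integral UNIV (\<lambda>x. grad f x \<bullet> v) = 0"
proof -
  obtain S where S: "compact S" "\<And>x. x \<notin> S \<Longrightarrow> f x = 0" "\<And>x. x \<notin> S \<Longrightarrow> grad f x = 0"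
    using C1cE[OF f] by metis
  define S' where "S' = {x + y |x y. x \<in> S \<and> y \<in> cball 0 (norm v)}"
  have "compact S'" unfolding S'_def using S(1) by (intro compact_sums) auto
  then obtain a where a: "S' \<subseteq> cbox (-a) a" using bounded_subset_cbox_symmetric compact_imp_bounded by blast
  let ?B = "cbox (-a) a"
  have SB: "S \<subseteq> ?B" using a by (force simp: S'_def)
  let ?F = "\<lambda>t x. f (x + t *\<^sub>R v)"
  have cont: "continuous_on UNIV (\<lambda>x. f (x + t *\<^sub>R v))" for t
    by (intro continuous_on_compose2[OF C1c_D(3)[OF f]] continuous_intros) auto
  have const: "integral ?B (?F t) = integral S f" if t: "t \<in> cbox (-1) 1" for t
  proof -
    have "integral ?B (?F t) = integral ((\<lambda>x. x - t *\<^sub>R v) ` S) (?F t)"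
    proof (rule compact_support_integrable[OF cont])
      show "compact ((\<lambda>x. x - t *\<^sub>R v) ` S)"
        by (intro compact_continuous_image continuous_intros S)
      show "(\<lambda>x. x - t *\<^sub>R v) ` S \<subseteq> ?B"
      proof (rule image_subsetI, rule subsetD[OF a])
        fix x assume "x \<in> S"
        moreover have "norm (- (t *\<^sub>R v)) \<le> norm v"
          using t mult_right_mono[of "\<bar>t\<bar>" 1 "norm v"] by auto
        ultimately show "x - t *\<^sub>R v \<in> S'" unfolding S'_def mem_Collect_eq
          by (intro exI[of _ x] exI[of _ "- (t *\<^sub>R v)"]) auto
      qed
      show "?F t x = 0" if "x \<notin> (\<lambda>x. x - t *\<^sub>R v) ` S" for x
        proof (rule S(2))
          show "x + t *\<^sub>R v \<notin> S" using that image_eqI[of x "\<lambda>x. x - t *\<^sub>R v" "x + t *\<^sub>R v" S] by auto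
        qed
    qed
    also have "\<dots> = integral S f"
    proof -
      have "(f has_integral integral ?B f) ?B"
        using C1c_D(3)[OF f] by (intro integrable_integral integrable_continuous) (auto intro: continuous_on_subset)
      from has_integral_affinity'[OF this, of 1 "t *\<^sub>R v"]
      have "(?F t has_integral integral ?B f) (cbox (-a - t *\<^sub>R v) (a - t *\<^sub>R v))" by simp
      then have "integral (cbox (-a - t *\<^sub>R v) (a - t *\<^sub>R v)) (?F t) = integral ?B f" by (rule integral_unique)
      moreover have "integral (cbox (-a - t *\<^sub>R v) (a - t *\<^sub>R v)) (?F t) = integral ((\<lambda>x. x - t *\<^sub>R v) ` S) (?F t)"
      proof (rule compact_support_integrable[OF cont])
        show "compact ((\<lambda>x. x - t *\<^sub>R v) ` S)"
          by (intro compact_continuous_image continuous_intros S)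
        show "(\<lambda>x. x - t *\<^sub>R v) ` S \<subseteq> cbox (-a - t *\<^sub>R v) (a - t *\<^sub>R v)"
          using SB by (auto simp: mem_box_cart subset_iff)
        show "?F t x = 0" if "x \<notin> (\<lambda>x. x - t *\<^sub>R v) ` S" for x
          proof (rule S(2))
          show "x + t *\<^sub>R v \<notin> S" using that image_eqI[of x "\<lambda>x. x - t *\<^sub>R v" "x + t *\<^sub>R v" S] by auto
        qed
      qed
      moreover have "integral ?B f = integral S f"
        by (rule compact_support_integrable[OF C1c_D(3)[OF f] S(1) SB S(2)])
      ultimately show ?thesis by simp
    qed
    finally show ?thesis .
  qed
  have "((\<lambda>t. integral ?B (?F t)) has_field_derivative integral ?B (\<lambda>x. grad f (x + 0 *\<^sub>R v) \<bullet> v)) (at 0 within cbox (-1) 1)"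
  proof (rule leibniz_rule_field_derivative)
    show "((\<lambda>t. ?F t x) has_field_derivative grad f (x + t *\<^sub>R v) \<bullet> v) (at t within cbox (-1) 1)" for x t
    proof -
      have "((\<lambda>t. x + t *\<^sub>R v) has_derivative (\<lambda>h. h *\<^sub>R v)) (at t within cbox (-1) 1)"
        by (auto intro!: derivative_eq_intros)
      from has_derivative_compose[OF this C1c_D(1)[OF f]]
      show ?thesis by (simp add: has_field_derivative_def mult.commute[of _ "_ \<bullet> _"] )
    qed
    show "?F t integrable_on ?B" for t
      using cont by (intro integrable_continuous) (auto intro: continuous_on_subset)
    show "continuous_on (cbox (-1) 1 \<times> ?B) (\<lambda>(t, x). grad f (x + t *\<^sub>R v) \<bullet> v)"
      unfolding case_prod_unfold
      by (intro continuous_on_compose2[OF C1c_D(2)[OF f]] continuous_intros) auto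
  qed auto
  moreover have "((\<lambda>t. integral ?B (?F t)) has_field_derivative 0) (at 0 within cbox (-1) 1)"
    using const by (intro has_field_derivative_transform_within[OF DERIV_const[of "integral S f"], of 1]) auto
  ultimately have "integral ?B (\<lambda>x. grad f (x + 0 *\<^sub>R v) \<bullet> v) = 0"
    by (intro has_field_derivative_unique) (auto simp: trivial_limit_within islimpt_Icc)
  moreover have "integral T (\<lambda>x. grad f x \<bullet> v) = integral S (\<lambda>x. grad f x \<bullet> v)" if "S \<subseteq> T" for T
  proof (rule compact_support_integrable[OF _ S(1) that])
    show "continuous_on UNIV (\<lambda>x. grad f x \<bullet> v)"
      using C1c_D(2)[OF f] by (rule continuous_on_inner) (rule continuous_on_const)
  qed (simp add: S(3))
  from this[of UNIV] this[OF SB]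
  have "integral UNIV (\<lambda>x. grad f x \<bullet> v) = integral ?B (\<lambda>x. grad f x \<bullet> v)" by simp
  ultimately show ?thesis by simp
qed

section \<open>Integrals of powers\<close>

definition powint :: "real \<Rightarrow> (real^'n) set \<Rightarrow> (real^'n \<Rightarrow> 'b::euclidean_space) \<Rightarrow> real" where
  "powint s S f = integral S (\<lambda>x. norm (f x) powr s)"

lemma powint_nonneg: "0 \<le> powint s S f"
  unfolding powint_def
  by (cases "(\<lambda>x. norm (f x) powr s) integrable_on S")
     (auto intro: Henstock_Kurzweil_Integration.integral_nonneg simp: not_integrable_integral)

text \<open>Convexity of \<open>x \<mapsto> x powr s\<close> at \<open>a + b = (1 - t) * (a / (1 - t)) + t * (b / t)\<close>. This replaces
  Minkowski's inequality below: as \<open>t \<rightarrow> 0\<close> the factor of \<open>a powr s\<close> tends to \<open>1\<close>, so a summand \<open>b\<close>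
  that can be made small at fixed \<open>t\<close> is negligible.\<close>

lemma add_powr_le:
  fixes a b t s :: real
  assumes "0 \<le> a" "0 \<le> b" "0 < t" "t < 1" "1 \<le> s"
  shows "(a + b) powr s \<le> (1 - t) powr (1 - s) * a powr s + t powr (1 - s) * b powr s"
proof -
  have ge1: "1 \<le> r powr (1 - s)" if "0 < r" "r < 1" for r :: real
    using that assms powr_mono2'[of "1 - s" r 1] by simp
  consider "a = 0" | "b = 0" | "a > 0" "b > 0" using assms by linarith
  then show ?thesis
  proof cases
    case 1
    then show ?thesis using ge1[of t] assms mult_right_mono[of 1 "t powr (1 - s)" "b powr s"] by auto
  next
    case 2
    then show ?thesis using ge1[of "1 - t"] assms mult_right_mono[of 1 "(1-t) powr (1 - s)" "a powr s"] by auto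
  next
    case 3
    have e: "r * (c / r) powr s = r powr (1 - s) * c powr s" if "0 < r" "0 < c" for r c :: real
      using that by (simp add: powr_divide powr_diff)
    have "((1 - t) *\<^sub>R (a / (1 - t)) + t *\<^sub>R (b / t)) powr s \<le> (1 - t) * (a / (1 - t)) powr s + t * (b / t) powr s"
      using convex_onD[OF powr_convex[OF assms(5)], of t "a / (1 - t)" "b / t"] assms 3 by simp
    then show ?thesis using assms 3 e[of t b] e[of "1 - t" a] by simp
  qed
qed

lemma norm_add_powr_le:
  assumes "0 < t" "t < 1" "1 \<le> s"
  shows "norm (a + b) powr s \<le> (1 - t) powr (1 - s) * norm a powr s + t powr (1 - s) * norm b powr s"
proof -
  have "norm (a + b) powr s \<le> (norm a + norm b) powr s"
    using assms by (intro powr_mono2 norm_triangle_ineq) auto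
  also have "\<dots> \<le> (1 - t) powr (1 - s) * norm a powr s + t powr (1 - s) * norm b powr s"
    using assms by (intro add_powr_le) auto
  finally show ?thesis .
qed

lemma Lp_integrable:
  assumes "f \<in> Lp s A"
  shows "(\<lambda>x. norm (f x) powr s) absolutely_integrable_on A" "(\<lambda>x. norm (f x) powr s) integrable_on A"
    "(LINT x:A|lebesgue. norm (f x) powr s) = powint s A f"
proof -
  show 1: "(\<lambda>x. norm (f x) powr s) absolutely_integrable_on A" using assms by (simp only: Lp_def mem_Collect_eq)
  show "(\<lambda>x. norm (f x) powr s) integrable_on A"
    "(LINT x:A|lebesgue. norm (f x) powr s) = powint s A f"
    using set_lebesgue_integral_eq_integral[OF 1] by (simp_all add: powint_def)
qed

lemma Lp_diff:
  fixes f g :: "real^'n \<Rightarrow> 'b::euclidean_space"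
  assumes f: "f \<in> Lp s A" and g: "g \<in> Lp s A" and s: "1 \<le> s"
  shows "(\<lambda>x. f x - g x) \<in> Lp s A"
proof -
  have [measurable]: "(\<lambda>x. indicator A x *\<^sub>R f x) \<in> borel_measurable lebesgue"
    "(\<lambda>x. indicator A x *\<^sub>R g x) \<in> borel_measurable lebesgue"
    using f g unfolding Lp_def set_borel_measurable_def by blast+
  have e: "(\<lambda>x. indicator A x *\<^sub>R (f x - g x)) = (\<lambda>x. indicator A x *\<^sub>R f x - indicator A x *\<^sub>R g x)"
    by (simp add: scaleR_diff_right)
  have m: "set_borel_measurable lebesgue A (\<lambda>x. f x - g x)"
    unfolding set_borel_measurable_def e by measurable
  have e2: "(\<lambda>x. indicator A x *\<^sub>R norm (f x - g x) powr s) = (\<lambda>x. norm (indicator A x *\<^sub>R f x - indicator A x *\<^sub>R g x) powr s)"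
    by (auto simp: fun_eq_iff indicator_def)
  have m2: "set_borel_measurable lebesgue A (\<lambda>x. norm (f x - g x) powr s)"
    unfolding set_borel_measurable_def e2 by measurable
  let ?c = "(1/2) powr (1 - s)"
  have "set_integrable lebesgue A (\<lambda>x. ?c * norm (f x) powr s + ?c * norm (g x) powr s)"
    using Lp_integrable(1)[OF f] Lp_integrable(1)[OF g] by (intro set_integral_add set_integrable_mult_right) auto
  then have "set_integrable lebesgue A (\<lambda>x. norm (f x - g x) powr s)"
  proof (rule set_integrable_bound[OF _ m2], intro AE_I2 impI)
    fix x
    have "norm (f x + - g x) powr s \<le> ?c * norm (f x) powr s + ?c * norm (- g x) powr s"
      using norm_add_powr_le[of "1/2" s "f x" "- g x"] s by simp
    then show "norm (norm (f x - g x) powr s) \<le> norm (?c * norm (f x) powr s + ?c * norm (g x) powr s)"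
      by simp
  qed
  with m show ?thesis by (simp add: Lp_def)
qed

lemma powint_Lp_le:
  fixes f g :: "real^'n \<Rightarrow> 'b::euclidean_space"
  assumes f: "f \<in> Lp s A" and g: "g \<in> Lp s A" and s: "1 \<le> s" and t: "0 < t" "t < 1"
  shows "powint s A f \<le> (1 - t) powr (1 - s) * powint s A g + t powr (1 - s) * powint s A (\<lambda>x. f x - g x)"
proof -
  have "powint s A f \<le> integral A (\<lambda>x. (1 - t) powr (1 - s) * norm (g x) powr s + t powr (1 - s) * norm (f x - g x) powr s)"
    unfolding powint_def
  proof (rule integral_le)
    show "(\<lambda>x. norm (f x) powr s) integrable_on A" by (rule Lp_integrable(2)[OF f])
    show "(\<lambda>x. (1 - t) powr (1 - s) * norm (g x) powr s + t powr (1 - s) * norm (f x - g x) powr s) integrable_on A"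
      using Lp_integrable(2)[OF g] Lp_integrable(2)[OF Lp_diff[OF f g s]]
      by (intro integrable_add integrable_on_mult_right)
    show "norm (f x) powr s \<le> (1 - t) powr (1 - s) * norm (g x) powr s + t powr (1 - s) * norm (f x - g x) powr s" for x
      using norm_add_powr_le[OF t s, of "g x" "f x - g x"] by simp
  qed
  also have "\<dots> = (1 - t) powr (1 - s) * powint s A g + t powr (1 - s) * powint s A (\<lambda>x. f x - g x)"
    using Lp_integrable(2)[OF g] Lp_integrable(2)[OF Lp_diff[OF f g s]]
    by (simp add: Henstock_Kurzweil_Integration.integral_add integrable_on_mult_right powint_def)
  finally show ?thesis .
qed

lemma continuous_compact_support_Lp:
  fixes f :: "real^'n \<Rightarrow> 'b::euclidean_space"
  assumes f: "continuous_on UNIV f" and S: "compact S" "S \<subseteq> A" "\<And>x. x \<notin> S \<Longrightarrow> f x = 0" and s: "0 < s"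
  shows "f \<in> Lp s A" "powint s A f = powint s UNIV f" "f absolutely_integrable_on A"
proof -
  have c: "continuous_on UNIV (\<lambda>x. norm (f x) powr s)" by (rule continuous_norm_powr[OF f s])
  have z: "norm (f x) powr s = 0" if "x \<notin> S" for x using S(3)[OF that] by simp
  show fi: "f absolutely_integrable_on A" by (rule compact_support_integrable(1)[OF f S])
  have m: "set_borel_measurable lebesgue A f"
    using borel_measurable_integrable[OF fi[unfolded set_integrable_def]] unfolding set_borel_measurable_def by simp
  show "f \<in> Lp s A"
    unfolding Lp_def mem_Collect_eq
    by (intro conjI m) (rule compact_support_integrable(1)[OF c S(1,2) z])
  show "powint s A f = powint s UNIV f" unfolding powint_def
    using compact_support_integrable(2)[OF c S(1,2) z] compact_support_integrable(2)[OF c S(1) subset_UNIV z] by simp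
qed

lemma C1c_Lp:
  fixes \<phi> :: "real^'n \<Rightarrow> real"
  assumes "\<phi> \<in> C1c A" "0 < s"
  shows "\<phi> \<in> Lp s A" "grad \<phi> \<in> Lp s A" "powint s A \<phi> = powint s UNIV \<phi>"
    "powint s A (grad \<phi>) = powint s UNIV (grad \<phi>)"
proof -
  obtain S where S: "compact S" "S \<subseteq> A" "\<And>x. x \<notin> S \<Longrightarrow> \<phi> x = 0" "\<And>x. x \<notin> S \<Longrightarrow> grad \<phi> x = 0"
    using C1cE[OF assms(1)] by metis
  show "\<phi> \<in> Lp s A"
    by (rule continuous_compact_support_Lp(1)[OF C1c_D(3)[OF assms(1)] S(1-3) assms(2)])
  show "powint s A \<phi> = powint s UNIV \<phi>"
    by (rule continuous_compact_support_Lp(2)[OF C1c_D(3)[OF assms(1)] S(1-3) assms(2)])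
  show "grad \<phi> \<in> Lp s A"
    by (rule continuous_compact_support_Lp(1)[OF C1c_D(2)[OF assms(1)] S(1,2,4) assms(2)])
  show "powint s A (grad \<phi>) = powint s UNIV (grad \<phi>)"
    by (rule continuous_compact_support_Lp(2)[OF C1c_D(2)[OF assms(1)] S(1,2,4) assms(2)])
qed

text \<open>Integration by parts: the gradient of a product of two test functions has integral zero.\<close>

lemma C1c_weak_gradient:
  fixes \<phi> :: "real^'n \<Rightarrow> real"
  assumes \<phi>: "\<phi> \<in> C1c A"
  shows "weak_gradient A \<phi> (grad \<phi>)"
  unfolding weak_gradient_def
proof
  fix \<psi> :: "real^'n \<Rightarrow> real" assume \<psi>: "\<psi> \<in> C1c A"
  obtain S where S: "compact S" "S \<subseteq> A" "\<And>x. x \<notin> S \<Longrightarrow> \<phi> x = 0" "\<And>x. x \<notin> S \<Longrightarrow> grad \<phi> x = 0"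
    using C1cE[OF \<phi>] by metis
  let ?u = "\<lambda>x. \<phi> x *\<^sub>R grad \<psi> x" and ?v = "\<lambda>x. \<psi> x *\<^sub>R grad \<phi> x"
  have cu: "continuous_on UNIV ?u" and cv: "continuous_on UNIV ?v"
    using C1c_D[OF \<phi>] C1c_D[OF \<psi>] by (auto intro!: continuous_intros)
  have zu: "?u x = 0" if "x \<notin> S" for x using S(3)[OF that] by simp
  have zv: "?v x = 0" if "x \<notin> S" for x using S(4)[OF that] by simp
  have z: "?u x + ?v x = 0" if "x \<notin> S" for x by (simp only: zu[OF that] zv[OF that] add_0)
  note u = compact_support_integrable[OF cu S(1) _ zu] and v = compact_support_integrable[OF cv S(1) _ zv]
  have P: "(\<lambda>x. \<phi> x * \<psi> x) \<in> C1c UNIV" "grad (\<lambda>x. \<phi> x * \<psi> x) = (\<lambda>x. ?u x + ?v x)"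
  proof (rule_tac[!] C1cI[OF _ _ S(1) subset_UNIV])
    show "((\<lambda>x. \<phi> x * \<psi> x) has_derivative (\<lambda>h. (?u x + ?v x) \<bullet> h)) (at x)" for x
      by (rule has_derivative_eq_rhs[OF has_derivative_mult[OF C1c_D(1)[OF \<phi>] C1c_D(1)[OF \<psi>]]])
         (auto simp: inner_add_left algebra_simps)
    then show "((\<lambda>x. \<phi> x * \<psi> x) has_derivative (\<lambda>h. (?u x + ?v x) \<bullet> h)) (at x)" for x .
    show "continuous_on UNIV (\<lambda>x. ?u x + ?v x)" using cu cv by (rule continuous_on_add)
    then show "continuous_on UNIV (\<lambda>x. ?u x + ?v x)" .
    show "\<phi> x * \<psi> x = 0" if "x \<notin> S" for x using S(3)[OF that] by simp
    then show "\<phi> x * \<psi> x = 0" if "x \<notin> S" for x using that .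
  qed
  have cuv: "continuous_on UNIV (\<lambda>x. ?u x + ?v x)" using cu cv by (rule continuous_on_add)
  have "integral UNIV (\<lambda>x. ?u x + ?v x) \<bullet> w = 0" for w
  proof -
    have "integral UNIV (\<lambda>x. (?u x + ?v x) \<bullet> w) = integral UNIV (\<lambda>x. ?u x + ?v x) \<bullet> w"
      using integral_linear[OF compact_support_integrable(3)[OF cuv S(1) subset_UNIV z] bounded_linear_inner_left[of w]]
      by (simp add: o_def)
    then show ?thesis using integral_grad_eq_0[OF P(1), of w] P(2) by simp
  qed
  then have "integral UNIV (\<lambda>x. ?u x + ?v x) = 0" using inner_eq_zero_iff by blast
  then have "integral UNIV ?u + integral UNIV ?v = 0"
    using Henstock_Kurzweil_Integration.integral_add[OF u(3)[OF subset_UNIV] v(3)[OF subset_UNIV]] by simp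
  then have "integral A ?u + integral A ?v = 0"
    using u(2)[OF S(2)] u(2)[OF subset_UNIV] v(2)[OF S(2)] v(2)[OF subset_UNIV] by simp
  then show "(LINT x:A|lebesgue. ?u x) = - (LINT x:A|lebesgue. ?v x)"
    using set_lebesgue_integral_eq_integral(2)[OF u(1)[OF S(2)]] set_lebesgue_integral_eq_integral(2)[OF v(1)[OF S(2)]]
    by (simp add: eq_neg_iff_add_eq_0)
qed

lemma C1c_W1p0:
  fixes \<phi> :: "real^'n \<Rightarrow> real"
  assumes "\<phi> \<in> C1c A" "0 < s"
  shows "(\<phi>, grad \<phi>) \<in> W1p0 s A"
proof -
  have "W1p_norm s A (\<lambda>x. \<phi> x - \<phi> x) (\<lambda>x. grad \<phi> x - grad \<phi> x) = 0"
    by (simp add: W1p_norm_def set_lebesgue_integral_def)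
  then have "\<exists>\<psi>\<in>C1c A. W1p_norm s A (\<lambda>x. \<phi> x - \<psi> x) (\<lambda>x. grad \<phi> x - grad \<psi> x) < \<epsilon>" if "\<epsilon> > 0" for \<epsilon>
    using that by (intro bexI[OF _ assms(1)]) simp
  then show ?thesis
    using C1c_Lp(1,2)[OF assms] C1c_weak_gradient[OF assms(1)] by (simp add: W1p0_def W1p_def)
qed

section \<open>Rayleigh quotients of test functions\<close>

text \<open>An inequality between power integrals passes from test functions to their closure. Comparing
  \<open>u\<close> with \<open>\<phi>\<close> and \<open>grad \<phi>\<close> with \<open>g\<close> costs one factor \<open>(1 - t) powr (1 - s)\<close> each, besides an error
  that vanishes as \<open>\<phi>\<close> approaches \<open>u\<close>; the two factors disappear in the limit \<open>t \<rightarrow> 0\<close>.\<close>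

lemma W1p0_powint_ineq:
  fixes u :: "real^'n \<Rightarrow> real"
  assumes ug: "(u, g) \<in> W1p0 s A" and s: "1 \<le> s" and L: "0 \<le> L"
    and C: "\<And>\<phi>. \<phi> \<in> C1c A \<Longrightarrow> L * powint s UNIV \<phi> \<le> powint s UNIV (grad \<phi>)"
  shows "L * powint s A u \<le> powint s A g"
proof -
  have s0: "0 < s" using s by simp
  have u: "u \<in> Lp s A" and g: "g \<in> Lp s A" using ug by (auto simp: W1p0_def W1p_def)
  have main: "L * powint s A u \<le> ((1 - t) powr (1 - s))\<^sup>2 * powint s A g" if t: "0 < t" "t < 1" for t
  proof (rule field_le_epsilon)
    fix e :: real assume e: "0 < e"
    define a b where "a = (1 - t) powr (1 - s)" and "b = t powr (1 - s)"
    have ab: "0 < a" "0 < b" using t by (auto simp: a_def b_def)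
    define \<eta> where "\<eta> = e / (a * b + L * b)"
    have \<eta>: "0 < \<eta>" "(a * b + L * b) * \<eta> = e" using ab e L add_pos_nonneg[of "a * b" "L * b"] by (auto simp: \<eta>_def)
    have "\<forall>\<epsilon>>0. \<exists>\<phi>\<in>C1c A. W1p_norm s A (\<lambda>x. u x - \<phi> x) (\<lambda>x. g x - grad \<phi> x) < \<epsilon>"
      using ug by (simp add: W1p0_def)
    moreover have "0 < \<eta> powr (1 / s)" using \<eta>(1) by simp
    ultimately obtain \<phi> where \<phi>: "\<phi> \<in> C1c A" "W1p_norm s A (\<lambda>x. u x - \<phi> x) (\<lambda>x. g x - grad \<phi> x) < \<eta> powr (1 / s)"
      by blast
    note L\<phi> = C1c_Lp[OF \<phi>(1) s0]
    define E1 E2 where "E1 = powint s A (\<lambda>x. u x - \<phi> x)" and "E2 = powint s A (\<lambda>x. g x - grad \<phi> x)"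
    have "(LINT x:A|lebesgue. \<bar>u x - \<phi> x\<bar> powr s) = E1" "(LINT x:A|lebesgue. norm (g x - grad \<phi> x) powr s) = E2"
      using Lp_integrable(3)[OF Lp_diff[OF u L\<phi>(1) s]] Lp_integrable(3)[OF Lp_diff[OF g L\<phi>(2) s]]
      by (simp_all add: E1_def E2_def)
    then have "(E1 + E2) powr (1 / s) < \<eta> powr (1 / s)" using \<phi>(2) by (simp add: W1p_norm_def)
    moreover have E: "0 \<le> E1" "0 \<le> E2" by (simp_all add: E1_def E2_def powint_nonneg)
    ultimately have E12: "E1 + E2 < \<eta>"
      using powr_mono2[of "1 / s" \<eta> "E1 + E2"] s0 \<eta>(1) by (meson less_eq_real_def linorder_not_le divide_nonneg_pos zero_le_one)
    have 1: "powint s A u \<le> a * powint s UNIV \<phi> + b * E1"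
      using powint_Lp_le[OF u L\<phi>(1) s t] L\<phi>(3) by (simp add: a_def b_def E1_def)
    have "powint s A (\<lambda>x. grad \<phi> x - g x) = E2"
      by (simp add: E2_def powint_def norm_minus_commute)
    then have 2: "powint s UNIV (grad \<phi>) \<le> a * powint s A g + b * E2"
      using powint_Lp_le[OF L\<phi>(2) g s t] L\<phi>(4) by (simp add: a_def b_def)
    have "L * powint s A u \<le> L * (a * powint s UNIV \<phi> + b * E1)" using 1 L by (rule mult_left_mono)
    also have "\<dots> = a * (L * powint s UNIV \<phi>) + L * b * E1" by (simp add: algebra_simps)
    also have "\<dots> \<le> a * (a * powint s A g + b * E2) + L * b * E1"
      using order_trans[OF C[OF \<phi>(1)] 2] ab by (intro add_right_mono mult_left_mono) auto
    also have "\<dots> = a\<^sup>2 * powint s A g + (a * b * E2 + L * b * E1)" by (simp add: algebra_simps power2_eq_square)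
    also have "a * b * E2 + L * b * E1 \<le> a * b * \<eta> + L * b * \<eta>"
      using ab L E E12 by (intro add_mono mult_left_mono) auto
    also have "\<dots> = e" using \<eta>(2) by (simp add: algebra_simps)
    finally show "L * powint s A u \<le> ((1 - t) powr (1 - s))\<^sup>2 * powint s A g + e" by (simp add: a_def)
  qed
  have lim: "((\<lambda>t. ((1 - t) powr (1 - s))\<^sup>2 * powint s A g) \<longlongrightarrow> ((1 - 0) powr (1 - s))\<^sup>2 * powint s A g) (at_right 0)"
    by (intro tendsto_intros) auto
  have ev: "\<forall>\<^sub>F t in at_right 0. L * powint s A u \<le> ((1 - t) powr (1 - s))\<^sup>2 * powint s A g"
    unfolding eventually_at_right_field using main by (intro exI[of _ 1]) auto
  show ?thesis using tendsto_lowerbound[OF lim ev] by simp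
qed

lemma DERIV_max0_squared: "((\<lambda>y::real. (max 0 y)\<^sup>2) has_real_derivative 2 * max 0 y) (at y)"
proof -
  consider "y < 0" | "y > 0" | "y = 0" by linarith
  then show ?thesis
  proof cases
    case 1
    have "((\<lambda>_::real. 0) has_real_derivative 2 * max 0 y) (at y)" using 1 by simp
    then show ?thesis
      by (rule has_field_derivative_transform_within_open[of _ _ _ "{..<0}"]) (use 1 in auto)
  next
    case 2
    have "((\<lambda>y::real. y\<^sup>2) has_real_derivative 2 * max 0 y) (at y)" using 2 by (auto intro!: derivative_eq_intros)
    then show ?thesis
      by (rule has_field_derivative_transform_within_open[of _ _ _ "{0<..}"]) (use 2 in auto)
  next
    case 3
    have "((\<lambda>h::real. (max 0 h)\<^sup>2 / h) \<longlongrightarrow> 0) (at 0)"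
    proof (rule tendsto_norm_zero_cancel, rule tendsto_sandwich[of "\<lambda>_. 0" _ _ "\<lambda>h. \<bar>h\<bar>"])
      show "\<forall>\<^sub>F h::real in at 0. norm ((max 0 h)\<^sup>2 / h) \<le> \<bar>h\<bar>"
        by (rule always_eventually) (auto simp: max_def power2_eq_square)
      show "((\<lambda>h::real. \<bar>h\<bar>) \<longlongrightarrow> 0) (at 0)" by (rule tendsto_rabs_zero) (rule tendsto_ident_at)
    qed auto
    then show ?thesis using 3 by (simp add: DERIV_def)
  qed
qed

lemma C1c_bump:
  fixes A :: "(real^'n) set"
  assumes "open A" "x0 \<in> A"
  obtains \<phi> where "\<phi> \<in> C1c A" "\<phi> x0 \<noteq> 0"
proof -
  obtain r where r: "0 < r" "cball x0 r \<subseteq> A" using assms open_contains_cball by blast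
  define \<phi> where "\<phi> = (\<lambda>x. (max 0 (r\<^sup>2 - (x - x0) \<bullet> (x - x0)))\<^sup>2)"
  have "\<phi> \<in> C1c A"
  proof (rule C1cI(1)[where g="\<lambda>x. (- 4 * max 0 (r\<^sup>2 - (x - x0) \<bullet> (x - x0))) *\<^sub>R (x - x0)"])
    fix x
    have "((\<lambda>x. r\<^sup>2 - (x - x0) \<bullet> (x - x0)) has_derivative (\<lambda>h. - 2 * ((x - x0) \<bullet> h))) (at x)"
      by (auto intro!: derivative_eq_intros simp: inner_commute)
    from has_derivative_compose[OF this DERIV_max0_squared[unfolded has_field_derivative_def]]
    show "(\<phi> has_derivative (\<lambda>h. ((- 4 * max 0 (r\<^sup>2 - (x - x0) \<bullet> (x - x0))) *\<^sub>R (x - x0)) \<bullet> h)) (at x)"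
      by (simp add: \<phi>_def algebra_simps)
  next
    show "continuous_on UNIV (\<lambda>x. (- 4 * max 0 (r\<^sup>2 - (x - x0) \<bullet> (x - x0))) *\<^sub>R (x - x0))"
      by (intro continuous_intros)
    show "compact (cball x0 r)" by simp
    show "cball x0 r \<subseteq> A" by (rule r)
    fix x assume "x \<notin> cball x0 r"
    then have "r < norm (x - x0)" by (simp add: dist_norm norm_minus_commute)
    then have "r\<^sup>2 < (norm (x - x0))\<^sup>2" using r(1) by (intro power_strict_mono) auto
    then show "\<phi> x = 0" by (simp add: \<phi>_def power2_norm_eq_inner)
  qed
  moreover have "\<phi> x0 \<noteq> 0" using r(1) by (simp add: \<phi>_def)
  ultimately show ?thesis using that by blast
qed

lemma C1c_not_AE_0:
  fixes \<phi> :: "real^'n \<Rightarrow> real"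
  assumes "\<phi> \<in> C1c A" "\<phi> x0 \<noteq> 0"
  shows "\<not> (AE x in lebesgue. x \<in> A \<longrightarrow> \<phi> x = 0)"
proof
  assume "AE x in lebesgue. x \<in> A \<longrightarrow> \<phi> x = 0"
  moreover obtain S where S: "S \<subseteq> A" "\<And>x. x \<notin> S \<Longrightarrow> \<phi> x = 0" using C1cE[OF assms(1)] by metis
  ultimately have "AE x in lebesgue. \<phi> x = 0" by (elim AE_mp) (use S in auto)
  then have "{x. \<phi> x \<noteq> 0} \<in> null_sets lebesgue" by (simp add: completion.AE_iff_null_sets)
  then have "negligible {x. \<phi> x \<noteq> 0}" by (simp add: negligible_iff_null_sets)
  moreover have "open {x. \<phi> x \<noteq> 0}"
    using open_Collect_neq[OF C1c_D(3)[OF assms(1)] continuous_on_const] by simp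
  ultimately show False using open_not_negligible assms(2) by blast
qed

lemma powint_pos:
  assumes "u \<in> Lp s A" "\<not> (AE x in lebesgue. x \<in> A \<longrightarrow> u x = 0)" 
  shows "0 < powint s A u"
proof -
  have "powint s A u \<noteq> 0"
  proof
    assume "powint s A u = 0"
    then have "(LINT x:A|lebesgue. norm (u x) powr s) = 0" using Lp_integrable(3)[OF assms(1)] by simp
    moreover have "integrable lebesgue (\<lambda>x. indicat_real A x *\<^sub>R norm (u x) powr s)"
      using Lp_integrable(1)[OF assms(1)] by (simp only: set_integrable_def)
    ultimately have "AE x in lebesgue. indicat_real A x *\<^sub>R norm (u x) powr s = 0"
      unfolding set_lebesgue_integral_def by (subst (asm) integral_nonneg_eq_0_iff_AE) auto
    then have "AE x in lebesgue. x \<in> A \<longrightarrow> u x = 0"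
      by (elim AE_mp) (auto simp: indicator_def)
    then show False using assms(2) by simp
  qed
  then show ?thesis using powint_nonneg[of s A u] by simp
qed

text \<open>The bump function shows that the infimum extends over a nonempty set; over the empty set it would be
  an unspecified real number.\<close>

lemma lambda_bounded_ge:
  fixes A :: "(real^'n) set"
  assumes A: "open A" "A \<noteq> {}" and s: "1 \<le> s" and L: "0 \<le> L"
    and C: "\<And>\<phi>. \<phi> \<in> C1c A \<Longrightarrow> L * powint s UNIV \<phi> \<le> powint s UNIV (grad \<phi>)"
  shows "L \<le> lambda_bounded s A"
  unfolding lambda_bounded_def
proof (rule cInf_greatest)
  obtain x0 where "x0 \<in> A" using A by blast
  then obtain \<phi> where "\<phi> \<in> C1c A" "\<phi> x0 \<noteq> 0" using C1c_bump A by blast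
  then have "(\<phi>, grad \<phi>) \<in> W1p0 s A \<and> \<not> (AE x in lebesgue. x \<in> A \<longrightarrow> \<phi> x = 0)"
    using C1c_W1p0[of \<phi> A s] C1c_not_AE_0[of \<phi> A x0] s by auto
  then show "{(LINT x:A|lebesgue. norm (g x) powr s) / (LINT x:A|lebesgue. \<bar>u x\<bar> powr s) | u g.
       (u, g) \<in> W1p0 s A \<and> \<not> (AE x in lebesgue. x \<in> A \<longrightarrow> u x = 0)} \<noteq> {}" by blast
next
  fix y assume "y \<in> {(LINT x:A|lebesgue. norm (g x) powr s) / (LINT x:A|lebesgue. \<bar>u x\<bar> powr s) | u g.
       (u, g) \<in> W1p0 s A \<and> \<not> (AE x in lebesgue. x \<in> A \<longrightarrow> u x = 0)}"
  then obtain u g where y: "y = (LINT x:A|lebesgue. norm (g x) powr s) / (LINT x:A|lebesgue. \<bar>u x\<bar> powr s)"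
    and ug: "(u, g) \<in> W1p0 s A" and nz: "\<not> (AE x in lebesgue. x \<in> A \<longrightarrow> u x = 0)" by blast
  have u: "u \<in> Lp s A" and g: "g \<in> Lp s A" using ug by (auto simp: W1p0_def W1p_def)
  have "y = powint s A g / powint s A u"
    using y Lp_integrable(3)[OF u] Lp_integrable(3)[OF g] by simp
  then show "L \<le> y"
    using W1p0_powint_ineq[OF ug s L C] powint_pos[OF u nz] by (simp add: pos_le_divide_eq)
qed

text \<open>A test function competes in the infimum, paired with its classical gradient.\<close>

lemma lambda_bounded_le:
  fixes A :: "(real^'n) set"
  assumes "\<phi> \<in> C1c A" "\<phi> x0 \<noteq> 0" and s: "1 \<le> s"
  shows "lambda_bounded s A * powint s UNIV \<phi> \<le> powint s UNIV (grad \<phi>)"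
proof -
  let ?X = "{(LINT x:A|lebesgue. norm (g x) powr s) / (LINT x:A|lebesgue. \<bar>u x\<bar> powr s) | u g.
       (u, g) \<in> W1p0 s A \<and> \<not> (AE x in lebesgue. x \<in> A \<longrightarrow> u x = 0)}"
  have s0: "0 < s" using s by simp
  note L = C1c_Lp[OF assms(1) s0] and N = C1c_not_AE_0[OF assms(1,2)]
  have "lambda_bounded s A \<le> (LINT x:A|lebesgue. norm (grad \<phi> x) powr s) / (LINT x:A|lebesgue. \<bar>\<phi> x\<bar> powr s)"
    unfolding lambda_bounded_def
  proof (rule cInf_lower)
    show "(LINT x:A|lebesgue. norm (grad \<phi> x) powr s) / (LINT x:A|lebesgue. \<bar>\<phi> x\<bar> powr s) \<in> ?X"
      using C1c_W1p0[OF assms(1) s0] N by blast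
    have "0 \<le> y" if "y \<in> ?X" for y
    proof -
      from that obtain u :: "real^'n \<Rightarrow> real" and g :: "real^'n \<Rightarrow> real^'n" where y: "y = (LINT x:A|lebesgue. norm (g x) powr s) / (LINT x:A|lebesgue. \<bar>u x\<bar> powr s)" by auto
      show ?thesis unfolding y set_lebesgue_integral_def
        by (intro divide_nonneg_nonneg integral_nonneg_AE AE_I2) (auto simp: indicator_def)
    qed
    then show "bdd_below ?X" by (rule bdd_belowI)
  qed
  also have "\<dots> = powint s UNIV (grad \<phi>) / powint s UNIV \<phi>"
    using Lp_integrable(3)[OF L(1)] Lp_integrable(3)[OF L(2)] L(3,4) by simp
  finally show ?thesis using powint_pos[OF L(1) N] L(3) by (simp add: pos_le_divide_eq)
qed

lemma powint_0: "powint s S (\<lambda>x. 0) = 0"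
  by (simp add: powint_def)

text \<open>A test function on \<open>\<Omega>\<close> lives on a bounded open subset of \<open>\<Omega>\<close>, namely the intersection with a
  large ball. So the infimum over bounded subsets sees exactly the test functions on \<open>\<Omega>\<close>.\<close>

lemma le_lambda_iff:
  fixes \<Omega> :: "(real^'n) set"
  assumes \<Omega>: "open \<Omega>" "\<Omega> \<noteq> {}" and s: "1 \<le> s" and L: "0 \<le> L"
  shows "L \<le> lambda s \<Omega> \<longleftrightarrow> (\<forall>\<phi>\<in>C1c \<Omega>. L * powint s UNIV \<phi> \<le> powint s UNIV (grad \<phi>))"
proof
  let ?F = "{A. A \<subseteq> \<Omega> \<and> open A \<and> bounded A \<and> A \<noteq> {}}"
  have bdd: "bdd_below (lambda_bounded s ` ?F)"
    by (rule bdd_belowI2[of _ 0], rule lambda_bounded_ge) (use s in \<open>auto intro: powint_nonneg\<close>)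
  assume lam: "L \<le> lambda s \<Omega>"
  show "\<forall>\<phi>\<in>C1c \<Omega>. L * powint s UNIV \<phi> \<le> powint s UNIV (grad \<phi>)"
  proof
    fix \<phi> assume \<phi>: "\<phi> \<in> C1c \<Omega>"
    show "L * powint s UNIV \<phi> \<le> powint s UNIV (grad \<phi>)"
    proof (cases "\<exists>x0. \<phi> x0 \<noteq> 0")
      case False
      then have "\<phi> = (\<lambda>x. 0)" by auto
      then show ?thesis using powint_nonneg[of s UNIV "grad \<phi>"] by (simp add: powint_0)
    next
      case True
      then obtain x0 where x0: "\<phi> x0 \<noteq> 0" by blast
      obtain S where S: "compact S" "S \<subseteq> \<Omega>" "\<And>x. x \<notin> S \<Longrightarrow> \<phi> x = 0" using C1cE[OF \<phi>] by metis
      obtain r where r: "S \<subseteq> ball 0 r" using bounded_subset_ballD[OF compact_imp_bounded[OF S(1)]] by blast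
      define A where "A = \<Omega> \<inter> ball 0 r"
      have SA: "S \<subseteq> A" using r S(2) by (simp add: A_def)
      have A: "A \<in> ?F"
        using \<Omega> SA S(3) x0 by (auto simp: A_def open_Int bounded_Int)
      have \<phi>A: "\<phi> \<in> C1c A"
        using C1cI(1)[OF C1c_D(1,2)[OF \<phi>] S(1) SA S(3)] .
      have "L \<le> lambda_bounded s A"
        using lam cINF_lower[OF bdd A] by (simp add: lambda_def)
      then have "L * powint s UNIV \<phi> \<le> lambda_bounded s A * powint s UNIV \<phi>"
        by (rule mult_right_mono) (rule powint_nonneg)
      also have "\<dots> \<le> powint s UNIV (grad \<phi>)" by (rule lambda_bounded_le[OF \<phi>A x0 s])
      finally show ?thesis .
    qed
  qed
next
  let ?F = "{A. A \<subseteq> \<Omega> \<and> open A \<and> bounded A \<and> A \<noteq> {}}"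
  assume C: "\<forall>\<phi>\<in>C1c \<Omega>. L * powint s UNIV \<phi> \<le> powint s UNIV (grad \<phi>)"
  show "L \<le> lambda s \<Omega>" unfolding lambda_def
  proof (rule cINF_greatest)
    obtain x0 where "x0 \<in> \<Omega>" using \<Omega> by blast
    then obtain r where "0 < r" "ball x0 r \<subseteq> \<Omega>" using \<Omega>(1) open_contains_ball by blast
    then have "ball x0 r \<in> ?F" by auto
    then show "?F \<noteq> {}" by blast
    fix A assume A: "A \<in> ?F"
    then have "C1c A \<subseteq> C1c \<Omega>" by (intro C1c_mono) blast
    then show "L \<le> lambda_bounded s A" using A C s L by (intro lambda_bounded_ge) auto
  qed
qed

section \<open>Frequency bounds\<close>

text \<open>For \<open>s = \<infinity>\<close> the balls contained in \<open>\<Omega>\<close> take the part of the test functions. With this common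
  description of \<open>lambda_root\<close> the finite and the infinite exponent can be treated together.\<close>

definition freq_bound :: "ereal \<Rightarrow> real \<Rightarrow> (real^'n) set \<Rightarrow> bool" where
  "freq_bound s a \<Omega> \<longleftrightarrow>
     (if s = \<infinity> then \<forall>x r. 0 < r \<longrightarrow> ball x r \<subseteq> \<Omega> \<longrightarrow> a * r \<le> 1
      else \<forall>\<phi>\<in>C1c \<Omega>. a powr real_of_ereal s * powint (real_of_ereal s) UNIV \<phi>
             \<le> powint (real_of_ereal s) UNIV (grad \<phi>))"

lemma open_contains_some_ball:
  fixes \<Omega> :: "(real^'n) set"
  assumes "open \<Omega>" "\<Omega> \<noteq> {}"
  obtains x r where "0 < r" "ball x r \<subseteq> \<Omega>"
proof -
  obtain x where "x \<in> \<Omega>" using assms by blast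
  then obtain r where "0 < r" "ball x r \<subseteq> \<Omega>" using assms(1) open_contains_ball by blast
  then show ?thesis using that by blast
qed

lemma le_inverse_inradius_iff:
  fixes \<Omega> :: "(real^'n) set"
  assumes \<Omega>: "open \<Omega>" "\<Omega> \<noteq> {}" and a: "0 \<le> a"
  shows "a \<le> real_of_ereal (1 / inradius \<Omega>) \<longleftrightarrow> (\<forall>x r. 0 < r \<longrightarrow> ball x r \<subseteq> \<Omega> \<longrightarrow> a * r \<le> 1)"
proof -
  have le: "ereal r \<le> inradius \<Omega>" if "0 < r" "ball x r \<subseteq> \<Omega>" for x r
    unfolding inradius_def by (rule Sup_upper) (use that in auto)
  obtain x0 r0 where r0: "0 < r0" "ball x0 r0 \<subseteq> \<Omega>" using open_contains_some_ball[OF \<Omega>] .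
  have pos: "0 < inradius \<Omega>" using le[OF r0] r0(1) by (metis ereal_less(2) order_less_le_trans)
  have bnd: "inradius \<Omega> \<le> ereal (1 / a)"
    if "0 < a" and H: "\<forall>x r. 0 < r \<longrightarrow> ball x r \<subseteq> \<Omega> \<longrightarrow> a * r \<le> 1"
    unfolding inradius_def
  proof (rule Sup_least)
    fix y assume "y \<in> {ereal r | r. 0 < r \<and> (\<exists>x. ball x r \<subseteq> \<Omega>)}"
    then obtain r x where r: "y = ereal r" "0 < r" "ball x r \<subseteq> \<Omega>" by blast
    then have "a * r \<le> 1" using H by blast
    then show "y \<le> ereal (1 / a)" using r(1) \<open>0 < a\<close> by (simp add: pos_le_divide_eq mult.commute)
  qed
  show ?thesis
  proof (cases "inradius \<Omega>")
    case PInf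
    then have "\<not> (\<forall>x r. 0 < r \<longrightarrow> ball x r \<subseteq> \<Omega> \<longrightarrow> a * r \<le> 1)" if "0 < a" using bnd[OF that] by auto
    then show ?thesis using PInf a by (cases "a = 0") auto
  next
    case (real i)
    then have i: "0 < i" using pos by simp
    have "(\<forall>x r. 0 < r \<longrightarrow> ball x r \<subseteq> \<Omega> \<longrightarrow> a * r \<le> 1) \<longleftrightarrow> a * i \<le> 1"
    proof
      assume H: "\<forall>x r. 0 < r \<longrightarrow> ball x r \<subseteq> \<Omega> \<longrightarrow> a * r \<le> 1"
      show "a * i \<le> 1"
      proof (cases "a = 0")
        case False
        then show ?thesis using bnd[OF _ H] real a by (simp add: pos_le_divide_eq mult.commute)
      qed simp
    next
      assume H: "a * i \<le> 1"
      show "\<forall>x r. 0 < r \<longrightarrow> ball x r \<subseteq> \<Omega> \<longrightarrow> a * r \<le> 1"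
      proof (intro allI impI)
        fix x r assume "0 < r" "ball x r \<subseteq> \<Omega>"
        then have "r \<le> i" using le[of r x] real by simp
        then show "a * r \<le> 1" using H mult_left_mono[of r i a] a by simp
      qed
    qed
    moreover have "real_of_ereal (1 / inradius \<Omega>) = 1 / i"
      using real i by (simp add: one_ereal_def)
    ultimately show ?thesis using i by (simp add: pos_le_divide_eq)
  qed (use pos in auto)
qed

lemma le_lambda_root_iff:
  fixes \<Omega> :: "(real^'n) set"
  assumes \<Omega>: "open \<Omega>" "\<Omega> \<noteq> {}" and s: "1 \<le> s" and a: "0 \<le> a"
  shows "a \<le> lambda_root s \<Omega> \<longleftrightarrow> freq_bound s a \<Omega>"
proof (cases s)
  case PInf
  then show ?thesis using le_inverse_inradius_iff[OF \<Omega> a] by (simp add: lambda_root_def freq_bound_def)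
next
  case (real \<sigma>)
  then have \<sigma>: "1 \<le> \<sigma>" using s by simp
  have l: "0 \<le> lambda \<sigma> \<Omega>" using le_lambda_iff[OF \<Omega> \<sigma>, of 0] powint_nonneg by auto
  have "a \<le> lambda \<sigma> \<Omega> powr (1 / \<sigma>) \<longleftrightarrow> a powr \<sigma> \<le> lambda \<sigma> \<Omega>"
  proof
    assume "a \<le> lambda \<sigma> \<Omega> powr (1 / \<sigma>)"
    then have "a powr \<sigma> \<le> (lambda \<sigma> \<Omega> powr (1 / \<sigma>)) powr \<sigma>" using a \<sigma> by (intro powr_mono2) auto
    then show "a powr \<sigma> \<le> lambda \<sigma> \<Omega>" using l \<sigma> by (simp add: powr_powr)
  next
    assume "a powr \<sigma> \<le> lambda \<sigma> \<Omega>"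
    then have "(a powr \<sigma>) powr (1 / \<sigma>) \<le> lambda \<sigma> \<Omega> powr (1 / \<sigma>)" using \<sigma> by (intro powr_mono2) auto
    then show "a \<le> lambda \<sigma> \<Omega> powr (1 / \<sigma>)" using a \<sigma> by (simp add: powr_powr)
  qed
  then show ?thesis using real le_lambda_iff[OF \<Omega> \<sigma>, of "a powr \<sigma>"]
    by (simp add: lambda_root_def freq_bound_def)
qed (use s in auto)

lemma freq_bound_0: "freq_bound s 0 \<Omega>"
  by (simp add: freq_bound_def powint_nonneg)

lemma lambda_root_nonneg:
  assumes "open \<Omega>" "\<Omega> \<noteq> {}" "1 \<le> s"
  shows "0 \<le> lambda_root s \<Omega>"
  using le_lambda_root_iff[OF assms, of 0] freq_bound_0 by simp

lemma freq_bound_antimono: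
  assumes "freq_bound s a \<Omega>" "A \<subseteq> \<Omega>"
  shows "freq_bound s a A"
proof (cases "s = \<infinity>")
  case True
  then show ?thesis using assms unfolding freq_bound_def by (metis order_trans)
next
  case False
  then show ?thesis using assms C1c_mono[OF assms(2)] unfolding freq_bound_def by auto
qed

lemma lambda_root_antimono:
  assumes "open A" "A \<noteq> {}" "open \<Omega>" "A \<subseteq> \<Omega>" "1 \<le> s"
  shows "lambda_root s \<Omega> \<le> lambda_root s A"
proof -
  have "\<Omega> \<noteq> {}" using assms by blast
  have n: "0 \<le> lambda_root s \<Omega>" by (rule lambda_root_nonneg) (use assms in auto)
  have "freq_bound s (lambda_root s \<Omega>) \<Omega>" using le_lambda_root_iff[of \<Omega> s "lambda_root s \<Omega>"] assms n by auto
  then show ?thesis using freq_bound_antimono[OF _ assms(4)] le_lambda_root_iff[of A s "lambda_root s \<Omega>"] n assms by blast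
qed

text \<open>A frequency bound can only fail at a function of compact support or at a ball, and either of
  them is visible in a bounded subset.\<close>

lemma lambda_root_bounded_subset:
  fixes \<Omega> :: "(real^'n) set"
  assumes \<Omega>: "open \<Omega>" "\<Omega> \<noteq> {}" and s: "1 \<le> s" and a: "lambda_root s \<Omega> < a"
  obtains A where "A \<subseteq> \<Omega>" "open A" "bounded A" "A \<noteq> {}" "lambda_root s A < a"
proof -
  have a0: "0 \<le> a" using lambda_root_nonneg[OF \<Omega> s] a by simp
  have "\<not> freq_bound s a \<Omega>" using le_lambda_root_iff[OF \<Omega> s a0] a by simp
  moreover obtain x0 r0 where r0: "0 < r0" "ball x0 r0 \<subseteq> \<Omega>" using open_contains_some_ball[OF \<Omega>] .
  ultimately have "\<exists>A. A \<subseteq> \<Omega> \<and> open A \<and> bounded A \<and> A \<noteq> {} \<and> \<not> freq_bound s a A"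
  proof (cases "s = \<infinity>")
    case True
    with \<open>\<not> freq_bound s a \<Omega>\<close> obtain x r where "0 < r" "ball x r \<subseteq> \<Omega>" "\<not> a * r \<le> 1"
      by (auto simp: freq_bound_def)
    then show ?thesis using True by (intro exI[of _ "ball x r"]) (auto simp: freq_bound_def)
  next
    case False
    with \<open>\<not> freq_bound s a \<Omega>\<close> obtain \<phi> where \<phi>: "\<phi> \<in> C1c \<Omega>"
      and n: "\<not> a powr real_of_ereal s * powint (real_of_ereal s) UNIV \<phi> \<le> powint (real_of_ereal s) UNIV (grad \<phi>)"
      by (auto simp: freq_bound_def)
    obtain S where S: "compact S" "S \<subseteq> \<Omega>" "\<And>x. x \<notin> S \<Longrightarrow> \<phi> x = 0" using C1cE[OF \<phi>] by metis
    obtain r where r: "S \<subseteq> ball 0 r" using bounded_subset_ballD[OF compact_imp_bounded[OF S(1)]] by blast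
    \<comment> \<open>Adding the ball around \<open>x0\<close> makes it evident that the set is nonempty.\<close>
    have "S \<subseteq> \<Omega> \<inter> ball 0 r \<union> ball x0 r0" using r S(2) by blast
    then have "\<phi> \<in> C1c (\<Omega> \<inter> ball 0 r \<union> ball x0 r0)"
      using C1cI(1)[OF C1c_D(1,2)[OF \<phi>] S(1) _ S(3)] by blast
    then show ?thesis using False n r0 \<Omega>
      by (intro exI[of _ "\<Omega> \<inter> ball 0 r \<union> ball x0 r0"]) (auto simp: freq_bound_def bounded_Int)
  qed
  then obtain A where A: "A \<subseteq> \<Omega>" "open A" "bounded A" "A \<noteq> {}" "\<not> freq_bound s a A" by blast
  then have "lambda_root s A < a" using le_lambda_root_iff[OF A(2,4) s a0] by simp
  with A show ?thesis using that by blast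
qed

lemma integral_UNIV_affinity:
  fixes f :: "real^'n \<Rightarrow> real"
  assumes f: "continuous_on UNIV f" and S: "compact S" "\<And>x. x \<notin> S \<Longrightarrow> f x = 0" and t: "0 < t"
  shows "integral UNIV (\<lambda>x. f (t *\<^sub>R x + c)) = integral UNIV f / t ^ CARD('n)"
proof -
  obtain b where b: "S \<subseteq> cbox (-b) b" using bounded_subset_cbox_symmetric compact_imp_bounded[OF S(1)] by blast
  have z: "f x = 0" if "x \<notin> cbox (-b) b" for x using S(2) b that by blast
  have "(f has_integral integral (cbox (-b) b) f) (cbox (-b) b)"
    using f by (intro integrable_integral integrable_continuous) (auto intro: continuous_on_subset)
  then have 1: "((\<lambda>x. f (t *\<^sub>R x + c)) has_integral (integral (cbox (-b) b) f /\<^sub>R t ^ DIM(real^'n)))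
           (cbox ((-b - c) /\<^sub>R t) ((b - c) /\<^sub>R t))" using t by (rule has_integral_affinity')
  have 2: "((\<lambda>x. f (t *\<^sub>R x + c)) has_integral (integral (cbox (-b) b) f /\<^sub>R t ^ DIM(real^'n))) UNIV"
  proof (rule has_integral_on_superset[OF 1])
    fix x assume x: "x \<notin> cbox ((-b - c) /\<^sub>R t) ((b - c) /\<^sub>R t)"
    show "f (t *\<^sub>R x + c) = 0"
    proof (rule z, rule notI)
      assume "t *\<^sub>R x + c \<in> cbox (-b) b"
      then have "- (b$i) \<le> t * x$i + c$i \<and> t * x$i + c$i \<le> b$i" for i by (simp add: mem_box_cart)
      then have "x \<in> cbox ((-b - c) /\<^sub>R t) ((b - c) /\<^sub>R t)"
        using t by (auto simp: mem_box_cart field_simps)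
      then show False using x by simp
    qed
  qed simp
  have "integral (cbox (-b) b) f = integral UNIV f"
    by (rule integral_spike_set) (use z in \<open>auto intro: negligible_subset[OF negligible_empty]\<close>)
  with 2 show ?thesis by (simp add: integral_unique divide_inverse mult.commute)
qed

text \<open>For finite \<open>s\<close>, composing with the affine map divides \<open>\<integral> \<bar>\<phi>\<bar>\<^sup>s\<close> by \<open>t ^ d\<close> and multiplies the integral of
  the gradient by \<open>t powr s / t ^ d\<close>.\<close>

lemma freq_bound_affinity:
  fixes \<Omega> :: "(real^'n) set"
  assumes B: "freq_bound s a \<Omega>" and t: "0 < t" and a: "0 \<le> a" and s: "1 \<le> s"
  shows "freq_bound s (a / t) ((\<lambda>x. t *\<^sub>R x + c) ` \<Omega>)"
proof (cases s)
  case PInf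
  have "a / t * r \<le> 1" if r: "0 < r" "ball x r \<subseteq> (\<lambda>x. t *\<^sub>R x + c) ` \<Omega>" for x r
  proof -
    have "ball ((x - c) /\<^sub>R t) (r / t) \<subseteq> \<Omega>"
    proof
      fix y assume y: "y \<in> ball ((x - c) /\<^sub>R t) (r / t)"
      have "x - (t *\<^sub>R y + c) = t *\<^sub>R ((x - c) /\<^sub>R t - y)" using t by (simp add: algebra_simps)
      then have "dist x (t *\<^sub>R y + c) = t * dist ((x - c) /\<^sub>R t) y" using t by (simp add: dist_norm)
      also have "\<dots> < r" using y t by (simp add: field_simps)
      finally have "t *\<^sub>R y + c \<in> (\<lambda>x. t *\<^sub>R x + c) ` \<Omega>" using r(2) by (auto simp: subset_iff)
      then show "y \<in> \<Omega>" using t by auto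
    qed
    moreover have "\<forall>x r. 0 < r \<longrightarrow> ball x r \<subseteq> \<Omega> \<longrightarrow> a * r \<le> 1" using B PInf by (simp add: freq_bound_def)
    ultimately have "a * (r / t) \<le> 1" using r(1) t divide_pos_pos by blast
    then show ?thesis by simp
  qed
  then show ?thesis using PInf by (simp add: freq_bound_def)
next
  case (real \<sigma>)
  then have \<sigma>: "1 \<le> \<sigma>" "0 < \<sigma>" using s by auto
  have "(a / t) powr \<sigma> * powint \<sigma> UNIV \<phi> \<le> powint \<sigma> UNIV (grad \<phi>)"
    if \<phi>: "\<phi> \<in> C1c ((\<lambda>x. t *\<^sub>R x + c) ` \<Omega>)" for \<phi>
  proof -
    obtain S where S: "compact S" "S \<subseteq> (\<lambda>x. t *\<^sub>R x + c) ` \<Omega>" "\<And>x. x \<notin> S \<Longrightarrow> \<phi> x = 0" "\<And>x. x \<notin> S \<Longrightarrow> grad \<phi> x = 0"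
      using C1cE[OF \<phi>] by metis
    define \<psi> where "\<psi> = (\<lambda>x. \<phi> (t *\<^sub>R x + c))"
    have comp: "\<psi> \<in> C1c \<Omega>" "grad \<psi> = (\<lambda>x. t *\<^sub>R grad \<phi> (t *\<^sub>R x + c))"
    proof -
      have d: "(\<psi> has_derivative (\<lambda>h. (t *\<^sub>R grad \<phi> (t *\<^sub>R x + c)) \<bullet> h)) (at x)" for x
      proof -
        have "((\<lambda>x. t *\<^sub>R x + c) has_derivative (\<lambda>h. t *\<^sub>R h)) (at x)" by (auto intro!: derivative_eq_intros)
        from has_derivative_compose[OF this C1c_D(1)[OF \<phi>]] show ?thesis by (simp add: \<psi>_def)
      qed
      have co: "continuous_on UNIV (\<lambda>x. t *\<^sub>R grad \<phi> (t *\<^sub>R x + c))"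
        by (intro continuous_intros continuous_on_compose2[OF C1c_D(2)[OF \<phi>]]) auto
      let ?S = "(\<lambda>y. (y - c) /\<^sub>R t) ` S"
      have c: "compact ?S" by (intro compact_continuous_image continuous_intros S(1))
      have sub: "?S \<subseteq> \<Omega>"
      proof (rule image_subsetI)
        fix y assume "y \<in> S"
        then obtain x where "x \<in> \<Omega>" "y = t *\<^sub>R x + c" using S(2) by blast
        then show "(y - c) /\<^sub>R t \<in> \<Omega>" using t by simp
      qed
      have z: "\<psi> x = 0" if "x \<notin> ?S" for x
      proof -
        have "x = (t *\<^sub>R x + c - c) /\<^sub>R t" using t by simp
        then have "t *\<^sub>R x + c \<notin> S" using that by blast
        then show ?thesis using S(3) by (simp add: \<psi>_def)
      qed
      show "\<psi> \<in> C1c \<Omega>" "grad \<psi> = (\<lambda>x. t *\<^sub>R grad \<phi> (t *\<^sub>R x + c))"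
        using C1cI[OF d co c sub z] by blast+
    qed
    let ?d = "t ^ CARD('n)"
    have 1: "powint \<sigma> UNIV \<psi> = powint \<sigma> UNIV \<phi> / ?d"
      unfolding powint_def \<psi>_def
      by (rule integral_UNIV_affinity[OF continuous_norm_powr[OF C1c_D(3)[OF \<phi>] \<sigma>(2)] S(1) _ t]) (simp add: S(3))
    have "powint \<sigma> UNIV (grad \<psi>) = t powr \<sigma> * integral UNIV (\<lambda>x. norm (grad \<phi> (t *\<^sub>R x + c)) powr \<sigma>)"
      using t by (simp add: powint_def comp(2) powr_mult)
    also have "integral UNIV (\<lambda>x. norm (grad \<phi> (t *\<^sub>R x + c)) powr \<sigma>) = powint \<sigma> UNIV (grad \<phi>) / ?d"
      unfolding powint_def
      by (rule integral_UNIV_affinity[OF continuous_norm_powr[OF C1c_D(2)[OF \<phi>] \<sigma>(2)] S(1) _ t]) (simp add: S(4))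
    finally have 2: "powint \<sigma> UNIV (grad \<psi>) = t powr \<sigma> * powint \<sigma> UNIV (grad \<phi>) / ?d" by simp
    have "a powr \<sigma> * powint \<sigma> UNIV \<psi> \<le> powint \<sigma> UNIV (grad \<psi>)"
      using B comp(1) real by (simp add: freq_bound_def)
    then have "a powr \<sigma> * powint \<sigma> UNIV \<phi> \<le> t powr \<sigma> * powint \<sigma> UNIV (grad \<phi>)"
      using t unfolding 1 2 by (simp add: divide_right_mono_neg field_simps)
    then show ?thesis using t a by (simp add: powr_divide field_simps)
  qed
  then show ?thesis using real by (simp add: freq_bound_def)
qed (use s in auto)

text \<open>The previous lemma for the map and for its inverse.\<close>

lemma lambda_root_affinity:
  fixes \<Omega> :: "(real^'n) set"
  assumes \<Omega>: "open \<Omega>" "\<Omega> \<noteq> {}" and s: "1 \<le> s" and t: "0 < t"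
  shows "lambda_root s ((\<lambda>x. t *\<^sub>R x + c) ` \<Omega>) = lambda_root s \<Omega> / t"
proof -
  have le: "lambda_root s \<Omega> / t \<le> lambda_root s ((\<lambda>x. t *\<^sub>R x + c) ` \<Omega>)"
    if "open \<Omega>" "\<Omega> \<noteq> {}" "0 < t" for \<Omega> :: "(real^'n) set" and t c
  proof -
    have o: "open ((\<lambda>x. t *\<^sub>R x + c) ` \<Omega>)" using open_affinity[OF that(1), of t c] that(3) by (simp add: add.commute)
    have n: "0 \<le> lambda_root s \<Omega>" by (rule lambda_root_nonneg[OF that(1,2) s])
    have "freq_bound s (lambda_root s \<Omega>) \<Omega>" using le_lambda_root_iff[OF that(1,2) s n] by simp
    from freq_bound_affinity[OF this that(3) n s, of c]
    show ?thesis using le_lambda_root_iff[OF o _ s, of "lambda_root s \<Omega> / t"] n that by simp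
  qed
  let ?\<Omega> = "(\<lambda>x. t *\<^sub>R x + c) ` \<Omega>"
  have o: "open ?\<Omega>" using open_affinity[OF \<Omega>(1), of t c] t by (simp add: add.commute)
  have "(\<lambda>x. (1 / t) *\<^sub>R x + (- (1 / t) *\<^sub>R c)) ` ?\<Omega> = \<Omega>"
    using t by (simp add: image_image algebra_simps)
  with le[OF o, of "1 / t" "- (1 / t) *\<^sub>R c"] \<Omega> t
  have "lambda_root s ?\<Omega> * t \<le> lambda_root s \<Omega>" by simp
  then show ?thesis using le[OF \<Omega> t, of c] t by (simp add: field_simps)
qed

section \<open>Morrey's inequality on cubes\<close>

text \<open>Young's inequality, with equality at \<open>r = m\<close>: it bounds \<open>r\<close> linearly in \<open>r powr s\<close>, which allows to
  pass from the integral of \<open>\<bar>\<nabla>\<phi>\<bar>\<close> to that of \<open>\<bar>\<nabla>\<phi>\<bar>\<^sup>s\<close> with a parameter to be chosen later.\<close>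

lemma le_young:
  fixes r m s :: real
  assumes "0 \<le> r" "0 < m" "1 < s"
  shows "r \<le> (1 / s) * (m powr (1 - s) * r powr s) + (1 - 1 / s) * m"
proof (cases "r = 0")
  case True
  then show ?thesis using assms by simp
next
  case False
  then have r: "0 < r" using assms by simp
  have "(m powr (1 - s) * r powr s) powr (1 / s) * m powr (1 - 1 / s) \<le> (1 / s) * (m powr (1 - s) * r powr s) + (1 - 1 / s) * m"
    by (rule Youngs_inequality_0) (use assms r in auto)
  moreover have "(m powr (1 - s) * r powr s) powr (1 / s) * m powr (1 - 1 / s) = r"
  proof -
    have "(m powr (1 - s) * r powr s) powr (1 / s) * m powr (1 - 1 / s) = m powr ((1 - s) / s + (1 - 1 / s)) * r"
      using assms r by (simp add: powr_mult powr_powr powr_add)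
    also have "(1 - s) / s + (1 - 1 / s) = 0" using assms by (simp add: field_simps)
    finally show ?thesis using assms by simp
  qed
  ultimately show ?thesis by simp
qed

text \<open>The function \<open>f t = \<integral> \<phi> (x + t (y - x)) dy\<close> over the cube connects \<open>f 0 = h\<^sup>d \<phi> x\<close> with
  \<open>f 1 = \<integral> \<phi>\<close>. Its derivative is at most \<open>d h\<close> times the integral of \<open>\<bar>\<nabla>\<phi>\<bar>\<close> at the points \<open>x + t (y - x)\<close>,
  which fill a smaller cube inside the given one; the change of variables costs \<open>t\<^sup>-\<^sup>d\<close>. Young's
  inequality with parameter \<open>m0 t\<^sup>-\<^sup>d\<^sup>/\<^sup>s\<close> turns this into a multiple of \<open>t\<^sup>-\<^sup>d\<^sup>/\<^sup>s\<close>, and this is integrable at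
  \<open>0\<close> exactly because \<open>d < s\<close>.\<close>

lemma cube_average_deviation:
  fixes \<phi> :: "real^'n \<Rightarrow> real"
  assumes \<phi>: "\<phi> \<in> C1c UNIV" and h: "0 < h" and b: "b = a + vec h"
    and x: "x \<in> cbox a b" and s: "real CARD('n) < s" and m0: "0 < m0"
  shows "\<bar>integral (cbox a b) \<phi> - h ^ CARD('n) * \<phi> x\<bar> \<le>
    real CARD('n) * h / (1 - CARD('n) / s) *
      ((1 / s) * (m0 powr (1 - s) * powint s (cbox a b) (grad \<phi>)) + (1 - 1 / s) * (m0 * h ^ CARD('n)))"
proof -
  let ?Q = "cbox a b"
  define d where "d = CARD('n)"
  have d1: "1 \<le> d" by (simp add: d_def Suc_leI)
  then have "1 \<le> real d" by linarith
  moreover have "real d < s" using s by (simp add: d_def)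
  ultimately have s1: "1 < s" "0 < s" "real d < s" by linarith+
  have bi: "b $ i = a $ i + h" for i using b by simp
  have cQ: "measure lborel ?Q = h ^ d"
    using h by (subst content_cbox_cart) (auto simp: bi d_def interval_ne_empty_cart)
  define G where "G = powint s ?Q (grad \<phi>)"
  define B where "B = (1 / s) * (m0 powr (1 - s) * G) + (1 - 1 / s) * (m0 * h ^ d)"
  define D where "D = real d * h"
  define f where "f = (\<lambda>t. integral ?Q (\<lambda>y. \<phi> (x + t *\<^sub>R (y - x))))"
  define f' where "f' = (\<lambda>t. integral ?Q (\<lambda>y. grad \<phi> (x + t *\<^sub>R (y - x)) \<bullet> (y - x)))"
  have cont: "continuous_on ?Q (\<lambda>y. \<phi> (x + t *\<^sub>R (y - x)))" for t
    by (intro continuous_on_compose2[OF C1c_D(3)[OF \<phi>]] continuous_intros) auto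
  have contG: "continuous_on ?Q (\<lambda>y. grad \<phi> (x + t *\<^sub>R (y - x)))" for t
    by (intro continuous_on_compose2[OF C1c_D(2)[OF \<phi>]] continuous_intros) auto
  have df: "(f has_vector_derivative f' t) (at t within UNIV)" for t
    unfolding f_def f'_def
  proof (rule leibniz_rule_vector_derivative)
    show "((\<lambda>t. \<phi> (x + t *\<^sub>R (y - x))) has_vector_derivative grad \<phi> (x + t *\<^sub>R (y - x)) \<bullet> (y - x)) (at t within UNIV)" for t y
    proof -
      have "((\<lambda>t. x + t *\<^sub>R (y - x)) has_derivative (\<lambda>h. h *\<^sub>R (y - x))) (at t within UNIV)"
        by (auto intro!: derivative_eq_intros)
      from has_derivative_compose[OF this C1c_D(1)[OF \<phi>]]
      show ?thesis by (simp add: has_vector_derivative_def)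
    qed
    show "(\<lambda>y. \<phi> (x + t *\<^sub>R (y - x))) integrable_on ?Q" for t
      by (intro integrable_continuous cont)
    show "continuous_on (UNIV \<times> ?Q) (\<lambda>(t, y). grad \<phi> (x + t *\<^sub>R (y - x)) \<bullet> (y - x))"
      unfolding case_prod_unfold
      by (intro continuous_on_compose2[OF C1c_D(2)[OF \<phi>]] continuous_intros) auto
  qed auto
  have bound: "norm (f' t) \<le> D * B * t powr (- d / s)" if t: "0 < t" "t < 1" for t
  proof -
    define m where "m = m0 * t powr (- d / s)"
    have m: "0 < m" using m0 t by (simp add: m_def)
    have dist: "norm (y - x) \<le> D" if "y \<in> ?Q" for y
    proof -
      have "norm (y - x) \<le> (\<Sum>i\<in>UNIV. \<bar>(y - x) $ i\<bar>)" by (rule norm_le_l1_cart)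
      also have "\<dots> \<le> (\<Sum>i\<in>(UNIV::'n set). h)"
      proof (rule sum_mono)
        fix i
        have "a $ i \<le> y $ i" "y $ i \<le> a $ i + h" "a $ i \<le> x $ i" "x $ i \<le> a $ i + h"
          using that x bi by (auto simp: mem_box_cart)
        then show "\<bar>(y - x) $ i\<bar> \<le> h" by auto
      qed
      finally show ?thesis by (simp add: D_def d_def)
    qed
    have scale: "((\<lambda>y. norm (grad \<phi> (x + t *\<^sub>R (y - x))) powr s) has_integral
        powint s (cbox (t *\<^sub>R a + (1 - t) *\<^sub>R x) (t *\<^sub>R b + (1 - t) *\<^sub>R x)) (grad \<phi>) / t ^ d) ?Q"
    proof -
      have "(\<lambda>y. norm (grad \<phi> y) powr s) integrable_on cbox (t *\<^sub>R a + (1 - t) *\<^sub>R x) (t *\<^sub>R b + (1 - t) *\<^sub>R x)"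
        using C1c_D(2)[OF \<phi>] s1 by (intro norm_powr_integrable(2)) auto
      from has_integral_affinity'[OF integrable_integral[OF this] t(1), of "(1 - t) *\<^sub>R x"]
      show ?thesis using t by (simp add: powint_def d_def algebra_simps divide_inverse_commute)
    qed
    have "powint s (cbox (t *\<^sub>R a + (1 - t) *\<^sub>R x) (t *\<^sub>R b + (1 - t) *\<^sub>R x)) (grad \<phi>) \<le> G"
      unfolding powint_def G_def
    proof (rule integral_subset_le)
      show "cbox (t *\<^sub>R a + (1 - t) *\<^sub>R x) (t *\<^sub>R b + (1 - t) *\<^sub>R x) \<subseteq> cbox a b"
      proof
        fix y assume y: "y \<in> cbox (t *\<^sub>R a + (1 - t) *\<^sub>R x) (t *\<^sub>R b + (1 - t) *\<^sub>R x)"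
        show "y \<in> cbox a b" unfolding mem_box_cart
        proof
          fix i
          have "a $ i \<le> x $ i" "x $ i \<le> b $ i" using x by (auto simp: mem_box_cart)
          then have "(1 - t) * a $ i \<le> (1 - t) * x $ i" "(1 - t) * x $ i \<le> (1 - t) * b $ i"
            using t by (auto intro: mult_left_mono)
          moreover have "t * a $ i + (1 - t) * x $ i \<le> y $ i" "y $ i \<le> t * b $ i + (1 - t) * x $ i"
            using y by (auto simp: mem_box_cart)
          ultimately show "a $ i \<le> y $ i \<and> y $ i \<le> b $ i" by (simp add: algebra_simps)
        qed
      qed
    qed (use C1c_D(2)[OF \<phi>] s1 in \<open>auto intro!: norm_powr_integrable(2)\<close>)
    then have sc: "integral ?Q (\<lambda>y. norm (grad \<phi> (x + t *\<^sub>R (y - x))) powr s) \<le> G / t ^ d"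
      using integral_unique[OF scale] t by (simp add: divide_right_mono)
    have int: "(\<lambda>y. norm (grad \<phi> (x + t *\<^sub>R (y - x))) powr s) integrable_on ?Q" using scale by blast
    have "norm (f' t) \<le> integral ?Q (\<lambda>y. D * ((1 / s) * (m powr (1 - s) * norm (grad \<phi> (x + t *\<^sub>R (y - x))) powr s) + (1 - 1 / s) * m))"
      unfolding f'_def
    proof (rule integral_norm_bound_integral)
      show "(\<lambda>y. grad \<phi> (x + t *\<^sub>R (y - x)) \<bullet> (y - x)) integrable_on ?Q"
        by (intro integrable_continuous continuous_intros contG)
      show "(\<lambda>y. D * ((1 / s) * (m powr (1 - s) * norm (grad \<phi> (x + t *\<^sub>R (y - x))) powr s) + (1 - 1 / s) * m)) integrable_on ?Q"
        by (intro integrable_on_mult_right integrable_add int integrable_const)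
      fix y assume y: "y \<in> ?Q"
      have "norm (grad \<phi> (x + t *\<^sub>R (y - x)) \<bullet> (y - x)) \<le> norm (grad \<phi> (x + t *\<^sub>R (y - x))) * norm (y - x)"
        using Cauchy_Schwarz_ineq2 by simp
      also have "\<dots> \<le> norm (grad \<phi> (x + t *\<^sub>R (y - x))) * D"
        by (rule mult_left_mono[OF dist[OF y]]) simp
      also have "\<dots> = D * norm (grad \<phi> (x + t *\<^sub>R (y - x)))" by simp
      also have "\<dots> \<le> D * ((1 / s) * (m powr (1 - s) * norm (grad \<phi> (x + t *\<^sub>R (y - x))) powr s) + (1 - 1 / s) * m)"
        using le_young[OF _ m s1(1)] h by (intro mult_left_mono) (auto simp: D_def)
      finally show "norm (grad \<phi> (x + t *\<^sub>R (y - x)) \<bullet> (y - x))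
          \<le> D * ((1 / s) * (m powr (1 - s) * norm (grad \<phi> (x + t *\<^sub>R (y - x))) powr s) + (1 - 1 / s) * m)" .
    qed
    also have "\<dots> = D * ((1 / s) * (m powr (1 - s) * integral ?Q (\<lambda>y. norm (grad \<phi> (x + t *\<^sub>R (y - x))) powr s)) + (1 - 1 / s) * m * h ^ d)"
    proof (rule integral_unique)
      have "((\<lambda>y. D * ((1 / s) * (m powr (1 - s) * norm (grad \<phi> (x + t *\<^sub>R (y - x))) powr s) + (1 - 1 / s) * m)) has_integral
          D * ((1 / s) * (m powr (1 - s) * integral ?Q (\<lambda>y. norm (grad \<phi> (x + t *\<^sub>R (y - x))) powr s))
            + measure lborel ?Q *\<^sub>R ((1 - 1 / s) * m))) ?Q"
        by (intro has_integral_mult_right has_integral_add integrable_integral int has_integral_const)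
      then show "((\<lambda>y. D * ((1 / s) * (m powr (1 - s) * norm (grad \<phi> (x + t *\<^sub>R (y - x))) powr s) + (1 - 1 / s) * m)) has_integral
          D * ((1 / s) * (m powr (1 - s) * integral ?Q (\<lambda>y. norm (grad \<phi> (x + t *\<^sub>R (y - x))) powr s)) + (1 - 1 / s) * m * h ^ d)) ?Q"
        by (simp add: cQ mult.commute)
    qed
    also have "\<dots> \<le> D * ((1 / s) * (m powr (1 - s) * (G / t ^ d)) + (1 - 1 / s) * m * h ^ d)"
      using sc s1 h by (intro mult_left_mono add_right_mono) (auto simp: D_def)
    also have "m powr (1 - s) * (G / t ^ d) = m0 powr (1 - s) * G * t powr (- d / s)"
    proof -
      have "t ^ d = t powr d" using t by (simp add: powr_realpow)
      then have "m powr (1 - s) / t ^ d = m0 powr (1 - s) * (t powr ((- d / s) * (1 - s)) / t powr d)"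
        using m0 t by (simp add: m_def powr_mult powr_powr)
      also have "t powr ((- d / s) * (1 - s)) / t powr d = t powr ((- d / s) * (1 - s) - d)"
        by (simp add: powr_diff)
      also have "(- d / s) * (1 - s) - d = - d / s" using s1 by (simp add: field_simps)
      finally have "m powr (1 - s) / t ^ d = m0 powr (1 - s) * t powr (- d / s)" .
      then have "G * (m powr (1 - s) / t ^ d) = G * (m0 powr (1 - s) * t powr (- d / s))" by (simp only:)
      then show ?thesis by (simp add: mult_ac)
    qed
    also have "D * ((1 / s) * (m0 powr (1 - s) * G * t powr (- d / s)) + (1 - 1 / s) * m * h ^ d) = D * B * t powr (- d / s)"
      by (simp add: B_def m_def algebra_simps)
    finally show ?thesis .
  qed
  define e where "e = 1 - d / s"
  have e: "0 < e" using s1 by (simp add: e_def)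
  \<comment> \<open>The majorant is the primitive of \<open>D B t\<^sup>-\<^sup>d\<^sup>/\<^sup>s\<close>, with exponent \<open>e = 1 - d / s\<close>.\<close>
  have "norm (f 1 - f 0) \<le> D * B / e * 1 powr e - D * B / e * 0 powr e"
  proof (rule differentiable_bound_general)
    show "continuous_on {0..1} f"
      using df by (intro continuous_at_imp_continuous_on) (auto intro: has_vector_derivative_continuous)
    show "continuous_on {0..1} (\<lambda>t. D * B / e * t powr e)"
      using e by (intro continuous_intros continuous_on_powr') auto
    fix t :: real assume t: "0 < t" "t < 1"
    show "(f has_vector_derivative f' t) (at t)" using df by simp
    show "norm (f' t) \<le> D * B * t powr (- d / s)" by (rule bound[OF t])
    have "((\<lambda>t. D * B / e * t powr e) has_real_derivative D * B / e * (e * t powr (e - 1))) (at t)"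
      using t by (intro DERIV_cmult has_real_derivative_powr)
    then have "((\<lambda>t. D * B / e * t powr e) has_real_derivative D * B * t powr (e - 1)) (at t)"
      using e by (simp add: mult.assoc)
    then show "((\<lambda>t. D * B / e * t powr e) has_vector_derivative D * B * t powr (- d / s)) (at t)"
      by (simp add: has_real_derivative_iff_has_vector_derivative e_def)
  qed simp
  then have "norm (f 1 - f 0) \<le> D * B / e" by simp
  moreover have "f 1 = integral ?Q \<phi>" "f 0 = h ^ d * \<phi> x" by (simp_all add: f_def cQ)
  ultimately show ?thesis by (simp add: D_def B_def e_def G_def d_def)
qed

definition morrey_const :: "nat \<Rightarrow> real \<Rightarrow> real" where
  "morrey_const d s = (2 * d * s / (s - d)) powr s"

text \<open>Both points deviate little from the average. The best parameter is \<open>m0 = (G / h\<^sup>d)\<^sup>1\<^sup>/\<^sup>s\<close>, where \<open>G\<close> is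
  the gradient integral; for \<open>G = 0\<close> let \<open>m0\<close> tend to zero.\<close>

lemma morrey_cube:
  fixes \<phi> :: "real^'n \<Rightarrow> real"
  assumes \<phi>: "\<phi> \<in> C1c UNIV" and h: "0 < h" and b: "b = a + vec h"
    and x: "x \<in> cbox a b" and y: "y \<in> cbox a b" and s: "real CARD('n) < s"
  shows "\<bar>\<phi> x - \<phi> y\<bar> powr s \<le> morrey_const CARD('n) s * h powr (s - CARD('n)) * powint s (cbox a b) (grad \<phi>)"
proof -
  define d where "d = CARD('n)"
  have d1: "1 \<le> d" by (simp add: d_def Suc_leI)
  then have "1 \<le> real d" by linarith
  moreover have "real d < s" using s by (simp add: d_def)
  ultimately have s1: "1 < s" "0 < s" "real d < s" by linarith+
  define G where "G = powint s (cbox a b) (grad \<phi>)"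
  have G0: "0 \<le> G" by (simp add: G_def powint_nonneg)
  define \<kappa> where "\<kappa> = 2 * d * s / (s - d) * h"
  have \<kappa>: "0 < \<kappa>" using s1 d1 h by (simp add: \<kappa>_def)
  have \<kappa>2: "\<kappa> = 2 * (d * h / (1 - d / s))" using s1 by (simp add: \<kappa>_def field_simps)
  have main: "\<bar>\<phi> x - \<phi> y\<bar> \<le> \<kappa> * ((1 / s) * (m0 powr (1 - s) * (G / h ^ d)) + (1 - 1 / s) * m0)" if m0: "0 < m0" for m0
  proof -
    let ?B = "(1 / s) * (m0 powr (1 - s) * G) + (1 - 1 / s) * (m0 * h ^ d)"
    have "\<bar>h ^ d * \<phi> x - h ^ d * \<phi> y\<bar> \<le> \<kappa> * ?B"
      using cube_average_deviation[OF \<phi> h b x s m0] cube_average_deviation[OF \<phi> h b y s m0]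
      unfolding \<kappa>2 G_def d_def by linarith
    then have "h ^ d * \<bar>\<phi> x - \<phi> y\<bar> \<le> \<kappa> * ?B"
      using h by (simp add: right_diff_distrib[symmetric] abs_mult)
    then have "\<bar>\<phi> x - \<phi> y\<bar> \<le> \<kappa> * ?B / h ^ d" using h by (simp add: pos_le_divide_eq mult.commute)
    also have "\<dots> = \<kappa> * ((1 / s) * (m0 powr (1 - s) * (G / h ^ d)) + (1 - 1 / s) * m0)"
      using h s1 by (simp add: field_simps)
    finally show ?thesis .
  qed
  have e: "morrey_const d s * h powr (s - d) * G = \<kappa> powr s * (G / h ^ d)"
  proof -
    have "h powr (s - d) = h powr s / h ^ d" using h by (simp add: powr_diff powr_realpow)
    moreover have "\<kappa> powr s = morrey_const d s * h powr s"
      unfolding \<kappa>_def morrey_const_def using s1 d1 h by (subst powr_mult) auto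
    ultimately show ?thesis by simp
  qed
  have "\<bar>\<phi> x - \<phi> y\<bar> powr s \<le> \<kappa> powr s * (G / h ^ d)"
  proof (cases "G = 0")
    case True
    have "\<bar>\<phi> x - \<phi> y\<bar> \<le> 0 + \<epsilon>" if "0 < \<epsilon>" for \<epsilon>
    proof -
      have "\<bar>\<phi> x - \<phi> y\<bar> \<le> (1 - 1 / s) * \<epsilon>"
        using main[of "\<epsilon> / \<kappa>"] True that \<kappa> by simp
      also have "\<dots> \<le> 1 * \<epsilon>" using that s1 by (intro mult_right_mono) auto
      finally show ?thesis by simp
    qed
    then have "\<bar>\<phi> x - \<phi> y\<bar> \<le> 0" by (rule field_le_epsilon)
    then show ?thesis using True by simp
  next
    case False
    define m where "m = (G / h ^ d) powr (1 / s)"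
    have Gh: "0 < G / h ^ d" using False G0 h by simp
    have m: "0 < m" "m powr s = G / h ^ d" using Gh G0 h s1 by (auto simp: m_def powr_powr)
    have "m powr (1 - s) * (G / h ^ d) = m"
      using m by (simp add: m(2)[symmetric] powr_add[symmetric])
    then have "\<bar>\<phi> x - \<phi> y\<bar> \<le> \<kappa> * m" using main[OF m(1)] by (simp add: algebra_simps)
    then have "\<bar>\<phi> x - \<phi> y\<bar> powr s \<le> (\<kappa> * m) powr s" using s1 by (intro powr_mono2) auto
    then show ?thesis using \<kappa> m by (simp add: powr_mult)
  qed
  then show ?thesis using e by (simp add: d_def G_def)
qed

text \<open>The half-open cube with side \<open>h\<close> and a vertex in \<open>h \<int>\<^sup>d\<close> that contains \<open>x\<close>. Naming cells by their points
  makes them the classes of an equivalence relation.\<close>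

definition grid_cell :: "real \<Rightarrow> real^'n \<Rightarrow> (real^'n) set" where
  "grid_cell h x = {y. \<forall>i. \<lfloor>y $ i / h\<rfloor> = \<lfloor>x $ i / h\<rfloor>}"

lemma grid_cell_eq_iff: "y \<in> grid_cell h x \<longleftrightarrow> grid_cell h y = grid_cell h x"
  unfolding grid_cell_def by auto

lemma mem_grid_cell_self [simp]: "x \<in> grid_cell h x"
  by (simp add: grid_cell_def)

lemma grid_cell_iff:
  assumes "0 < h"
  shows "y \<in> grid_cell h x \<longleftrightarrow> (\<forall>i. h * \<lfloor>x $ i / h\<rfloor> \<le> y $ i \<and> y $ i < h * \<lfloor>x $ i / h\<rfloor> + h)"
  using assms unfolding grid_cell_def mem_Collect_eq floor_eq_iff
  by (simp add: field_simps)

lemma morrey_grid_cell: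
  fixes \<phi> :: "real^'n \<Rightarrow> real"
  assumes \<phi>: "\<phi> \<in> C1c UNIV" and h: "0 < h" and s: "real CARD('n) < s"
    and y: "y \<in> grid_cell h x" and C: "grid_cell h x \<subseteq> C" "bounded C" "C \<in> sets lebesgue"
  shows "\<bar>\<phi> x - \<phi> y\<bar> powr s \<le> morrey_const CARD('n) s * h powr (s - CARD('n)) * powint s C (grad \<phi>)"
proof -
  define a :: "real^'n" where "a = (\<chi> i. h * \<lfloor>x $ i / h\<rfloor>)"
  have s0: "0 < s" using s by (meson le_less_trans of_nat_0_le_iff)
  have sub: "grid_cell h x \<subseteq> cbox a (a + vec h)"
    using h by (auto simp: grid_cell_iff mem_box_cart a_def less_imp_le)
  have sub': "box a (a + vec h) \<subseteq> C"
    using h by (intro order_trans[OF _ C(1)]) (auto simp: grid_cell_iff mem_box_cart a_def less_imp_le)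
  have "powint s (cbox a (a + vec h)) (grad \<phi>) = powint s (box a (a + vec h)) (grad \<phi>)"
    by (simp add: powint_def integral_open_interval)
  also have "\<dots> \<le> powint s C (grad \<phi>)"
    unfolding powint_def
    by (rule integral_subset_le[OF sub']) (use C C1c_D(2)[OF \<phi>] s0 in \<open>auto intro!: norm_powr_integrable(2)\<close>)
  finally have le: "powint s (cbox a (a + vec h)) (grad \<phi>) \<le> powint s C (grad \<phi>)" .
  have "\<bar>\<phi> x - \<phi> y\<bar> powr s \<le> morrey_const CARD('n) s * h powr (s - CARD('n)) * powint s (cbox a (a + vec h)) (grad \<phi>)"
    using subsetD[OF sub] y by (intro morrey_cube[OF \<phi> h refl _ _ s]) auto
  also have "\<dots> \<le> morrey_const CARD('n) s * h powr (s - CARD('n)) * powint s C (grad \<phi>)"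
    using le by (intro mult_left_mono) (auto simp: morrey_const_def)
  finally show ?thesis .
qed

section \<open>Truncation and tilings\<close>

text \<open>A continuously differentiable substitute for the positive part of \<open>u - \<delta>\<close>: it is \<open>0\<close> up to \<open>\<delta>\<close>
  and \<open>(u - \<delta>)\<^sup>2 / u = u - 2 \<delta> + \<delta>\<^sup>2 / u\<close> from there on, with slope \<open>1 - (\<delta> / u)\<^sup>2\<close>. So it increases gradients
  nowhere and loses at most \<open>2 \<delta>\<close>.\<close>

definition soft_threshold :: "real \<Rightarrow> real \<Rightarrow> real" where
  "soft_threshold \<delta> u = (max 0 (u - \<delta>))\<^sup>2 / max \<delta> u"

lemma DERIV_soft_threshold:
  assumes "0 < \<delta>"
  shows "(soft_threshold \<delta> has_real_derivative 1 - (\<delta> / max \<delta> u)\<^sup>2) (at u)"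
proof (cases "u < \<delta>")
  case True
  have "((\<lambda>_. 0) has_real_derivative 1 - (\<delta> / max \<delta> u)\<^sup>2) (at u)" using True assms by simp
  then show ?thesis
    by (rule has_field_derivative_transform_within_open[of _ _ _ "{..<\<delta>}"]) (use True in \<open>auto simp: soft_threshold_def\<close>)
next
  case False
  then have u: "0 < u" "\<delta> \<le> u" using assms by auto
  have "((\<lambda>u. (max 0 (u - \<delta>))\<^sup>2) has_real_derivative 2 * max 0 (u - \<delta>) * 1) (at u)"
    by (rule DERIV_chain2[OF DERIV_max0_squared]) (auto intro!: derivative_eq_intros)
  then have "((\<lambda>u. (max 0 (u - \<delta>))\<^sup>2 / u) has_real_derivative
      (2 * max 0 (u - \<delta>) * 1 * u - (max 0 (u - \<delta>))\<^sup>2 * 1) / (u * u)) (at u)"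
    using u by (intro DERIV_divide DERIV_ident) auto
  moreover have "(2 * max 0 (u - \<delta>) * 1 * u - (max 0 (u - \<delta>))\<^sup>2 * 1) / (u * u) = 1 - (\<delta> / max \<delta> u)\<^sup>2"
    using u by (simp add: field_simps power2_eq_square)
  ultimately have "((\<lambda>u. (max 0 (u - \<delta>))\<^sup>2 / u) has_real_derivative 1 - (\<delta> / max \<delta> u)\<^sup>2) (at u)" by simp
  then show ?thesis
    by (rule has_field_derivative_transform_within_open[of _ _ _ "{0<..}"]) (use u in \<open>auto simp: soft_threshold_def max_def\<close>)
qed

lemma soft_threshold_eq_0: "u \<le> \<delta> \<Longrightarrow> soft_threshold \<delta> u = 0"
  by (simp add: soft_threshold_def)

lemma soft_threshold_nonneg: "0 < \<delta> \<Longrightarrow> 0 \<le> soft_threshold \<delta> u"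
  by (simp add: soft_threshold_def)

lemma soft_threshold_ge: "0 < \<delta> \<Longrightarrow> u - 2 * \<delta> \<le> soft_threshold \<delta> u"
proof (cases "u \<le> \<delta>")
  case False
  assume "0 < \<delta>"
  moreover have "(u - 2 * \<delta>) * u \<le> (u - \<delta>)\<^sup>2" by (simp add: power2_eq_square algebra_simps)
  ultimately show ?thesis using False by (simp add: soft_threshold_def pos_le_divide_eq)
qed (simp add: soft_threshold_def)

lemma soft_threshold_deriv_bounds:
  fixes \<delta> u :: real
  assumes "0 < \<delta>"
  shows "0 \<le> 1 - (\<delta> / max \<delta> u)\<^sup>2" "1 - (\<delta> / max \<delta> u)\<^sup>2 \<le> 1"
proof -
  have "0 < max \<delta> u" using assms by simp
  then have "\<delta> / max \<delta> u \<le> 1" by (simp only: pos_divide_le_eq mult_1 max.cobounded1)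
  then have "(\<delta> / max \<delta> u)\<^sup>2 \<le> 1\<^sup>2" using assms by (intro power_mono) auto
  then show "0 \<le> 1 - (\<delta> / max \<delta> u)\<^sup>2" by simp
qed simp

text \<open>Apply the soft threshold to \<open>\<phi>\<close> and \<open>- \<phi>\<close> inside \<open>U\<close> and extend by zero. Since \<open>\<bar>\<phi>\<bar> < \<delta>\<close> on the frontier, the
  set where \<open>\<bar>\<phi>\<bar> \<ge> \<delta>\<close> meets the closure of \<open>U\<close> in a compact subset of \<open>U\<close>, and the result vanishes off
  that subset.\<close>

lemma truncation:
  fixes \<phi> :: "real^'n \<Rightarrow> real"
  assumes \<phi>: "\<phi> \<in> C1c UNIV" and \<delta>: "0 < \<delta>" and U: "open U" "bounded U"
    and fr: "\<And>x. x \<in> frontier U \<Longrightarrow> \<bar>\<phi> x\<bar> < \<delta>"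
  obtains v where "v \<in> C1c U" "\<And>x. norm (grad v x) \<le> norm (grad \<phi> x)" 
    "\<And>x. x \<in> U \<Longrightarrow> \<bar>\<phi> x\<bar> \<le> \<bar>v x\<bar> + 2 * \<delta>"
proof -
  define \<tau> where "\<tau> = (\<lambda>u. soft_threshold \<delta> u + soft_threshold \<delta> (- u))"
  define \<tau>' where "\<tau>' = (\<lambda>u. (1 - (\<delta> / max \<delta> u)\<^sup>2) - (1 - (\<delta> / max \<delta> (- u))\<^sup>2))"
  have \<tau>: "(\<tau> has_real_derivative \<tau>' u) (at u)" for u
    unfolding \<tau>_def \<tau>'_def
    using DERIV_add[OF DERIV_soft_threshold[OF \<delta>, of u] DERIV_chain2[OF DERIV_soft_threshold[OF \<delta>, of "- u"] DERIV_minus[OF DERIV_ident]]]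
    by simp
  have \<tau>0: "\<tau> u = 0" "\<tau>' u = 0" if "\<bar>u\<bar> < \<delta>" for u
    using that by (auto simp: \<tau>_def \<tau>'_def soft_threshold_eq_0 max_def)
  have \<tau>'1: "\<bar>\<tau>' u\<bar> \<le> 1" for u
    using soft_threshold_deriv_bounds[OF \<delta>, of u] soft_threshold_deriv_bounds[OF \<delta>, of "- u"]
    unfolding \<tau>'_def by linarith
  have \<tau>ge: "\<bar>u\<bar> \<le> \<bar>\<tau> u\<bar> + 2 * \<delta>" for u
    using soft_threshold_ge[OF \<delta>, of u] soft_threshold_ge[OF \<delta>, of "- u"] soft_threshold_nonneg[OF \<delta>, of u]
      soft_threshold_nonneg[OF \<delta>, of "- u"] by (simp add: \<tau>_def)
  have c\<tau>: "continuous_on UNIV \<tau>'" unfolding \<tau>'_def using \<delta> by (intro continuous_intros) (auto simp: max_def)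
  define S where "S = closure U \<inter> {x. \<delta> \<le> \<bar>\<phi> x\<bar>}"
  have cl: "closed {x. \<delta> \<le> \<bar>\<phi> x\<bar>}" by (intro closed_Collect_le continuous_intros C1c_D(3)[OF \<phi>])
  have S: "compact S" unfolding S_def using U(2) by (intro compact_Int_closed[OF _ cl]) (simp add: compact_closure)
  have SU: "S \<subseteq> U" using fr closure_Un_frontier[of U] unfolding S_def by force
  have small: "\<bar>\<phi> x\<bar> < \<delta>" if "x \<in> U" "x \<notin> S" for x using that closure_subset[of U] by (force simp: S_def)
  define v where "v = (\<lambda>x. if x \<in> U then \<tau> (\<phi> x) else 0)"
  define g where "g = (\<lambda>x. if x \<in> U then \<tau>' (\<phi> x) *\<^sub>R grad \<phi> x else 0)"
  have v0: "v x = 0" and g0: "g x = 0" if "x \<notin> S" for x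
    using small[of x] \<tau>0[of "\<phi> x"] that by (auto simp: v_def g_def)
  have "open (- S)" using S by (simp add: compact_imp_closed open_Compl)
  have d: "(v has_derivative (\<lambda>h. g x \<bullet> h)) (at x)" for x
  proof (cases "x \<in> U")
    case True
    have "((\<lambda>x. \<tau> (\<phi> x)) has_derivative (\<lambda>h. g x \<bullet> h)) (at x)"
      using has_derivative_compose[OF C1c_D(1)[OF \<phi>] \<tau>[unfolded has_field_derivative_def]] True
      by (simp add: g_def)
    then show ?thesis
      by (rule has_derivative_transform_within_open[OF _ U(1) True]) (simp add: v_def)
  next
    case False
    then have x: "x \<in> - S" using SU by blast
    have "((\<lambda>_. 0) has_derivative (\<lambda>h. g x \<bullet> h)) (at x)" using g0[of x] x by simp
    then show ?thesis
      by (rule has_derivative_transform_within_open[OF _ \<open>open (- S)\<close> x]) (use v0 in auto)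
  qed
  have cg: "continuous_on UNIV g"
  proof -
    have "continuous_on U (\<lambda>x. \<tau>' (\<phi> x) *\<^sub>R grad \<phi> x)"
      using continuous_on_subset[OF C1c_D(2)[OF \<phi>]] continuous_on_subset[OF C1c_D(3)[OF \<phi>]]
      by (intro continuous_intros continuous_on_compose2[OF c\<tau>]) auto
    then have "continuous_on U g" by (rule continuous_on_eq) (simp add: g_def)
    moreover have "continuous_on (- S) g"
      by (rule continuous_on_eq[of _ "\<lambda>_. 0"]) (use g0 in auto)
    ultimately have "continuous_on (U \<union> - S) g"
      using U(1) \<open>open (- S)\<close> by (intro continuous_on_open_Un) auto
    moreover have "U \<union> - S = UNIV" using SU by blast
    ultimately show ?thesis by simp
  qed
  have v: "v \<in> C1c U" and gv: "grad v = g" using C1cI[OF d cg S SU v0] by blast+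
  show ?thesis
  proof (rule that[OF v])
    show "norm (grad v x) \<le> norm (grad \<phi> x)" for x
      using mult_right_mono[OF \<tau>'1[of "\<phi> x"], of "norm (grad \<phi> x)"] by (simp add: gv g_def)
    show "\<bar>\<phi> x\<bar> \<le> \<bar>v x\<bar> + 2 * \<delta>" if "x \<in> U" for x using \<tau>ge[of "\<phi> x"] that by (simp add: v_def)
  qed
qed

lemma powint_tile_sum:
  fixes \<phi> :: "real^'n \<Rightarrow> real"
  assumes \<phi>: "\<phi> \<in> C1c UNIV" and s: "0 < s" and fin: "finite \<C>" and disj: "disjoint \<C>"
    and C: "\<And>C. C \<in> \<C> \<Longrightarrow> bounded C \<and> C \<in> sets lebesgue"
    and supp: "\<And>x. \<phi> x \<noteq> 0 \<Longrightarrow> x \<in> \<Union>\<C>"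
    and le: "\<And>C. C \<in> \<C> \<Longrightarrow> L * powint s C \<phi> \<le> powint s C (grad \<phi>)"
  shows "L * powint s UNIV \<phi> \<le> powint s UNIV (grad \<phi>)"
proof -
  have sum: "((\<lambda>x. norm (f x) powr s) has_integral (\<Sum>C\<in>\<C>. powint s C f)) (\<Union>\<C>)"
    if "continuous_on UNIV f" for f :: "real^'n \<Rightarrow> 'b::euclidean_space"
  proof (rule has_integral_Union[OF fin])
    show "((\<lambda>x. norm (f x) powr s) has_integral powint s C f) C" if "C \<in> \<C>" for C
      unfolding powint_def using C[OF that] \<open>continuous_on UNIV f\<close> s by (intro integrable_integral norm_powr_integrable(2)) auto
    show "pairwise (\<lambda>S S'. negligible (S \<inter> S')) \<C>"
      using disj unfolding pairwise_def disjnt_def by simp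
  qed
  have U: "bounded (\<Union>\<C>)" "\<Union>\<C> \<in> sets lebesgue" using fin C by (auto intro!: sets.finite_Union)
  have "powint s UNIV \<phi> = (\<Sum>C\<in>\<C>. powint s C \<phi>)"
  proof -
    have "((\<lambda>x. norm (\<phi> x) powr s) has_integral (\<Sum>C\<in>\<C>. powint s C \<phi>)) UNIV"
      by (rule has_integral_on_superset[OF sum[OF C1c_D(3)[OF \<phi>]]]) (use supp in auto)
    then show ?thesis by (simp add: powint_def integral_unique)
  qed
  then have "L * powint s UNIV \<phi> = (\<Sum>C\<in>\<C>. L * powint s C \<phi>)" by (simp add: sum_distrib_left)
  also have "\<dots> \<le> (\<Sum>C\<in>\<C>. powint s C (grad \<phi>))" by (rule sum_mono) (rule le)
  also have "\<dots> = powint s (\<Union>\<C>) (grad \<phi>)"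
    using sum[OF C1c_D(2)[OF \<phi>]] by (simp add: powint_def integral_unique)
  also have "\<dots> \<le> powint s UNIV (grad \<phi>)"
    unfolding powint_def
  proof (rule integral_subset_le)
    obtain S where S: "compact S" "\<And>x. x \<notin> S \<Longrightarrow> grad \<phi> x = 0" using C1cE[OF \<phi>] by metis
    show "(\<lambda>x. norm (grad \<phi> x) powr s) integrable_on UNIV"
      by (rule compact_support_integrable(3)[OF continuous_norm_powr[OF C1c_D(2)[OF \<phi>] s] S(1)]) (use S(2) in auto)
    show "(\<lambda>x. norm (grad \<phi> x) powr s) integrable_on \<Union>\<C>"
      by (rule norm_powr_integrable(2)[OF C1c_D(2)[OF \<phi>] s U])
  qed auto
  finally show ?thesis .
qed

lemma half_open_box:
  fixes a b :: "'n::finite \<Rightarrow> real"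
  shows "bounded {y::real^'n. \<forall>i. a i \<le> y $ i \<and> y $ i < b i}" "{y::real^'n. \<forall>i. a i \<le> y $ i \<and> y $ i < b i} \<in> sets borel"
proof -
  have "{y::real^'n. \<forall>i. a i \<le> y $ i \<and> y $ i < b i} \<subseteq> cbox (\<chi> i. a i) (\<chi> i. b i)"
    by (auto simp: mem_box_cart less_imp_le)
  then show "bounded {y::real^'n. \<forall>i. a i \<le> y $ i \<and> y $ i < b i}" using bounded_cbox bounded_subset by blast
  have "{y::real^'n. \<forall>i. a i \<le> y $ i \<and> y $ i < b i} = (\<Inter>i. {y. a i \<le> y $ i} \<inter> {y. y $ i < b i})" by auto
  moreover have "{y::real^'n. a i \<le> y $ i} \<inter> {y. y $ i < b i} \<in> sets borel" for i
    by (intro sets.Int borel_closed borel_open closed_Collect_le open_Collect_less continuous_intros)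
  ultimately show "{y::real^'n. \<forall>i. a i \<le> y $ i \<and> y $ i < b i} \<in> sets borel"
    by (auto intro!: sets.finite_INT)
qed

lemma grid_cell_bounded_measurable:
  assumes "0 < h"
  shows "bounded (grid_cell h x)" "grid_cell h x \<in> sets lebesgue"
proof -
  have "grid_cell h x = {y. \<forall>i. h * \<lfloor>x $ i / h\<rfloor> \<le> y $ i \<and> y $ i < h * \<lfloor>x $ i / h\<rfloor> + h}"
    using grid_cell_iff[OF assms] by blast
  then show "bounded (grid_cell h x)" "grid_cell h x \<in> sets lebesgue"
    using half_open_box[of "\<lambda>i. h * \<lfloor>x $ i / h\<rfloor>" "\<lambda>i. h * \<lfloor>x $ i / h\<rfloor> + h"] by auto
qed

lemma measure_grid_cell_le:
  assumes "0 < h"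
  shows "measure lebesgue (grid_cell h (x::real^'n)) \<le> h ^ CARD('n)"
proof -
  let ?a = "(\<chi> i. h * \<lfloor>x $ i / h\<rfloor>) :: real^'n"
  have "grid_cell h x \<subseteq> cbox ?a (?a + vec h)" using assms by (auto simp: grid_cell_iff mem_box_cart less_imp_le)
  then have "measure lebesgue (grid_cell h x) \<le> measure lebesgue (cbox ?a (?a + vec h))"
    using grid_cell_bounded_measurable(2)[OF assms] by (intro measure_mono_fmeasurable) auto
  also have "\<dots> = h ^ CARD('n)"
    using assms content_cbox_cart[of ?a "?a + vec h"] by (simp add: interval_ne_empty_cart)
  finally show ?thesis .
qed

lemma finite_grid_cells:
  fixes S :: "(real^'n) set"
  assumes "bounded S" "0 < h"
  shows "finite (grid_cell h ` S)"
proof -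
  obtain r where r: "\<And>x. x \<in> S \<Longrightarrow> norm x \<le> r" using assms(1) bounded_iff by blast
  define m where "m = \<lceil>r / h\<rceil>"
  let ?F = "\<lambda>z::'n \<Rightarrow> int. {y::real^'n. \<forall>i. \<lfloor>y $ i / h\<rfloor> = z i}"
  have "grid_cell h ` S \<subseteq> ?F ` (UNIV \<rightarrow>\<^sub>E {- m - 1..m + 1})"
  proof (rule image_subsetI)
    fix x assume x: "x \<in> S"
    have "\<lfloor>x $ i / h\<rfloor> \<in> {- m - 1..m + 1}" for i
    proof -
      have "\<bar>x $ i\<bar> \<le> r" using r[OF x] component_le_norm_cart[of x i] by linarith
      then have "\<bar>x $ i / h\<bar> \<le> r / h" using assms(2) by (simp add: divide_right_mono)
      also have "\<dots> \<le> m" by (simp add: m_def)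
      finally have "x $ i / h \<le> m" "- (x $ i / h) \<le> m" by (auto simp only: abs_le_iff)
      then have "- m - 1 \<le> \<lfloor>x $ i / h\<rfloor>" "\<lfloor>x $ i / h\<rfloor> \<le> m + 1" by linarith+
      then show ?thesis by simp
    qed
    then show "grid_cell h x \<in> ?F ` (UNIV \<rightarrow>\<^sub>E {- m - 1..m + 1})"
      by (intro image_eqI[of _ _ "\<lambda>i. \<lfloor>x $ i / h\<rfloor>"]) (auto simp: grid_cell_def)
  qed
  then show ?thesis by (rule finite_subset) (intro finite_imageI finite_PiE; simp)
qed

lemma dist_grid_cell_le:
  fixes x :: "real^'n" and h :: real
  assumes "0 < h" "y \<in> grid_cell h x"
  shows "dist x y \<le> CARD('n) * h"
proof -
  have "dist x y \<le> (\<Sum>i\<in>UNIV. \<bar>(x - y) $ i\<bar>)" unfolding dist_norm by (rule norm_le_l1_cart)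
  also have "(\<Sum>i\<in>UNIV. \<bar>(x - y) $ i\<bar>) \<le> (\<Sum>i\<in>(UNIV::'n set). h)"
  proof (rule sum_mono)
    fix i show "\<bar>(x - y) $ i\<bar> \<le> h"
      using assms(2) mem_grid_cell_self[of x h] unfolding grid_cell_iff[OF assms(1)] by (auto simp: abs_le_iff) (smt (verit))+
  qed
  finally show ?thesis by simp
qed

section \<open>Finite sets of points in place of boundaries\<close>

definition meets_cells :: "real \<Rightarrow> (real^'n) set \<Rightarrow> (real^'n) set \<Rightarrow> bool" where
  "meets_cells h K X \<longleftrightarrow> (\<forall>x\<in>X. grid_cell h x \<inter> K \<noteq> {})"

lemma has_integral_const_lmeasurable:
  fixes k :: real
  assumes "C \<in> lmeasurable"
  shows "((\<lambda>_. k) has_integral measure lebesgue C * k) C"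
proof -
  have "((\<lambda>x. indicat_real C x * k) has_integral measure lebesgue C * k) UNIV"
    using assms unfolding lmeasurable_iff_has_integral by (rule has_integral_mult_left)
  moreover have "(\<lambda>x. indicat_real C x * k) = (\<lambda>x. if x \<in> C then k else 0)" by (auto simp: indicator_def)
  ultimately show ?thesis using has_integral_restrict_UNIV[of C "\<lambda>_. k"] by simp
qed

text \<open>The set \<open>K\<close> acts like the complement of \<open>U\<close> in \<open>C\<close>. With mesh \<open>h = 1 / N\<close> and \<open>G = powint s C (grad \<phi>)\<close>,
  Morrey's inequality gives \<open>\<bar>\<phi>\<bar>\<^sup>s \<le> M h powr (s - d) * G\<close> on \<open>C - U\<close>. Truncating slightly above this level
  leaves a test function \<open>v\<close> on \<open>U\<close> with \<open>L' * \<integral> \<bar>v\<bar>\<^sup>s \<le> G\<close>, and \<open>\<phi>\<close> exceeds \<open>v\<close> by at most twice the level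
  on the bounded set \<open>C\<close>. Since the level is a small multiple of \<open>G\<close> itself, the estimate holds with
  \<open>L'\<close> replaced by any smaller \<open>L\<close> as soon as \<open>N\<close> is large, uniformly in \<open>\<phi>\<close>.\<close>

lemma cell_bound_eventually:
  fixes U C :: "(real^'n) set"
  assumes C: "bounded C" "C \<in> sets lebesgue" "\<And>x. x \<in> C \<Longrightarrow> grid_cell 1 x \<subseteq> C"
    and U: "open U" "closure U \<subseteq> C" and s: "real CARD('n) < s" and L: "0 \<le> L" "L < L'"
    and bound: "\<And>\<phi>. \<phi> \<in> C1c U \<Longrightarrow> L' * powint s UNIV \<phi> \<le> powint s UNIV (grad \<phi>)"
  shows "\<forall>\<^sub>F N in sequentially. \<forall>\<phi> K. \<phi> \<in> C1c UNIV \<longrightarrow> meets_cells (1 / real N) K (C - U) \<longrightarrow>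
    (\<forall>y\<in>K. \<phi> y = 0) \<longrightarrow> L * powint s C \<phi> \<le> powint s C (grad \<phi>)"
proof (cases "L = 0")
  case True
  then show ?thesis by (simp add: powint_nonneg)
next
  case False
  then have L0: "0 < L" "0 < L'" using L by auto
  have s1: "1 < s" "0 < s"
  proof -
    have "1 \<le> real CARD('n)" using zero_less_card_finite[where 'a='n] by linarith
    then show "1 < s" "0 < s" using s by linarith+
  qed
  define c where "c = measure lebesgue C"
  have Cl: "C \<in> lmeasurable" using C by (simp add: bounded_set_imp_lmeasurable)
  define M where "M = morrey_const CARD('n) s"
  have M0: "0 \<le> M" by (simp add: M_def morrey_const_def)
  \<comment> \<open>The parameter of the convexity inequality uses up part of the gap between \<open>L\<close> and \<open>L'\<close>; the rest absorbs the truncation error.\<close>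
  obtain t where t: "0 < t" "t < 1" "(1 - t) powr (1 - s) / L' < 1 / L"
  proof -
    have "((\<lambda>t. (1 - t) powr (1 - s) / L') \<longlongrightarrow> (1 - 0) powr (1 - s) / L') (at_right 0)"
      using L0 by (intro tendsto_intros) auto
    moreover have "(1 - 0) powr (1 - s) / L' < 1 / L" using L L0 by (simp add: frac_less2)
    ultimately have "\<forall>\<^sub>F t in at_right 0. (1 - t) powr (1 - s) / L' < 1 / L" by (rule order_tendstoD(2))
    then obtain b where b: "0 < b" "\<And>t. 0 < t \<Longrightarrow> t < b \<Longrightarrow> (1 - t) powr (1 - s) / L' < 1 / L"
      unfolding eventually_at_right_field by blast
    show ?thesis by (rule that[of "min (1/2) (b / 2)"]) (use b in auto)
  qed
  define A where "A = t powr (1 - s) * 2 powr s * c"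
  have A0: "0 \<le> A" by (simp add: A_def c_def)
  define f where "f = (\<lambda>N::nat. (1 - t) powr (1 - s) / L' + A * (M * (1 / real N) powr (s - CARD('n))))"
  have "f \<longlonglongrightarrow> (1 - t) powr (1 - s) / L' + A * (M * 0)"
    unfolding f_def
  proof (intro tendsto_intros)
    have "((\<lambda>N::nat. (1 / real N) powr (s - CARD('n))) \<longlongrightarrow> 0 powr (s - CARD('n))) sequentially"
    proof (rule tendsto_powr')
      show "(\<lambda>N. 1 / real N) \<longlonglongrightarrow> 0" by (rule lim_1_over_n)
    qed (use s in auto)
    then show "((\<lambda>N::nat. (1 / real N) powr (s - CARD('n))) \<longlongrightarrow> 0) sequentially" by simp
  qed
  then have "\<forall>\<^sub>F N in sequentially. f N < 1 / L" using t(3) by (intro order_tendstoD(2)) auto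
  then show ?thesis
    using eventually_gt_at_top[of 0]
  proof eventually_elim
    case (elim N)
    define h where "h = 1 / real N"
    have h: "0 < h" using elim by (simp add: h_def)
    show ?case
    proof (intro allI impI)
      fix \<phi> :: "real^'n \<Rightarrow> real" and K
      assume \<phi>: "\<phi> \<in> C1c UNIV" and K: "meets_cells (1 / real N) K (C - U)" and z: "\<forall>y\<in>K. \<phi> y = 0"
      define G where "G = powint s C (grad \<phi>)"
      have G0: "0 \<le> G" by (simp add: G_def powint_nonneg)
      \<comment> \<open>As \<open>1 / h\<close> is an integer, the fine grid refines the unit grid.\<close>
      have cell: "grid_cell h x \<subseteq> C" if "x \<in> C" for x
      proof -
        have "grid_cell h x \<subseteq> grid_cell 1 x"
        proof
          fix y assume "y \<in> grid_cell h x"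
          then have "\<lfloor>y $ i * N\<rfloor> = \<lfloor>x $ i * N\<rfloor>" for i by (simp add: grid_cell_def h_def)
          moreover have "\<lfloor>u\<rfloor> = \<lfloor>u * N\<rfloor> div int N" for u :: real
            using floor_divide_real_eq_div[of "int N" "u * N"] elim by simp
          ultimately have "\<lfloor>y $ i\<rfloor> = \<lfloor>x $ i\<rfloor>" for i by metis
          then show "y \<in> grid_cell 1 x" by (simp add: grid_cell_def)
        qed
        then show ?thesis using C(3)[OF that] by blast
      qed
      have key: "powint s C \<phi> \<le> (1 - t) powr (1 - s) / L' * G + A * w" if w: "M * h powr (s - CARD('n)) * G < w" for w
      proof -
        have "0 \<le> M * h powr (s - CARD('n)) * G" using M0 G0 by simp
        then have w0: "0 < w" using w by linarith
        define \<delta> where "\<delta> = w powr (1 / s)"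
        have \<delta>: "0 < \<delta>" "\<delta> powr s = w" using w0 s1 by (auto simp: \<delta>_def powr_powr)
        have small: "\<bar>\<phi> x\<bar> < \<delta>" if x: "x \<in> C - U" for x
        proof -
          obtain y where y: "y \<in> grid_cell h x" "y \<in> K" using K x unfolding meets_cells_def h_def by blast
          have "\<bar>\<phi> x - \<phi> y\<bar> powr s \<le> M * h powr (s - CARD('n)) * G"
            unfolding M_def G_def using x by (intro morrey_grid_cell[OF \<phi> h s y(1)] cell C) auto
          also have "\<dots> < \<delta> powr s" using w \<delta> by simp
          finally have "\<bar>\<phi> x\<bar> powr s < \<delta> powr s" using z y(2) by simp
          moreover have "\<delta> powr s \<le> \<bar>\<phi> x\<bar> powr s" if "\<delta> \<le> \<bar>\<phi> x\<bar>"
            using that s1 \<delta> by (intro powr_mono2) auto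
          ultimately show ?thesis by linarith
        qed
        have fr: "\<bar>\<phi> x\<bar> < \<delta>" if "x \<in> frontier U" for x
          using that U by (intro small) (auto simp: frontier_def interior_open)
        have bU: "bounded U" using bounded_subset[OF C(1) order_trans[OF closure_subset U(2)]] .
        obtain v where v: "v \<in> C1c U" "\<And>x. norm (grad v x) \<le> norm (grad \<phi> x)"
          "\<And>x. x \<in> U \<Longrightarrow> \<bar>\<phi> x\<bar> \<le> \<bar>v x\<bar> + 2 * \<delta>"
          using truncation[OF \<phi> \<delta>(1) U(1) bU fr] by metis
        have vle: "\<bar>\<phi> x\<bar> \<le> \<bar>v x\<bar> + 2 * \<delta>" if "x \<in> C" for x
          using small[of x] v(3)[of x] that \<delta>(1) by (cases "x \<in> U") auto
        have UC: "U \<subseteq> C" using U(2) closure_subset by blast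
        have vC: "v \<in> C1c C" using v(1) C1c_mono[OF UC] by blast
        note vL = C1c_Lp[OF vC s1(2)]
        have c1: "(\<lambda>x. \<bar>\<phi> x\<bar> powr s) integrable_on C" "(\<lambda>x. \<bar>v x\<bar> powr s) integrable_on C"
          using norm_powr_integrable(2)[OF C1c_D(3)[OF \<phi>] s1(2) C(1,2)] norm_powr_integrable(2)[OF C1c_D(3)[OF v(1)] s1(2) C(1,2)]
          by simp_all
        have hc: "((\<lambda>_. (2 * \<delta>) powr s) has_integral c * (2 * \<delta>) powr s) C"
          unfolding c_def by (rule has_integral_const_lmeasurable[OF Cl])
        have "powint s C \<phi> \<le> (1 - t) powr (1 - s) * powint s C v + t powr (1 - s) * (c * (2 * \<delta>) powr s)"
        proof (rule has_integral_le)
          show "((\<lambda>x. norm (\<phi> x) powr s) has_integral powint s C \<phi>) C"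
            unfolding powint_def using c1(1) by (intro integrable_integral) simp
          have "((\<lambda>x. norm (v x) powr s) has_integral powint s C v) C"
            unfolding powint_def using c1(2) by (intro integrable_integral) simp
          then show "((\<lambda>x. (1 - t) powr (1 - s) * norm (v x) powr s + t powr (1 - s) * (2 * \<delta>) powr s) has_integral
              (1 - t) powr (1 - s) * powint s C v + t powr (1 - s) * (c * (2 * \<delta>) powr s)) C"
            by (intro has_integral_add has_integral_mult_right hc)
          fix x assume x: "x \<in> C"
          have "norm (\<phi> x) powr s \<le> (\<bar>v x\<bar> + 2 * \<delta>) powr s"
            using vle[OF x] s1 by (intro powr_mono2) auto
          also have "\<dots> \<le> (1 - t) powr (1 - s) * norm (v x) powr s + t powr (1 - s) * (2 * \<delta>) powr s"
            using add_powr_le[of "\<bar>v x\<bar>" "2 * \<delta>" t s] t s1 \<delta> by simp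
          finally show "norm (\<phi> x) powr s \<le> (1 - t) powr (1 - s) * norm (v x) powr s + t powr (1 - s) * (2 * \<delta>) powr s" .
        qed
        also have "powint s C v \<le> G / L'"
        proof -
          have "L' * powint s C v \<le> powint s C (grad v)" using bound[OF v(1)] vL by simp
          also have "\<dots> \<le> G" unfolding G_def powint_def
            using C C1c_D(2)[OF v(1)] C1c_D(2)[OF \<phi>] s1 v(2)
            by (intro integral_le norm_powr_integrable(2) powr_mono2) auto
          finally show ?thesis using L0 by (simp add: pos_le_divide_eq mult.commute)
        qed
        finally have "powint s C \<phi> \<le> (1 - t) powr (1 - s) * (G / L') + t powr (1 - s) * (c * (2 * \<delta>) powr s)"
          by (simp add: mult_left_mono)
        also have "t powr (1 - s) * (c * (2 * \<delta>) powr s) = A * w"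
          using \<delta> by (simp add: A_def powr_mult)
        finally show ?thesis by simp
      qed
      have "powint s C \<phi> \<le> G * f N"
      proof (rule field_le_epsilon)
        fix e :: real assume e: "0 < e"
        define w where "w = M * h powr (s - CARD('n)) * G + e / (A + 1)"
        have "powint s C \<phi> \<le> (1 - t) powr (1 - s) / L' * G + A * w"
          using e A0 by (intro key) (simp add: w_def)
        also have "\<dots> = G * f N + A * (e / (A + 1))" by (simp add: w_def f_def h_def algebra_simps)
        also have "A * (e / (A + 1)) \<le> e" using A0 e by (simp add: field_simps)
        finally show "powint s C \<phi> \<le> G * f N + e" by simp
      qed
      also have "\<dots> \<le> G * (1 / L)" using elim G0 by (intro mult_left_mono) auto
      finally show "L * powint s C \<phi> \<le> powint s C (grad \<phi>)"
        using L0 by (simp add: G_def field_simps)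
    qed
  qed
qed

section \<open>Frequencies of different exponents\<close>

text \<open>If every cell of the grid contains a zero of \<open>\<phi>\<close>, then Morrey's inequality is a Poincare inequality
  on each cell, with a constant proportional to \<open>h powr s\<close>. For \<open>s = \<infinity>\<close>, a ball in \<open>\<Omega>\<close> cannot contain
  the cell of its centre.\<close>

lemma freq_bound_of_grid:
  fixes s :: ereal
  assumes s: "real CARD('n) < s"
  obtains c where "0 < c" "\<And>(\<Omega> :: (real^'n) set) h. 0 < h \<Longrightarrow> meets_cells h (- \<Omega>) UNIV \<Longrightarrow> freq_bound s (c / h) \<Omega>"
proof (cases s)
  case PInf
  let ?d = "real CARD('n)"
  have d: "0 < ?d" by simp
  have "freq_bound s ((1 / ?d) / h) \<Omega>" if h: "0 < h" and m: "meets_cells h (- \<Omega>) UNIV" for \<Omega> :: "(real^'n) set" and h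
  proof -
    have "(1 / ?d) / h * r \<le> 1" if r: "0 < r" "ball x r \<subseteq> \<Omega>" for x r
    proof -
      obtain y where y: "y \<in> grid_cell h x" "y \<notin> \<Omega>" using m unfolding meets_cells_def by blast
      then have "r \<le> dist x y" using r(2) by (auto simp: subset_iff not_less)
      also have "\<dots> \<le> ?d * h" by (rule dist_grid_cell_le[OF h y(1)])
      finally show ?thesis using h d by (simp add: field_simps)
    qed
    then show ?thesis using PInf by (simp add: freq_bound_def)
  qed
  moreover have "0 < 1 / ?d" by simp
  ultimately show ?thesis using that by blast
next
  case (real \<sigma>)
  then have \<sigma>: "real CARD('n) < \<sigma>" "0 < \<sigma>" using s by (auto intro: le_less_trans[of _ "real CARD('n)"])
  define M where "M = morrey_const CARD('n) \<sigma>"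
  have M: "0 < M" using \<sigma> by (simp add: M_def morrey_const_def)
  define c where "c = (1 / M) powr (1 / \<sigma>)"
  have c: "0 < c" "c powr \<sigma> = 1 / M" using M \<sigma> by (auto simp: c_def powr_powr)
  have "freq_bound s (c / h) \<Omega>" if h: "0 < h" and m: "meets_cells h (- \<Omega>) UNIV" for \<Omega> :: "(real^'n) set" and h
  proof -
    have "(c / h) powr \<sigma> * powint \<sigma> UNIV \<phi> \<le> powint \<sigma> UNIV (grad \<phi>)" if \<phi>': "\<phi> \<in> C1c \<Omega>" for \<phi>
    proof -
      have \<phi>: "\<phi> \<in> C1c UNIV" using \<phi>' C1c_mono[OF subset_UNIV] by blast
      obtain S where S: "compact S" "S \<subseteq> \<Omega>" "\<And>x. x \<notin> S \<Longrightarrow> \<phi> x = 0" using C1cE[OF \<phi>'] by metis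
      show ?thesis
      proof (rule powint_tile_sum[OF \<phi> \<sigma>(2) finite_grid_cells[OF compact_imp_bounded[OF S(1)] h]])
        show "disjoint (grid_cell h ` S)"
        proof (rule disjointI)
          fix A B assume AB: "A \<in> grid_cell h ` S" "B \<in> grid_cell h ` S" "A \<noteq> B"
          have "grid_cell h z = A \<and> grid_cell h z = B" if "z \<in> A" "z \<in> B" for z
            using AB(1,2) that by (auto simp: grid_cell_eq_iff)
          then show "A \<inter> B = {}" using AB(3) by blast
        qed
        show "bounded C \<and> C \<in> sets lebesgue" if "C \<in> grid_cell h ` S" for C
          using that grid_cell_bounded_measurable[OF h] by auto
        show "x \<in> \<Union> (grid_cell h ` S)" if "\<phi> x \<noteq> 0" for x
          using S(3)[of x] that mem_grid_cell_self[of x h] by blast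
        fix C assume "C \<in> grid_cell h ` S"
        then obtain x0 where C: "C = grid_cell h x0" by blast
        note Cbm = grid_cell_bounded_measurable[OF h, of x0, folded C]
        obtain y where y: "y \<in> C" "y \<notin> \<Omega>" using m unfolding meets_cells_def C by blast
        have \<phi>y: "\<phi> y = 0" using S(2,3) y by blast
        define G where "G = M * h powr (\<sigma> - CARD('n)) * powint \<sigma> C (grad \<phi>)"
        have G0: "0 \<le> G" using M by (simp add: G_def powint_nonneg)
        have pt: "norm (\<phi> x) powr \<sigma> \<le> G" if "x \<in> C" for x
        proof -
          have Cx: "grid_cell h x = C" using that C grid_cell_eq_iff by blast
          have "\<bar>\<phi> x - \<phi> y\<bar> powr \<sigma> \<le> G"
            unfolding G_def M_def by (rule morrey_grid_cell[OF \<phi> h \<sigma>(1)]) (use Cx y Cbm in auto)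
          then show ?thesis using \<phi>y by simp
        qed
        have Cl: "C \<in> lmeasurable" using Cbm by (simp add: bounded_set_imp_lmeasurable)
        have "powint \<sigma> C \<phi> \<le> measure lebesgue C * G"
        proof (rule has_integral_le)
          show "((\<lambda>x. norm (\<phi> x) powr \<sigma>) has_integral powint \<sigma> C \<phi>) C"
            unfolding powint_def by (intro integrable_integral norm_powr_integrable(2) C1c_D(3)[OF \<phi>] \<sigma>(2) Cbm)
          show "((\<lambda>_. G) has_integral measure lebesgue C * G) C"
            by (rule has_integral_const_lmeasurable[OF Cl])
        qed (rule pt)
        also have "\<dots> \<le> h ^ CARD('n) * G" using G0 measure_grid_cell_le[OF h, of x0] by (intro mult_right_mono) (auto simp: C)
        also have "\<dots> = M * h powr \<sigma> * powint \<sigma> C (grad \<phi>)"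
          using h by (simp add: G_def powr_diff powr_realpow)
        finally show "(c / h) powr \<sigma> * powint \<sigma> C \<phi> \<le> powint \<sigma> C (grad \<phi>)"
        proof -
          assume le: "powint \<sigma> C \<phi> \<le> M * h powr \<sigma> * powint \<sigma> C (grad \<phi>)"
          have "(c / h) powr \<sigma> * powint \<sigma> C \<phi> \<le> (c / h) powr \<sigma> * (M * h powr \<sigma> * powint \<sigma> C (grad \<phi>))"
            by (rule mult_left_mono[OF le]) simp
          also have "\<dots> = ((c / h) powr \<sigma> * (M * h powr \<sigma>)) * powint \<sigma> C (grad \<phi>)" by (simp only: mult.assoc)
          also have "(c / h) powr \<sigma> * (M * h powr \<sigma>) = 1" using c M h by (simp add: powr_divide)
          finally show ?thesis by simp
        qed
      qed
    qed
    then show ?thesis using real by (simp add: freq_bound_def)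
  qed
  with c(1) show ?thesis using that by blast
qed (use s in auto)

lemma ball_subset_grid_cell:
  fixes x :: "real^'n"
  assumes h: "0 < h"
  obtains c where "ball c (h / 2) \<subseteq> grid_cell h x"
proof -
  define c :: "real^'n" where "c = (\<chi> i. h * \<lfloor>x $ i / h\<rfloor> + h / 2)"
  have "ball c (h / 2) \<subseteq> grid_cell h x"
  proof
    fix y assume "y \<in> ball c (h / 2)"
    then have "\<bar>(c - y) $ i\<bar> < h / 2" for i
      using component_le_norm_cart[of "c - y" i] by (simp add: dist_norm)
    then have *: "\<bar>h * \<lfloor>x $ i / h\<rfloor> + h / 2 - y $ i\<bar> < h / 2" for i by (simp add: c_def)
    have "h * \<lfloor>x $ i / h\<rfloor> \<le> y $ i \<and> y $ i < h * \<lfloor>x $ i / h\<rfloor> + h" for i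
      using *[of i] unfolding abs_less_iff by (intro conjI) linarith+
    then show "y \<in> grid_cell h x" by (simp add: grid_cell_iff[OF h])
  qed
  then show ?thesis using that by blast
qed

lemma one_le_of_card_less:
  fixes s :: ereal
  assumes "real CARD('n::finite) < s"
  shows "1 \<le> s"
proof -
  have "1 \<le> ereal (real CARD('n))" by (simp add: one_ereal_def Suc_leI)
  then show ?thesis using assms by (rule order_trans[OF _ less_imp_le])
qed

text \<open>A bounded set contains no cell of a sufficiently coarse grid.\<close>

lemma lambda_root_pos:
  fixes A :: "(real^'n) set" and s :: ereal
  assumes A: "open A" "A \<noteq> {}" "bounded A" and s: "real CARD('n) < s"
  shows "0 < lambda_root s A"
proof -
  have s1: "1 \<le> s" by (rule one_le_of_card_less[OF s])
  obtain c where c: "0 < c" "\<And>(\<Omega> :: (real^'n) set) h. 0 < h \<Longrightarrow> meets_cells h (- \<Omega>) UNIV \<Longrightarrow> freq_bound s (c / h) \<Omega>"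
    using freq_bound_of_grid[OF s] by blast
  obtain r where r: "0 < r" "A \<subseteq> ball 0 r" using bounded_subset_ballD[OF A(3), of 0] by blast
  have "meets_cells (4 * r) (- A) UNIV"
    unfolding meets_cells_def
  proof
    fix x :: "real^'n"
    have "0 < 4 * r" using r by simp
    from ball_subset_grid_cell[OF this] obtain z where "ball z (4 * r / 2) \<subseteq> grid_cell (4 * r) x" .
    moreover have "\<not> ball z (4 * r / 2) \<subseteq> ball 0 r" using r(1) by (simp add: ball_subset_ball_iff not_le add_pos_nonneg)
    ultimately show "grid_cell (4 * r) x \<inter> - A \<noteq> {}" using r(2) by blast
  qed
  then have "freq_bound s (c / (4 * r)) A" using c(2) r(1) by simp
  then have "c / (4 * r) \<le> lambda_root s A" using le_lambda_root_iff[OF A(1,2) s1, of "c / (4 * r)"] c r by simp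
  moreover have "0 < c / (4 * r)" using c(1) r(1) by simp
  ultimately show ?thesis by linarith
qed

text \<open>Choose the side \<open>h\<close> of the grid such that a grid of points off \<open>\<Omega>\<close> would force \<open>lambda_root s \<Omega>\<close> to
  be at least twice its actual value. Then some cell, and thus a ball of radius \<open>h / 2\<close>, lies in \<open>\<Omega>\<close>,
  and \<open>h\<close> is inversely proportional to \<open>lambda_root s \<Omega>\<close>.\<close>

lemma lambda_root_le_comparable:
  fixes s p :: ereal
  assumes s: "real CARD('n) < s" and p: "1 \<le> p"
  obtains M where "\<And>\<Omega> :: (real^'n) set. open \<Omega> \<Longrightarrow> \<Omega> \<noteq> {} \<Longrightarrow> 0 < lambda_root s \<Omega> \<Longrightarrow>
    lambda_root p \<Omega> \<le> M * lambda_root s \<Omega>"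
proof -
  have s1: "1 \<le> s" by (rule one_le_of_card_less[OF s])
  obtain c where c: "0 < c" "\<And>(\<Omega> :: (real^'n) set) h. 0 < h \<Longrightarrow> meets_cells h (- \<Omega>) UNIV \<Longrightarrow> freq_bound s (c / h) \<Omega>"
    using freq_bound_of_grid[OF s] by blast
  let ?\<beta> = "lambda_root p (ball (0::real^'n) 1)"
  show ?thesis
  proof (rule that[of "4 * ?\<beta> / c"])
    fix \<Omega> :: "(real^'n) set" assume \<Omega>: "open \<Omega>" "\<Omega> \<noteq> {}" "0 < lambda_root s \<Omega>"
    define h where "h = c / (2 * lambda_root s \<Omega>)"
    have h: "0 < h" "c / h = 2 * lambda_root s \<Omega>" using c \<Omega> by (auto simp: h_def)
    have "\<not> freq_bound s (c / h) \<Omega>" using le_lambda_root_iff[OF \<Omega>(1,2) s1, of "c / h"] h \<Omega>(3) by simp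
    then have "\<not> meets_cells h (- \<Omega>) UNIV" using c(2) h(1) by blast
    then obtain x where x: "grid_cell h x \<subseteq> \<Omega>" unfolding meets_cells_def by blast
    obtain z where "ball z (h / 2) \<subseteq> grid_cell h x" using ball_subset_grid_cell[OF h(1)] .
    then have z: "ball z (h / 2) \<subseteq> \<Omega>" using x by (rule order_trans)
    have e: "ball z (h / 2) = (\<lambda>x. (h / 2) *\<^sub>R x + z) ` ball 0 1"
    proof (rule set_eqI, rule iffI)
      fix y assume "y \<in> ball z (h / 2)"
      then have "norm (y - z) < h / 2" by (simp add: dist_norm norm_minus_commute)
      then have "2 / h * norm (y - z) < 1" using h(1) by (simp add: field_simps)
      moreover have "norm ((2 / h) *\<^sub>R (y - z)) = 2 / h * norm (y - z)" using h(1) by (simp only: norm_scaleR) simp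
      ultimately have "norm ((2 / h) *\<^sub>R (y - z)) < 1" by (simp only:)
      then have "(2 / h) *\<^sub>R (y - z) \<in> ball 0 1" by (simp only: mem_ball_0)
      moreover have "y = (h / 2) *\<^sub>R ((2 / h) *\<^sub>R (y - z)) + z" using h(1) by simp
      ultimately show "y \<in> (\<lambda>x. (h / 2) *\<^sub>R x + z) ` ball 0 1" by blast
    qed (use h(1) in \<open>auto simp: dist_norm\<close>)
    have "lambda_root p \<Omega> \<le> lambda_root p (ball z (h / 2))"
      using h(1) z \<Omega> p by (intro lambda_root_antimono) auto
    also have "\<dots> = ?\<beta> / (h / 2)" unfolding e by (rule lambda_root_affinity) (use h(1) p in auto)
    also have "\<dots> = 4 * ?\<beta> / c * lambda_root s \<Omega>" using c \<Omega>(3) by (simp add: h_def field_simps)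
    finally show "lambda_root p \<Omega> \<le> 4 * ?\<beta> / c * lambda_root s \<Omega>" .
  qed
qed

section \<open>Gluing\<close>

text \<open>The frequency bound for the complement of \<open>K\<close>, localized to \<open>C\<close>. Nothing is required of the functions
  on the boundary of \<open>C\<close>, and balls may leave \<open>C\<close>; this is what makes local bounds additive.\<close>

definition local_bound :: "ereal \<Rightarrow> real \<Rightarrow> (real^'n) set \<Rightarrow> (real^'n) set \<Rightarrow> bool" where
  "local_bound s a C K \<longleftrightarrow>
     (if s = \<infinity> then \<forall>x\<in>C. \<forall>r>0. ball x r \<inter> K = {} \<longrightarrow> a * r \<le> 1
      else \<forall>\<phi>\<in>C1c UNIV. (\<forall>y\<in>K. \<phi> y = 0) \<longrightarrow>
        a powr real_of_ereal s * powint (real_of_ereal s) C \<phi> \<le> powint (real_of_ereal s) C (grad \<phi>))"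

text \<open>For finite \<open>s\<close> this is the estimate by truncation. For \<open>s = \<infinity>\<close>, let a ball with centre in \<open>C\<close> avoid \<open>K\<close>.
  Shrinking its radius by a bound \<open>\<epsilon>\<close> for the diameter of a fine cell, one obtains a ball that meets \<open>C\<close>
  only in \<open>U\<close>.
  Being connected, it cannot leave \<open>U\<close> without meeting the frontier of \<open>U\<close>, which is part of \<open>C - U\<close>.\<close>

lemma local_bound_eventually:
  fixes U C :: "(real^'n) set" and s :: ereal
  assumes C: "bounded C" "C \<in> sets lebesgue" "\<And>x. x \<in> C \<Longrightarrow> grid_cell 1 x \<subseteq> C"
    and U: "open U" "U \<noteq> {}" "closure U \<subseteq> C" and s: "real CARD('n) < s" "1 \<le> s" and a: "0 \<le> a" "a < lambda_root s U"
  shows "\<forall>\<^sub>F N in sequentially. \<forall>K. meets_cells (1 / real N) K (C - U) \<longrightarrow> local_bound s a C K"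
proof (cases s)
  case (real \<sigma>)
  then have \<sigma>: "real CARD('n) < \<sigma>" "1 \<le> \<sigma>" using s by auto
  define b where "b = lambda_root s U"
  have b: "freq_bound s b U" using le_lambda_root_iff[OF U(1,2) s(2), of b] a by (simp add: b_def)
  have "a powr \<sigma> < b powr \<sigma>" using a \<sigma> by (intro powr_less_mono2) (auto simp: b_def)
  moreover have "b powr \<sigma> * powint \<sigma> UNIV \<phi> \<le> powint \<sigma> UNIV (grad \<phi>)" if "\<phi> \<in> C1c U" for \<phi>
    using b that real by (simp add: freq_bound_def)
  ultimately have "\<forall>\<^sub>F N in sequentially. \<forall>\<phi> K. \<phi> \<in> C1c UNIV \<longrightarrow> meets_cells (1 / real N) K (C - U) \<longrightarrow>
    (\<forall>y\<in>K. \<phi> y = 0) \<longrightarrow> a powr \<sigma> * powint \<sigma> C \<phi> \<le> powint \<sigma> C (grad \<phi>)"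
    using C U \<sigma> by (intro cell_bound_eventually[where L'="b powr \<sigma>"]) auto
  then show ?thesis
    unfolding local_bound_def real by (elim eventually_mono) simp
next
  case PInf
  show ?thesis
  proof (cases "a = 0")
    case True
    then show ?thesis by (simp add: local_bound_def PInf)
  next
    case False
    then have a0: "0 < a" using a by simp
    define b where "b = lambda_root s U"
    have ab: "a < b" using a by (simp add: b_def)
    have b: "b * r \<le> 1" if "0 < r" "ball x r \<subseteq> U" for x r
      using le_lambda_root_iff[OF U(1,2) s(2), of b] a that PInf by (simp add: b_def freq_bound_def)
    let ?d = "real CARD('n)"
    have "(\<lambda>N. ?d * (1 / real N)) \<longlonglongrightarrow> ?d * 0" by (intro tendsto_intros lim_1_over_n)
    moreover have "?d * 0 < 1 / a - 1 / b" using a0 ab by (simp add: frac_less2)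
    ultimately have "\<forall>\<^sub>F N in sequentially. ?d * (1 / real N) < 1 / a - 1 / b" by (rule order_tendstoD(2))
    then show ?thesis using eventually_gt_at_top[of 0]
    proof eventually_elim
      case (elim N)
      define h where "h = 1 / real N"
      define \<epsilon> where "\<epsilon> = ?d * h"
      have h: "0 < h" "0 < \<epsilon>" "\<epsilon> < 1 / a - 1 / b" using elim by (auto simp: h_def \<epsilon>_def)
      show ?case
      proof (intro allI impI)
        fix K assume K: "meets_cells (1 / real N) K (C - U)"
        have "a * r \<le> 1" if x: "x \<in> C" and r: "0 < r" "ball x r \<inter> K = {}" for x r
        proof -
          have "r \<le> 1 / b + \<epsilon>"
          proof (cases "r \<le> \<epsilon>")
            case True
            moreover have "0 < 1 / b" using a0 ab by simp
            ultimately show ?thesis by linarith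
          next
            case False
            have sub: "y \<in> U" if y: "y \<in> ball x (r - \<epsilon>)" "y \<in> C" for y
            proof (rule ccontr)
              assume "y \<notin> U"
              then obtain z where z: "z \<in> grid_cell h y" "z \<in> K" using K y(2) unfolding meets_cells_def h_def by blast
              have "dist x z \<le> dist x y + dist y z" by (rule dist_triangle)
              also have "dist y z \<le> \<epsilon>" unfolding \<epsilon>_def by (rule dist_grid_cell_le[OF h(1) z(1)])
              finally have "z \<in> ball x r" using y(1) by simp
              then show False using r(2) z(2) by blast
            qed
            have "ball x (r - \<epsilon>) \<subseteq> U"
            proof (rule ccontr)
              assume "\<not> ball x (r - \<epsilon>) \<subseteq> U"
              then have "ball x (r - \<epsilon>) - U \<noteq> {}" by blast
              moreover have "x \<in> ball x (r - \<epsilon>)" using False by simp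
              then have "ball x (r - \<epsilon>) \<inter> U \<noteq> {}" using sub[of x] x by blast
              ultimately have "ball x (r - \<epsilon>) \<inter> frontier U \<noteq> {}"
                by (intro connected_Int_frontier) auto
              then obtain y where y: "y \<in> ball x (r - \<epsilon>)" "y \<in> frontier U" by blast
              then have "y \<in> C" "y \<notin> U" using U by (auto simp: frontier_def interior_open)
              then show False using sub y(1) by blast
            qed
            then have "b * (r - \<epsilon>) \<le> 1" using False by (intro b) auto
            then have "r - \<epsilon> \<le> 1 / b" using a0 ab by (simp add: pos_le_divide_eq mult.commute)
            then show ?thesis by simp
          qed
          then have "r \<le> 1 / a" using h(3) by linarith
          then show ?thesis using a0 by (simp add: pos_le_divide_eq mult.commute)
        qed
        then show "local_bound s a C K" using PInf by (simp add: local_bound_def)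
      qed
    qed
  qed
qed (use s in auto)

lemma freq_bound_of_local:
  fixes C K :: "nat \<Rightarrow> (real^'n) set"
  assumes s: "1 \<le> s" and loc: "\<And>n. local_bound s a (C n) (K n)"
    and C: "\<And>n. bounded (C n)" "\<And>n. C n \<in> sets lebesgue" "disjoint_family C"
    and cover: "\<And>r. \<exists>m. ball 0 r \<subseteq> (\<Union>n<m. C n)"
  shows "freq_bound s a (- (\<Union>n. K n))"
proof (cases s)
  case PInf
  have "a * r \<le> 1" if r: "0 < r" "ball x r \<subseteq> - (\<Union>n. K n)" for x r
  proof -
    have "x \<in> ball 0 (norm x + 1)" by simp
    then obtain n where n: "x \<in> C n" using cover[of "norm x + 1"] by blast
    have "ball x r \<inter> K n = {}" using r(2) by blast
    then show ?thesis using loc[of n] n r(1) PInf by (simp add: local_bound_def)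
  qed
  then show ?thesis using PInf by (simp add: freq_bound_def)
next
  case (real \<sigma>)
  then have \<sigma>: "0 < \<sigma>" using s by simp
  have "a powr \<sigma> * powint \<sigma> UNIV \<phi> \<le> powint \<sigma> UNIV (grad \<phi>)" if \<phi>': "\<phi> \<in> C1c (- (\<Union>n. K n))" for \<phi>
  proof -
    have \<phi>: "\<phi> \<in> C1c UNIV" using \<phi>' C1c_mono[OF subset_UNIV] by blast
    obtain S where S: "compact S" "S \<subseteq> - (\<Union>n. K n)" "\<And>x. x \<notin> S \<Longrightarrow> \<phi> x = 0" using C1cE[OF \<phi>'] by metis
    obtain r where r: "S \<subseteq> ball 0 r" using bounded_subset_ballD[OF compact_imp_bounded[OF S(1)]] by blast
    obtain m where m: "ball 0 r \<subseteq> (\<Union>n<m. C n)" using cover by blast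
    show ?thesis
    proof (rule powint_tile_sum[OF \<phi> \<sigma>, of "C ` {..<m}"])
      show "disjoint (C ` {..<m})"
        using C(3) by (intro disjoint_family_on_disjoint_image) (auto simp: disjoint_family_on_def)
      show "bounded B \<and> B \<in> sets lebesgue" if "B \<in> C ` {..<m}" for B using that C by auto
      show "x \<in> \<Union> (C ` {..<m})" if "\<phi> x \<noteq> 0" for x using S(3)[of x] that r m by blast
      show "a powr \<sigma> * powint \<sigma> B \<phi> \<le> powint \<sigma> B (grad \<phi>)" if B: "B \<in> C ` {..<m}" for B
      proof -
        obtain n where n: "B = C n" using B by blast
        have "\<phi> y = 0" if "y \<in> K n" for y using S(2,3) that by blast
        then show ?thesis using loc[of n] \<phi> real n by (simp add: local_bound_def)
      qed
    qed simp
  qed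
  then show ?thesis using real by (simp add: freq_bound_def)
qed (use s in auto)

text \<open>Differences of these boxes serve as cells. Integer size makes them unions of unit grid cells.\<close>

definition int_box :: "nat \<Rightarrow> (real^'n) set" where
  "int_box r = {y. \<forall>i. - real r \<le> y $ i \<and> y $ i < real r}"

lemma int_box_0 [simp]: "int_box 0 = ({} :: (real^'n) set)"
  by (auto simp: int_box_def not_less)

lemma int_box_mono: "r \<le> r' \<Longrightarrow> int_box r \<subseteq> (int_box r' :: (real^'n) set)"
proof
  fix y :: "real^'n" assume "r \<le> r'" and y: "y \<in> int_box r"
  then have "real r \<le> real r'" by simp
  moreover have "- real r \<le> y $ i \<and> y $ i < real r" for i using y by (simp add: int_box_def)
  ultimately have "- real r' \<le> y $ i \<and> y $ i < real r'" for i by (metis less_le_trans neg_le_iff_le order_trans)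
  then show "y \<in> int_box r'" by (simp add: int_box_def)
qed

lemma int_box_grid_cell:
  assumes "y \<in> grid_cell 1 x"
  shows "y \<in> int_box r \<longleftrightarrow> x \<in> int_box r"
proof -
  have f: "- real r \<le> u \<and> u < real r \<longleftrightarrow> - int r \<le> \<lfloor>u\<rfloor> \<and> \<lfloor>u\<rfloor> < int r" for u :: real
    using le_floor_iff[of "- int r" u] floor_less_iff[of u "int r"] by simp
  have "\<lfloor>y $ i\<rfloor> = \<lfloor>x $ i\<rfloor>" for i using assms by (simp add: grid_cell_def)
  then show ?thesis unfolding int_box_def mem_Collect_eq f by simp
qed

lemma int_box_bounded_measurable: "bounded (int_box r)" "int_box r \<in> sets lebesgue"
  using half_open_box[of "\<lambda>_. - real r" "\<lambda>_. real r"] by (auto simp: int_box_def)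

lemma locally_finite_discrete:
  fixes X :: "(real^'n) set"
  assumes "\<And>r. finite (X \<inter> ball 0 r)"
  shows "closed X" "discrete X" "\<not> x islimpt X"
proof -
  show *: "\<not> x islimpt X" for x
  proof
    assume "x islimpt X"
    then have "infinite (X \<inter> ball x 1)" by (simp add: islimpt_eq_infinite_ball)
    moreover have "ball x 1 \<subseteq> ball 0 (norm x + 1)" by (simp add: ball_subset_ball_iff)
    then have "X \<inter> ball x 1 \<subseteq> X \<inter> ball 0 (norm x + 1)" by blast
    ultimately show False using assms finite_subset by blast
  qed
  show "closed X" using * by (simp add: closed_limpt)
  show "discrete X" using * by (simp add: discrete_def isolated_in_islimpt_iff)
qed

lemma finite_net_exists:
  fixes X :: "(real^'n) set"
  assumes "bounded X" "0 < h"
  obtains K where "finite K" "K \<subseteq> X" "meets_cells h K X"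
proof -
  define pick where "pick = (\<lambda>Q. SOME y. y \<in> Q \<inter> X)"
  have pick: "pick (grid_cell h x) \<in> grid_cell h x \<inter> X" if "x \<in> X" for x
  proof -
    have "x \<in> grid_cell h x \<inter> X" using that by simp
    then show ?thesis unfolding pick_def by (rule someI)
  qed
  show ?thesis
  proof (rule that)
    show "finite (pick ` grid_cell h ` X)" using finite_grid_cells[OF assms] by simp
    show "pick ` grid_cell h ` X \<subseteq> X" using pick by blast
    show "meets_cells h (pick ` grid_cell h ` X) X" unfolding meets_cells_def using pick by blast
  qed
qed

text \<open>The space is partitioned into frames \<open>C n\<close> between consecutive integer boxes, the \<open>n\<close>-th frame being thick
  enough to hold a translate of \<open>U n\<close> near its corner with all coordinates positive. In each frame a
  finite set of points, fine enough for both exponents, replaces the complement of that translate.\<close>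

lemma discrete_gluing:
  fixes U :: "nat \<Rightarrow> (real^'n) set" and q p :: ereal
  assumes q: "real CARD('n) < q" and p: "real CARD('n) < p" and a: "0 \<le> a" and b: "0 \<le> b"
    and U: "\<And>n. open (U n)" "\<And>n. U n \<noteq> {}" "\<And>n. bounded (U n)"
    and Ua: "\<And>n. a < lambda_root q (U n)" and Ub: "\<And>n. b < lambda_root p (U n)"
  obtains \<Omega> where "open \<Omega>" "\<forall>n. \<exists>c. (\<lambda>x. x + c) ` U n \<subseteq> \<Omega>" "discrete (- \<Omega>)" "\<forall>x. \<not> x islimpt (- \<Omega>)"
    "a \<le> lambda_root q \<Omega>" "b \<le> lambda_root p \<Omega>"
proof -
  have q1: "1 \<le> q" and p1: "1 \<le> p" using one_le_of_card_less q p by blast+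
  have "\<exists>\<rho>::nat. U n \<subseteq> cball 0 (real \<rho>)" for n
  proof -
    obtain r where r: "\<And>x. x \<in> U n \<Longrightarrow> norm x \<le> r" using U(3)[of n] bounded_iff by blast
    obtain \<rho> :: nat where "r \<le> real \<rho>" using real_arch_simple by blast
    then show ?thesis using r by (intro exI[of _ \<rho>]) (force simp: subset_iff)
  qed
  then obtain \<rho> :: "nat \<Rightarrow> nat" where \<rho>: "\<And>n. U n \<subseteq> cball 0 (real (\<rho> n))" by metis
  define R where "R = (\<lambda>n. \<Sum>k<n. 2 * \<rho> k + 2)"
  have R0: "R 0 = 0" and RS: "R (Suc n) = R n + (2 * \<rho> n + 2)" for n by (simp_all add: R_def)
  have Rmono: "R m \<le> R n" if "m \<le> n" for m n using that by (rule lift_Suc_mono_le[of R, rotated]) (simp add: RS)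
  have Rge: "n \<le> R n" for n by (induction n) (auto simp: RS)
  define C :: "nat \<Rightarrow> (real^'n) set" where "C = (\<lambda>n. int_box (R (Suc n)) - int_box (R n))"
  have Cb: "bounded (C n)" "C n \<in> sets lebesgue" for n
    using bounded_subset[OF int_box_bounded_measurable(1)[of "R (Suc n)"], of "C n"]
      int_box_bounded_measurable(2) by (auto simp: C_def)
  have Csat: "grid_cell 1 x \<subseteq> C n" if "x \<in> C n" for n x
    using that int_box_grid_cell by (auto simp: C_def)
  have Cdisj: "C m \<inter> C n = {}" if "m < n" for m n
    using int_box_mono[OF Rmono[of "Suc m" n]] that by (auto simp: C_def)
  then have Cdisj': "C m \<inter> C n = {}" if "m \<noteq> n" for m n using that by (metis Int_commute linorder_neqE_nat)
  have Ccover: "int_box (R m) = (\<Union>n<m. C n)" for m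
  proof (induction m)
    case (Suc m)
    have "int_box (R (Suc m)) = int_box (R m) \<union> C m"
      using int_box_mono[OF Rmono[of m "Suc m"]] by (auto simp: C_def)
    then show ?case using Suc by (auto simp: lessThan_Suc)
  qed (simp add: R0)
  have cover: "\<exists>m. ball 0 r \<subseteq> (\<Union>n<m. C n)" for r
  proof -
    obtain m :: nat where "r \<le> real m" using real_arch_simple by blast
    then have m: "r \<le> real (R m)" using Rge[of m] by linarith
    have "ball (0::real^'n) r \<subseteq> int_box (R m)"
    proof
      fix x :: "real^'n" assume "x \<in> ball 0 r"
      then have "\<bar>x $ i\<bar> < real (R m)" for i using component_le_norm_cart[of x i] m by simp
      then have "x $ i < real (R m)" "- (x $ i) < real (R m)" for i unfolding abs_less_iff by blast+
      then have "- real (R m) \<le> x $ i \<and> x $ i < real (R m)" for i by (simp add: minus_le_iff less_imp_le)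
      then show "x \<in> int_box (R m)" by (simp add: int_box_def)
    qed
    then show ?thesis using Ccover by auto
  qed
  \<comment> \<open>The centre \<open>c n\<close> is chosen such that all coordinates of the translate lie strictly between \<open>R n\<close> and \<open>R (Suc n)\<close>.\<close>
  define c :: "nat \<Rightarrow> real^'n" where "c = (\<lambda>n. vec (real (R n + \<rho> n + 1)))"
  define V where "V = (\<lambda>n. (\<lambda>x. 1 *\<^sub>R x + c n) ` U n)"
  have Veq: "V n = (\<lambda>x. x + c n) ` U n" for n by (simp add: V_def)
  have Vopen: "open (V n)" for n using open_translation[OF U(1)[of n], of "c n"] by (simp add: Veq add.commute)
  have Vne: "V n \<noteq> {}" for n using U(2) by (simp add: V_def)
  have Vq: "a < lambda_root q (V n)" and Vp: "b < lambda_root p (V n)" for n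
    using Ua[of n] Ub[of n] lambda_root_affinity[OF U(1,2)[of n] q1, of 1 "c n"]
      lambda_root_affinity[OF U(1,2)[of n] p1, of 1 "c n"] by (simp_all add: V_def)
  have VC: "closure (V n) \<subseteq> C n" for n
  proof -
    have "V n \<subseteq> cball (c n) (\<rho> n)" using \<rho>[of n] by (auto simp: Veq dist_norm)
    then have "closure (V n) \<subseteq> cball (c n) (\<rho> n)" by (rule closure_minimal) simp
    also have "\<dots> \<subseteq> C n"
    proof
      fix y assume "y \<in> cball (c n) (\<rho> n)"
      then have "\<bar>(c n - y) $ i\<bar> \<le> \<rho> n" for i
        using component_le_norm_cart[of "c n - y" i] by (simp add: dist_norm)
      then have y: "\<bar>(R n + \<rho> n + 1) - y $ i\<bar> \<le> \<rho> n" for i by (simp add: c_def)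
      have y': "R n + 1 \<le> y $ i \<and> y $ i \<le> R n + 2 * \<rho> n + 1" for i
        using y[of i] by (auto simp: abs_le_iff)
      have "y \<in> int_box (R (Suc n))" unfolding int_box_def mem_Collect_eq
      proof
        fix i show "- real (R (Suc n)) \<le> y $ i \<and> y $ i < real (R (Suc n))"
          using y'[of i] by (simp add: RS)
      qed
      moreover have "y \<notin> int_box (R n)" 
      proof
        assume "y \<in> int_box (R n)"
        then have "y $ i < R n" for i by (simp add: int_box_def)
        moreover obtain i :: 'n where True by blast
        ultimately have "y $ i < R n" by blast
        then show False using y'[of i] by simp
      qed
      ultimately show "y \<in> C n" by (simp add: C_def)
    qed
    finally show ?thesis .
  qed
  have "\<exists>K. finite K \<and> K \<subseteq> C n - V n \<and> local_bound q a (C n) K \<and> local_bound p b (C n) K" for n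
  proof -
    have "\<forall>\<^sub>F N in sequentially. \<forall>K. meets_cells (1 / real N) K (C n - V n) \<longrightarrow> local_bound q a (C n) K"
      by (rule local_bound_eventually[OF Cb Csat Vopen Vne VC q q1 a Vq])
    moreover have "\<forall>\<^sub>F N in sequentially. \<forall>K. meets_cells (1 / real N) K (C n - V n) \<longrightarrow> local_bound p b (C n) K"
      by (rule local_bound_eventually[OF Cb Csat Vopen Vne VC p p1 b Vp])
    moreover have "\<forall>\<^sub>F N::nat in sequentially. 0 < N" by (rule eventually_gt_at_top)
    ultimately have "\<forall>\<^sub>F N in sequentially. 0 < N \<and> (\<forall>K. meets_cells (1 / real N) K (C n - V n) \<longrightarrow> local_bound q a (C n) K)
        \<and> (\<forall>K. meets_cells (1 / real N) K (C n - V n) \<longrightarrow> local_bound p b (C n) K)"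
      by (intro eventually_conj)
    then obtain N where N: "0 < N" "\<forall>K. meets_cells (1 / real N) K (C n - V n) \<longrightarrow> local_bound q a (C n) K"
      "\<forall>K. meets_cells (1 / real N) K (C n - V n) \<longrightarrow> local_bound p b (C n) K"
      using eventually_happens'[OF sequentially_bot] by blast
    have "bounded (C n - V n)" using Cb(1)[of n] by (rule bounded_subset) blast
    moreover have "0 < 1 / real N" using N(1) by simp
    ultimately obtain K where "finite K" "K \<subseteq> C n - V n" "meets_cells (1 / real N) K (C n - V n)"
      by (rule finite_net_exists)
    then show ?thesis using N by blast
  qed
  then obtain K where K: "\<And>n. finite (K n)" "\<And>n. K n \<subseteq> C n - V n"
    "\<And>n. local_bound q a (C n) (K n)" "\<And>n. local_bound p b (C n) (K n)" by metis
  define \<Omega> where "\<Omega> = - (\<Union>n. K n)"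
  have "finite ((\<Union>n. K n) \<inter> ball 0 r)" for r
  proof -
    obtain m where m: "ball 0 r \<subseteq> (\<Union>n<m. C n)" using cover by blast
    have "(\<Union>n. K n) \<inter> ball 0 r \<subseteq> (\<Union>n<m. K n)"
    proof
      fix x assume x: "x \<in> (\<Union>n. K n) \<inter> ball 0 r"
      then obtain k where k: "x \<in> K k" by blast
      obtain n where n: "n < m" "x \<in> C n" using x m by blast
      have "x \<in> C k" using K(2) k by blast
      then have "k = n" using Cdisj'[of k n] n(2) by blast
      then show "x \<in> (\<Union>n<m. K n)" using k n(1) by blast
    qed
    then show ?thesis by (rule finite_subset) (use K(1) in auto)
  qed
  note lf = locally_finite_discrete[OF this]
  have o: "open \<Omega>" unfolding \<Omega>_def using lf(1) by (rule open_Compl)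
  have V\<Omega>: "V n \<subseteq> \<Omega>" for n
  proof
    fix x assume x: "x \<in> V n"
    then have xC: "x \<in> C n" using VC[of n] closure_subset by blast
    have "x \<notin> K k" for k
    proof (cases "k = n")
      case True
      then show ?thesis using K(2) x by blast
    next
      case False
      then show ?thesis using Cdisj'[OF False] K(2) xC by blast
    qed
    then show "x \<in> \<Omega>" by (simp add: \<Omega>_def)
  qed
  have ne: "\<Omega> \<noteq> {}" using V\<Omega>[of 0] Vne[of 0] by blast
  have dC: "disjoint_family C" using Cdisj' by (simp add: disjoint_family_on_def)
  show ?thesis
  proof (rule that[OF o])
    show "\<forall>n. \<exists>c. (\<lambda>x. x + c) ` U n \<subseteq> \<Omega>" using V\<Omega> unfolding Veq by blast
    show "discrete (- \<Omega>)" using lf(2) by (simp add: \<Omega>_def)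
    show "\<forall>x. \<not> x islimpt (- \<Omega>)" using lf(3) by (simp add: \<Omega>_def)
    have "freq_bound q a \<Omega>" unfolding \<Omega>_def by (rule freq_bound_of_local[OF q1 K(3) Cb dC cover])
    then show "a \<le> lambda_root q \<Omega>" using le_lambda_root_iff[OF o ne q1 a] by simp
    have "freq_bound p b \<Omega>" unfolding \<Omega>_def by (rule freq_bound_of_local[OF p1 K(4) Cb dC cover])
    then show "b \<le> lambda_root p \<Omega>" using le_lambda_root_iff[OF o ne p1 b] by simp
  qed
qed

text \<open>Shrinking \<open>U n\<close> by \<open>t n < 1\<close> makes its frequencies strictly larger than \<open>a\<close> and \<open>b\<close>, as the gluing
  requires, while \<open>t n \<longlonglongrightarrow> 1\<close> preserves the limits. The glued set contains all pieces, so its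
  frequencies cannot exceed these limits.\<close>

lemma discrete_complement_attains_limits:
  fixes U :: "nat \<Rightarrow> (real^'n) set" and q p :: ereal
  assumes q: "real CARD('n) < q" and p: "real CARD('n) < p" and a: "0 \<le> a" and b: "0 \<le> b"
    and U: "\<And>n. open (U n)" "\<And>n. U n \<noteq> {}" "\<And>n. bounded (U n)"
    and Ua: "\<And>n. a \<le> lambda_root q (U n)" "(\<lambda>n. lambda_root q (U n)) \<longlonglongrightarrow> a"
    and Ub: "\<And>n. b \<le> lambda_root p (U n)" "(\<lambda>n. lambda_root p (U n)) \<longlonglongrightarrow> b"
  obtains \<Omega> :: "(real^'n) set" where "open \<Omega>" "\<Omega> \<noteq> {}" "discrete (- \<Omega>)" "\<forall>x. \<not> x islimpt (- \<Omega>)"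
    "lambda_root q \<Omega> = a" "lambda_root p \<Omega> = b"
proof -
  have q1: "1 \<le> q" and p1: "1 \<le> p" using one_le_of_card_less q p by blast+
  define t where "t = (\<lambda>n. 1 - 1 / (real n + 2))"
  have t: "0 < t n" "t n < 1" for n by (auto simp: t_def field_simps)
  have tlim: "t \<longlonglongrightarrow> 1" unfolding t_def by real_asymp
  define V where "V = (\<lambda>n. (\<lambda>x. t n *\<^sub>R x + 0) ` U n)"
  have V: "open (V n)" "V n \<noteq> {}" "bounded (V n)" for n
    using open_scaling[OF _ U(1)[of n], of "t n"] t(1)[of n] U(2) bounded_scaling[OF U(3)[of n], of "t n"]
    by (auto simp: V_def)
  have Vs: "lambda_root s (V n) = lambda_root s (U n) / t n" if "1 \<le> s" for s n
    unfolding V_def by (rule lambda_root_affinity[OF U(1,2) that t(1)])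
  have less: "lambda_root s (U n) < lambda_root s (V n)" if s: "real CARD('n) < s" for s :: ereal and n
  proof -
    have "lambda_root s (U n) = t n * lambda_root s (V n)"
      using t(1)[of n] Vs[OF one_le_of_card_less[OF s], of n] by simp
    also have "\<dots> < 1 * lambda_root s (V n)"
      using t(2) lambda_root_pos[OF V s] by (rule mult_strict_right_mono)
    finally show ?thesis by simp
  qed
  have Va: "a < lambda_root q (V n)" and Vb: "b < lambda_root p (V n)" for n
    using Ua(1)[of n] Ub(1)[of n] less[OF q, of n] less[OF p, of n] by linarith+
  obtain \<Omega> where \<Omega>: "open \<Omega>" "\<forall>n. \<exists>c. (\<lambda>x. x + c) ` V n \<subseteq> \<Omega>" "discrete (- \<Omega>)" "\<forall>x. \<not> x islimpt (- \<Omega>)"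
    "a \<le> lambda_root q \<Omega>" "b \<le> lambda_root p \<Omega>"
    by (rule discrete_gluing[OF q p a b V Va Vb])
  have ne: "\<Omega> \<noteq> {}" using \<Omega>(2) V(2)[of 0] by blast
  have le: "lambda_root s \<Omega> \<le> lambda_root s (U n) / t n" if "1 \<le> s" for s n
  proof -
    obtain c where c: "(\<lambda>x. x + c) ` V n \<subseteq> \<Omega>" using \<Omega>(2) by blast
    have "lambda_root s \<Omega> \<le> lambda_root s ((\<lambda>x. 1 *\<^sub>R x + c) ` V n)"
      using c V[of n] open_translation[of "V n" c] by (intro lambda_root_antimono \<Omega>(1) that) (auto simp: add.commute)
    also have "\<dots> = lambda_root s (V n)" using lambda_root_affinity[OF V(1)[of n] V(2)[of n] that, of 1 c] by simp
    finally show ?thesis using Vs[OF that] by simp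
  qed
  have "(\<lambda>n. lambda_root q (U n) / t n) \<longlonglongrightarrow> a / 1" "(\<lambda>n. lambda_root p (U n) / t n) \<longlonglongrightarrow> b / 1"
    using Ua(2) Ub(2) tlim by (intro tendsto_divide; simp)+
  then have "lambda_root q \<Omega> \<le> a" "lambda_root p \<Omega> \<le> b"
    using LIMSEQ_le_const[of "\<lambda>n. lambda_root q (U n) / t n" "a / 1" "lambda_root q \<Omega>"]
      LIMSEQ_le_const[of "\<lambda>n. lambda_root p (U n) / t n" "b / 1" "lambda_root p \<Omega>"] le[OF q1] le[OF p1] by auto
  then show ?thesis using that[OF \<Omega>(1) ne \<Omega>(3,4)] \<Omega>(5,6) by (simp add: antisym)
qed

lemma admissible_iff:
  fixes \<Omega> :: "(real^'n) set"
  assumes "1 \<le> q"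
  shows "\<Omega> \<in> admissible q \<longleftrightarrow> open \<Omega> \<and> \<Omega> \<noteq> {} \<and> 0 < lambda_root (ereal q) \<Omega>"
proof -
  have "0 < lambda q \<Omega> \<longleftrightarrow> 0 < lambda_root (ereal q) \<Omega>" if \<Omega>: "open \<Omega>" "\<Omega> \<noteq> {}"
  proof -
    have "0 \<le> lambda q \<Omega>" using le_lambda_iff[OF \<Omega> assms, of 0] powint_nonneg by auto
    then show ?thesis by (auto simp: lambda_root_def)
  qed
  then show ?thesis by (auto simp: admissible_def)
qed

text \<open>Both frequencies of \<open>\<Omega>\<close> are approximated from above by bounded subsets, and by monotonicity the union of two such
  subsets approximates them simultaneously.\<close>

lemma bounded_approximation:
  fixes \<Omega> :: "(real^'n) set"
  assumes q: "1 \<le> q" and p: "1 \<le> p" and \<Omega>: "\<Omega> \<in> admissible q" and e: "0 < e"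
  obtains A :: "(real^'n) set" where "open A" "A \<noteq> {}" "bounded A" "\<bar>F_ratio p q A - F_ratio p q \<Omega>\<bar> < e"
proof -
  have o: "open \<Omega>" "\<Omega> \<noteq> {}" and pos: "0 < lambda_root (ereal q) \<Omega>" using \<Omega> admissible_iff[OF q] by blast+
  have q': "1 \<le> ereal q" using q by (simp add: one_ereal_def)
  have "\<exists>A::(real^'n) set. open A \<and> A \<noteq> {} \<and> bounded A \<and> lambda_root q \<Omega> \<le> lambda_root q A \<and> lambda_root q A \<le> lambda_root q \<Omega> + 1 / Suc k
      \<and> lambda_root p \<Omega> \<le> lambda_root p A \<and> lambda_root p A \<le> lambda_root p \<Omega> + 1 / Suc k" for k :: nat
  proof -
    have less: "lambda_root s \<Omega> < lambda_root s \<Omega> + 1 / Suc k" for s by simp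
    obtain A1 where A1: "A1 \<subseteq> \<Omega>" "open A1" "bounded A1" "A1 \<noteq> {}" "lambda_root q A1 < lambda_root q \<Omega> + 1 / Suc k"
      by (rule lambda_root_bounded_subset[OF o q' less])
    obtain A2 where A2: "A2 \<subseteq> \<Omega>" "open A2" "bounded A2" "A2 \<noteq> {}" "lambda_root p A2 < lambda_root p \<Omega> + 1 / Suc k"
      by (rule lambda_root_bounded_subset[OF o p less])
    have A: "open (A1 \<union> A2)" "A1 \<union> A2 \<noteq> {}" "bounded (A1 \<union> A2)" "A1 \<union> A2 \<subseteq> \<Omega>" using A1 A2 by auto
    show ?thesis
    proof (intro exI[of _ "A1 \<union> A2"] conjI A)
      show "lambda_root q \<Omega> \<le> lambda_root q (A1 \<union> A2)" by (rule lambda_root_antimono[OF A(1,2) o(1) A(4) q'])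
      show "lambda_root p \<Omega> \<le> lambda_root p (A1 \<union> A2)" by (rule lambda_root_antimono[OF A(1,2) o(1) A(4) p])
      have "lambda_root q (A1 \<union> A2) \<le> lambda_root q A1" by (rule lambda_root_antimono[OF A1(2,4) A(1) _ q']) blast
      then show "lambda_root q (A1 \<union> A2) \<le> lambda_root q \<Omega> + 1 / Suc k" using A1(5) by linarith
      have "lambda_root p (A1 \<union> A2) \<le> lambda_root p A2" by (rule lambda_root_antimono[OF A2(2,4) A(1) _ p]) blast
      then show "lambda_root p (A1 \<union> A2) \<le> lambda_root p \<Omega> + 1 / Suc k" using A2(5) by linarith
    qed
  qed
  then obtain A :: "nat \<Rightarrow> (real^'n) set" where A: "\<And>k. open (A k)" "\<And>k. A k \<noteq> {}" "\<And>k. bounded (A k)"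
    "\<And>k. lambda_root q \<Omega> \<le> lambda_root q (A k)" "\<And>k. lambda_root q (A k) \<le> lambda_root q \<Omega> + 1 / Suc k"
    "\<And>k. lambda_root p \<Omega> \<le> lambda_root p (A k)" "\<And>k. lambda_root p (A k) \<le> lambda_root p \<Omega> + 1 / Suc k"
    by metis
  have lim: "(\<lambda>k. l + 1 / real (Suc k)) \<longlonglongrightarrow> l" for l
    using tendsto_add[OF tendsto_const[of l] lim_inverse_n'[THEN LIMSEQ_Suc]] by (simp add: inverse_eq_divide)
  have "(\<lambda>k. lambda_root q (A k)) \<longlonglongrightarrow> lambda_root q \<Omega>" "(\<lambda>k. lambda_root p (A k)) \<longlonglongrightarrow> lambda_root p \<Omega>"
    by (rule tendsto_sandwich[OF _ _ tendsto_const lim]; use A in auto)+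
  then have "(\<lambda>k. F_ratio p q (A k)) \<longlonglongrightarrow> F_ratio p q \<Omega>"
    unfolding F_ratio_def using pos by (intro tendsto_divide) auto
  from LIMSEQ_D[OF this e] obtain k where "\<forall>n\<ge>k. norm (F_ratio p q (A n) - F_ratio p q \<Omega>) < e" ..
  then have "\<bar>F_ratio p q (A k) - F_ratio p q \<Omega>\<bar> < e" by simp
  then show ?thesis by (rule that[OF A(1-3)])
qed

section \<open>Extremal sets\<close>

lemma bounded_admissible:
  fixes A :: "(real^'n) set"
  assumes "open A" "A \<noteq> {}" "bounded A" and q: "real CARD('n) < q"
  shows "A \<in> admissible q"
proof -
  have q': "real CARD('n) < ereal q" using q by simp
  then have "1 \<le> q" using one_le_of_card_less[OF q'] by (simp add: one_ereal_def)
  then show ?thesis using admissible_iff lambda_root_pos[OF assms(1-3) q'] assms(1,2) by blast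
qed

lemma bounded_sequence_approximating:
  fixes e :: real and p :: ereal
  assumes q: "1 \<le> q" and p: "1 \<le> p"
    and approx: "\<And>\<delta>. 0 < \<delta> \<Longrightarrow> \<exists>\<Omega>\<in>(admissible q :: (real^'n) set set). \<bar>F_ratio p q \<Omega> - e\<bar> < \<delta>"
  obtains U :: "nat \<Rightarrow> (real^'n) set" where "\<And>n. open (U n)" "\<And>n. U n \<noteq> {}" "\<And>n. bounded (U n)"
    "(\<lambda>n. F_ratio p q (U n)) \<longlonglongrightarrow> e"
proof -
  have "\<exists>U::(real^'n) set. open U \<and> U \<noteq> {} \<and> bounded U \<and> \<bar>F_ratio p q U - e\<bar> < 1 / Suc n" for n :: nat
  proof -
    define \<delta> where "\<delta> = 1 / Suc n / 2"
    have \<delta>: "0 < \<delta>" by (simp add: \<delta>_def)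
    obtain \<Omega> :: "(real^'n) set" where \<Omega>: "\<Omega> \<in> admissible q" "\<bar>F_ratio p q \<Omega> - e\<bar> < \<delta>" using approx[OF \<delta>] by blast
    obtain U :: "(real^'n) set" where U: "open U" "U \<noteq> {}" "bounded U" "\<bar>F_ratio p q U - F_ratio p q \<Omega>\<bar> < \<delta>"
      by (rule bounded_approximation[OF q p \<Omega>(1) \<delta>])
    have "\<delta> + \<delta> = 1 / Suc n" unfolding \<delta>_def by (rule field_sum_of_halves)
    then have "\<bar>F_ratio p q U - e\<bar> < 1 / Suc n" using U(4) \<Omega>(2) by linarith
    then show ?thesis using U by blast
  qed
  then obtain U :: "nat \<Rightarrow> (real^'n) set" where U: "\<And>n. open (U n)" "\<And>n. U n \<noteq> {}" "\<And>n. bounded (U n)"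
    "\<And>n. \<bar>F_ratio p q (U n) - e\<bar> < 1 / Suc n" by metis
  have "(\<lambda>n. F_ratio p q (U n) - e) \<longlonglongrightarrow> 0"
  proof (rule Lim_null_comparison)
    show "\<forall>\<^sub>F n in sequentially. norm (F_ratio p q (U n) - e) \<le> 1 / real (Suc n)"
      using U(4) by (intro always_eventually) (simp add: less_imp_le)
    show "(\<lambda>n. 1 / real (Suc n)) \<longlonglongrightarrow> 0" using LIMSEQ_Suc[OF lim_1_over_n] .
  qed
  then show ?thesis using that[OF U(1-3)] by (simp add: LIM_zero_iff)
qed

lemma normalize_lambda_root:
  fixes U :: "(real^'n) set"
  assumes U: "open U" "U \<noteq> {}" "bounded U" and t: "0 < t"
  obtains W :: "(real^'n) set" where "open W" "W \<noteq> {}" "bounded W" "\<And>s. 1 \<le> s \<Longrightarrow> lambda_root s W = lambda_root s U / t"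
proof
  let ?W = "(\<lambda>x. t *\<^sub>R x + 0) ` U"
  show "open ?W" "?W \<noteq> {}" "bounded ?W"
    using open_scaling[OF _ U(1), of t] t U(2) bounded_scaling[OF U(3), of t] by auto
  show "lambda_root s ?W = lambda_root s U / t" if "1 \<le> s" for s
    by (rule lambda_root_affinity[OF U(1,2) that t])
qed

text \<open>With \<open>lambda_root q\<close> normalized to \<open>1\<close>, the ratios are the values of \<open>lambda_root p\<close>, which approach
  their infimum from above.\<close>

lemma minimum_attained:
  fixes m :: real and p :: ereal
  assumes q: "real CARD('n) < q" and p: "real CARD('n) < p"
    and lower: "\<And>\<Omega>. \<Omega> \<in> (admissible q :: (real^'n) set set) \<Longrightarrow> m \<le> F_ratio p q \<Omega>"
    and approx: "\<And>\<delta>. 0 < \<delta> \<Longrightarrow> \<exists>\<Omega>\<in>(admissible q :: (real^'n) set set). \<bar>F_ratio p q \<Omega> - m\<bar> < \<delta>"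
    and m: "0 \<le> m"
  obtains \<Omega> :: "(real^'n) set" where "\<Omega> \<in> admissible q" "F_ratio p q \<Omega> = m" "discrete (- \<Omega>)" "\<forall>x. \<not> x islimpt (- \<Omega>)"
proof -
  have q': "real CARD('n) < ereal q" using q by simp
  have eq1: "1 \<le> ereal q" and p1: "1 \<le> p" using one_le_of_card_less q' p by blast+
  then have q1: "1 \<le> q" by (simp add: one_ereal_def)
  obtain U :: "nat \<Rightarrow> (real^'n) set" where U: "\<And>n. open (U n)" "\<And>n. U n \<noteq> {}" "\<And>n. bounded (U n)"
    "(\<lambda>n. F_ratio p q (U n)) \<longlonglongrightarrow> m"
    using bounded_sequence_approximating[OF q1 p1 approx] by metis
  have pos: "0 < lambda_root (ereal q) (U n)" for n by (rule lambda_root_pos[OF U(1-3) q'])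
  have "\<exists>W::(real^'n) set. open W \<and> W \<noteq> {} \<and> bounded W \<and> lambda_root (ereal q) W = 1 \<and> lambda_root p W = F_ratio p q (U n)" for n
  proof -
    obtain W :: "(real^'n) set" where W: "open W" "W \<noteq> {}" "bounded W"
      "\<And>s. 1 \<le> s \<Longrightarrow> lambda_root s W = lambda_root s (U n) / lambda_root (ereal q) (U n)"
      using normalize_lambda_root[OF U(1)[of n] U(2)[of n] U(3)[of n] pos[of n]] by metis
    then show ?thesis using W(4)[OF eq1] W(4)[OF p1] pos[of n] by (intro exI[of _ W]) (simp add: F_ratio_def)
  qed
  then obtain W :: "nat \<Rightarrow> (real^'n) set" where W: "\<And>n. open (W n)" "\<And>n. W n \<noteq> {}" "\<And>n. bounded (W n)"
    "\<And>n. lambda_root (ereal q) (W n) = 1" "\<And>n. lambda_root p (W n) = F_ratio p q (U n)" by metis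
  have 1: "1 \<le> lambda_root (ereal q) (W n)" for n by (simp add: W(4))
  have 2: "(\<lambda>n. lambda_root (ereal q) (W n)) \<longlonglongrightarrow> 1" by (simp add: W(4))
  have 3: "m \<le> lambda_root p (W n)" for n using lower[OF bounded_admissible[OF U(1-3) q]] by (simp add: W(5))
  have 4: "(\<lambda>n. lambda_root p (W n)) \<longlonglongrightarrow> m" using U(4) by (simp add: W(5))
  obtain \<Omega> :: "(real^'n) set" where \<Omega>: "open \<Omega>" "\<Omega> \<noteq> {}" "discrete (- \<Omega>)" "\<forall>x. \<not> x islimpt (- \<Omega>)"
    "lambda_root (ereal q) \<Omega> = 1" "lambda_root p \<Omega> = m"
    by (rule discrete_complement_attains_limits[OF q' p zero_le_one m W(1-3) 1 2 3 4])
  have "\<Omega> \<in> admissible q" using \<Omega> by (simp add: admissible_iff[OF q1])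
  moreover have "F_ratio p q \<Omega> = m" using \<Omega> by (simp add: F_ratio_def)
  ultimately show ?thesis using that \<Omega>(3,4) by blast
qed

text \<open>With \<open>lambda_root p\<close> normalized to \<open>1\<close>, the inverse ratios are the values of \<open>lambda_root q\<close>. They
  approach \<open>1 / M\<close> from above, so that the supremum of the ratios turns into an infimum of frequencies.\<close>

lemma maximum_attained:
  fixes M :: real and p :: ereal
  assumes q: "real CARD('n) < q" and p: "real CARD('n) < p"
    and upper: "\<And>\<Omega>. \<Omega> \<in> (admissible q :: (real^'n) set set) \<Longrightarrow> F_ratio p q \<Omega> \<le> M"
    and approx: "\<And>\<delta>. 0 < \<delta> \<Longrightarrow> \<exists>\<Omega>\<in>(admissible q :: (real^'n) set set). \<bar>F_ratio p q \<Omega> - M\<bar> < \<delta>"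
  obtains \<Omega> :: "(real^'n) set" where "\<Omega> \<in> admissible q" "F_ratio p q \<Omega> = M" "discrete (- \<Omega>)" "\<forall>x. \<not> x islimpt (- \<Omega>)"
proof -
  have q': "real CARD('n) < ereal q" using q by simp
  have eq1: "1 \<le> ereal q" and p1: "1 \<le> p" using one_le_of_card_less q' p by blast+
  then have q1: "1 \<le> q" by (simp add: one_ereal_def)
  obtain U :: "nat \<Rightarrow> (real^'n) set" where U: "\<And>n. open (U n)" "\<And>n. U n \<noteq> {}" "\<And>n. bounded (U n)"
    "(\<lambda>n. F_ratio p q (U n)) \<longlonglongrightarrow> M"
    using bounded_sequence_approximating[OF q1 p1 approx] by metis
  have pos: "0 < lambda_root p (U n)" for n by (rule lambda_root_pos[OF U(1-3) p])
  have Fpos: "0 < F_ratio p q (U n)" for n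
    using pos[of n] lambda_root_pos[OF U(1-3) q', of n] by (simp add: F_ratio_def)
  have FM: "F_ratio p q (U n) \<le> M" for n by (rule upper[OF bounded_admissible[OF U(1-3) q]])
  have M: "0 < M" using Fpos[of 0] FM[of 0] by linarith
  have "\<exists>W::(real^'n) set. open W \<and> W \<noteq> {} \<and> bounded W \<and> lambda_root (ereal q) W = 1 / F_ratio p q (U n) \<and> lambda_root p W = 1" for n
  proof -
    obtain W :: "(real^'n) set" where W: "open W" "W \<noteq> {}" "bounded W"
      "\<And>s. 1 \<le> s \<Longrightarrow> lambda_root s W = lambda_root s (U n) / lambda_root p (U n)"
      using normalize_lambda_root[OF U(1)[of n] U(2)[of n] U(3)[of n] pos[of n]] by metis
    then show ?thesis using W(4)[OF eq1] W(4)[OF p1] pos[of n] by (intro exI[of _ W]) (simp add: F_ratio_def)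
  qed
  then obtain W :: "nat \<Rightarrow> (real^'n) set" where W: "\<And>n. open (W n)" "\<And>n. W n \<noteq> {}" "\<And>n. bounded (W n)"
    "\<And>n. lambda_root (ereal q) (W n) = 1 / F_ratio p q (U n)" "\<And>n. lambda_root p (W n) = 1" by metis
  have 0: "0 \<le> 1 / M" using M by simp
  have 1: "1 / M \<le> lambda_root (ereal q) (W n)" for n using FM[of n] Fpos[of n] by (simp add: W(4) frac_le)
  have "(\<lambda>n. 1 / F_ratio p q (U n)) \<longlonglongrightarrow> 1 / M" using U(4) M by (intro tendsto_divide tendsto_const) auto
  then have 2: "(\<lambda>n. lambda_root (ereal q) (W n)) \<longlonglongrightarrow> 1 / M" by (simp add: W(4))
  have 3: "1 \<le> lambda_root p (W n)" for n by (simp add: W(5))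
  have 4: "(\<lambda>n. lambda_root p (W n)) \<longlonglongrightarrow> 1" by (simp add: W(5))
  obtain \<Omega> :: "(real^'n) set" where \<Omega>: "open \<Omega>" "\<Omega> \<noteq> {}" "discrete (- \<Omega>)" "\<forall>x. \<not> x islimpt (- \<Omega>)"
    "lambda_root (ereal q) \<Omega> = 1 / M" "lambda_root p \<Omega> = 1"
    by (rule discrete_complement_attains_limits[OF q' p 0 zero_le_one W(1-3) 1 2 3 4])
  have "\<Omega> \<in> admissible q" using \<Omega> M by (simp add: admissible_iff[OF q1])
  moreover have "F_ratio p q \<Omega> = M" using \<Omega> by (simp add: F_ratio_def)
  ultimately show ?thesis using that \<Omega>(3,4) by blast
qed

theorem theorem1p3:
  fixes p :: ereal and q :: real
  assumes "real CARD('n::finite) < q" and "ereal q < p"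
  shows "\<exists>(\<Omega>m :: (real^'n) set) (\<Omega>M :: (real^'n) set).
    \<Omega>m \<in> admissible q \<and> \<Omega>M \<in> admissible q \<and>
    ereal (F_ratio p q \<Omega>m) = m_inf TYPE('n) p q \<and>
    ereal (F_ratio p q \<Omega>M) = M_sup TYPE('n) p q \<and>
    discrete (- \<Omega>m) \<and> (\<forall>x. \<not> x islimpt (- \<Omega>m)) \<and>
    discrete (- \<Omega>M) \<and> (\<forall>x. \<not> x islimpt (- \<Omega>M))"
proof -
  let ?A = "admissible q :: (real^'n) set set" and ?F = "\<lambda>\<Omega> :: (real^'n) set. F_ratio p q \<Omega>"
  have q': "real CARD('n) < ereal q" using assms(1) by simp
  have p: "real CARD('n) < p" using q' assms(2) by (rule less_trans)
  have eq1: "1 \<le> ereal q" and p1: "1 \<le> p" using one_le_of_card_less q' p by blast+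
  then have q1: "1 \<le> q" by (simp add: one_ereal_def)
  have B: "ball 0 1 \<in> ?A" using assms(1) by (intro bounded_admissible) auto
  have F0: "0 \<le> ?F \<Omega>" if "\<Omega> \<in> ?A" for \<Omega>
    using that lambda_root_nonneg[of \<Omega>] eq1 p1 by (auto simp: F_ratio_def admissible_def)
  obtain K where K: "\<And>\<Omega> :: (real^'n) set. open \<Omega> \<Longrightarrow> \<Omega> \<noteq> {} \<Longrightarrow> 0 < lambda_root (ereal q) \<Omega> \<Longrightarrow>
    lambda_root p \<Omega> \<le> K * lambda_root (ereal q) \<Omega>" using lambda_root_le_comparable[OF q' p1] by metis
  have FK: "?F \<Omega> \<le> K" if "\<Omega> \<in> ?A" for \<Omega>
    using that K[of \<Omega>] unfolding admissible_iff[OF q1] by (simp add: F_ratio_def pos_divide_le_eq)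
  have m_le: "m_inf TYPE('n) p q \<le> ereal (?F \<Omega>)" if "\<Omega> \<in> ?A" for \<Omega>
    unfolding m_inf_def using that by (rule INF_lower)
  have le_M: "ereal (?F \<Omega>) \<le> M_sup TYPE('n) p q" if "\<Omega> \<in> ?A" for \<Omega>
    unfolding M_sup_def using that by (rule SUP_upper)
  have "0 \<le> m_inf TYPE('n) p q" unfolding m_inf_def using F0 by (intro INF_greatest) simp
  then obtain m where m: "m_inf TYPE('n) p q = ereal m" "0 \<le> m"
    using m_le[OF B] by (cases "m_inf TYPE('n) p q") auto
  have "M_sup TYPE('n) p q \<le> ereal K" unfolding M_sup_def using FK by (intro SUP_least) simp
  then obtain M where M: "M_sup TYPE('n) p q = ereal M"
    using le_M[OF B] by (cases "M_sup TYPE('n) p q") auto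
  have lower: "m \<le> ?F \<Omega>" and upper: "?F \<Omega> \<le> M" if "\<Omega> \<in> ?A" for \<Omega>
    using m_le[OF that] le_M[OF that] m(1) M by simp_all
  have approx_m: "\<exists>\<Omega>\<in>?A. \<bar>?F \<Omega> - m\<bar> < \<delta>" if "0 < \<delta>" for \<delta>
  proof -
    have "m_inf TYPE('n) p q < ereal (m + \<delta>)" using m that by simp
    then obtain \<Omega> where "\<Omega> \<in> ?A" "ereal (?F \<Omega>) < ereal (m + \<delta>)" unfolding m_inf_def INF_less_iff by blast
    then show ?thesis using lower[of \<Omega>] by (intro bexI[of _ \<Omega>]) auto
  qed
  have approx_M: "\<exists>\<Omega>\<in>?A. \<bar>?F \<Omega> - M\<bar> < \<delta>" if "0 < \<delta>" for \<delta>
  proof -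
    have "ereal (M - \<delta>) < M_sup TYPE('n) p q" using M that by simp
    then obtain \<Omega> where "\<Omega> \<in> ?A" "ereal (M - \<delta>) < ereal (?F \<Omega>)" unfolding M_sup_def less_SUP_iff by blast
    then show ?thesis using upper[of \<Omega>] by (intro bexI[of _ \<Omega>]) auto
  qed
  obtain \<Omega>m :: "(real^'n) set" where \<Omega>m: "\<Omega>m \<in> admissible q" "F_ratio p q \<Omega>m = m" "discrete (- \<Omega>m)" "\<forall>x. \<not> x islimpt (- \<Omega>m)"
    by (rule minimum_attained[OF assms(1) p lower approx_m m(2)])
  obtain \<Omega>M :: "(real^'n) set" where \<Omega>M: "\<Omega>M \<in> admissible q" "F_ratio p q \<Omega>M = M" "discrete (- \<Omega>M)" "\<forall>x. \<not> x islimpt (- \<Omega>M)"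
    by (rule maximum_attained[OF assms(1) p upper approx_M])
  show ?thesis using \<Omega>m \<Omega>M m(1) M by (intro exI[of _ \<Omega>m] exI[of _ \<Omega>M]) simp
qed

end
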